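(* Let $N\ge 1$. Let $(a_1,\ldots,a_\ell)$ and $(b_1,\ldots,b_\ell)$ be sequences of nonnegative integers, and let $\mu$ and $\widetilde{\mu}$ be the partitions with exactly $a_j$ and $b_j$ parts of size $j$ ($1\le j\le \ell$), respectively. Then the integral $$\int_{U(N)} \prod_{j=1}^{\ell} \mathrm{Sc}_j(U)^{a_j}\, \overline{\mathrm{Sc}_j(U)^{b_j}}\, dU \qquad\Big(\text{resp. } \int_{U(N)} \prod_{j=1}^{\ell} \big(\mathrm{Tr}\,\mathrm{Sym}^j(U)\big)^{a_j}\, \overline{\big(\mathrm{Tr}\,\mathrm{Sym}^j(U)\big)^{b_j}}\, dU\Big)$$ equals the number of arrays $(x_{i,j})_{1\le i\le\ell(\mu),\,1\le j\le\ell(\widetilde{\mu})}$ of nonnegative integers satisfying each of the following conditions: 1. $x_{1,1}\le N$ (resp. $x_{i,i}=0$ for $N+1\le i\le\min\{\ell(\mu),\ell(\widetilde{\mu})\}$); 2. $x_{i,j}$ is weakly decreasing when either $i$ or $j$ is fixed (i.e. weakly decreasing along each row and along each column); 3. $\sum_{j-i=r-\ell(\mu)} x_{i,j}=\mu_1+\cdots+\mu_r$ for all $1\le r\le\ell(\mu)$, and $\sum_{i-j=s-\ell(\widetilde{\mu})} x_{i,j}=\widetilde{\mu}_1+\cdots+\widetilde{\mu}_s$ for all $1\le s\le\ell(\widetilde{\mu})$, where the sums run over all index pairs $(i,j)$ of the array satisfying the indicated relation.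
   Context: $U(N)$ is the group of $N\times N$ complex unitary matrices with Haar probability measure $dU$. The secular coefficients $\mathrm{Sc}_n(U)$ are defined by $\det(zI+U)=\sum_{n=0}^N z^{N-n}\mathrm{Sc}_n(U)$; that is, $\mathrm{Sc}_n(U)=e_n$ (elementary symmetric polynomial) evaluated at the $N$ eigenvalues of $U$, with $\mathrm{Sc}_n(U)=0$ for $n>N$. $\mathrm{Tr}\,\mathrm{Sym}^j(U)$ is the trace of the $j$th symmetric power of $U$, i.e. the complete homogeneous symmetric polynomial $h_j$ evaluated at the eigenvalues of $U$. A partition is written $\mu=(\mu_1,\mu_2,\ldots)$ with parts in weakly decreasing order, and $\ell(\mu)$ denotes its number of parts. *)

theory Defs
  imports "HOL-Probability.Probability" "HOL-Computational_Algebra.Computational_Algebra"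
begin

definition adjoint_mat :: "complex^'n^'m \<Rightarrow> complex^'m^'n" where
  "adjoint_mat A = transpose (map_matrix cnj A)"

definition unitary_group :: "(complex^'n^'n) set" where
  "unitary_group = {A. adjoint_mat A ** A = mat 1 \<and> A ** adjoint_mat A = mat 1}"

text \<open>
  The Haar probability measure on \<open>U(N)\<close>, \<open>N = CARD('n)\<close>: the (unique) left-invariant
  Borel probability measure.
\<close>

definition haar_unitary :: "(complex^'n^'n) measure \<Rightarrow> bool" where
  "haar_unitary M \<longleftrightarrow>
     prob_space M \<and>
     space M = unitary_group \<and>
     sets M = sets (restrict_space borel unitary_group) \<and>
     (\<forall>A\<in>unitary_group. distr M M (\<lambda>B. A ** B) = M)"

text \<open>
  \<open>det (z I + A)\<close> is taken over the ring of polynomials in \<open>z\<close>.  The case distinction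
  is needed because subtraction on natural numbers truncates.
\<close>

definition secular :: "nat \<Rightarrow> complex^'n^'n \<Rightarrow> complex" where
  "secular n A =
     (if n \<le> CARD('n)
      then coeff (det (mat [:0, 1:] + map_matrix (\<lambda>c. [:c:]) A)) (CARD('n) - n)
      else 0)"

definition char_polynomial :: "complex^'n^'n \<Rightarrow> complex poly" where
  "char_polynomial A = det (mat [:0, 1:] - map_matrix (\<lambda>c. [:c:]) A)"

definition eigenvalues :: "complex^'n^'n \<Rightarrow> complex multiset" where
  "eigenvalues A = proots (char_polynomial A)"

text \<open>
  The complete homogeneous symmetric polynomial \<open>h\<^sub>j\<close> evaluated at the elements of a
  multiset \<open>E\<close>: the sum of all monomials of degree \<open>j\<close>.  There has to be one variable for
  each occurrence of an element, so the variables are indexed by the pairs \<open>(x, k)\<close> with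
  \<open>k < count E x\<close>, and the variable \<open>(x, k)\<close> has value \<open>x\<close>.  A monomial of degree \<open>j\<close> is a
  multiset of \<open>j\<close> indices.
\<close>

definition complete_homogeneous :: "nat \<Rightarrow> 'a::comm_semiring_1 multiset \<Rightarrow> 'a" where
  "complete_homogeneous j E =
     (\<Sum>K | set_mset K \<subseteq> {(x, k). k < count E x} \<and> size K = j. \<Prod>p\<in>#K. fst p)"

text \<open>
  The trace of the \<open>j\<close>th symmetric power of \<open>A\<close>, expressed through the eigenvalues of \<open>A\<close>
  counted with algebraic multiplicity.
\<close>

definition tr_sym :: "nat \<Rightarrow> complex^'n^'n \<Rightarrow> complex" where
  "tr_sym j A = complete_homogeneous j (eigenvalues A)"

definition is_partition :: "nat list \<Rightarrow> bool" where
  "is_partition \<mu> \<longleftrightarrow> sorted_wrt (\<ge>) \<mu> \<and> 0 \<notin> set \<mu>"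

definition partition_with_mults :: "nat \<Rightarrow> (nat \<Rightarrow> nat) \<Rightarrow> nat list \<Rightarrow> bool" where
  "partition_with_mults l a \<mu> \<longleftrightarrow>
     is_partition \<mu> \<and> set \<mu> \<subseteq> {1..l} \<and> (\<forall>j\<in>{1..l}. count_list \<mu> j = a j)"

text \<open>
  Arrays with index set \<open>{1..p} \<times> {1..q}\<close> are represented by functions vanishing outside this
  set, so that each array has exactly one representative.
\<close>

definition is_array :: "nat \<Rightarrow> nat \<Rightarrow> (nat \<Rightarrow> nat \<Rightarrow> nat) \<Rightarrow> bool" where
  "is_array p q x \<longleftrightarrow> (\<forall>i j. \<not> (i \<in> {1..p} \<and> j \<in> {1..q}) \<longrightarrow> x i j = 0)"

definition decreasing_array :: "nat \<Rightarrow> nat \<Rightarrow> (nat \<Rightarrow> nat \<Rightarrow> nat) \<Rightarrow> bool" where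
  "decreasing_array p q x \<longleftrightarrow>
     (\<forall>i\<in>{1..p}. \<forall>j\<in>{1..q}. \<forall>j'\<in>{1..q}. j \<le> j' \<longrightarrow> x i j' \<le> x i j) \<and>
     (\<forall>j\<in>{1..q}. \<forall>i\<in>{1..p}. \<forall>i'\<in>{1..p}. i \<le> i' \<longrightarrow> x i' j \<le> x i j)"

definition diagonal_sum :: "nat \<Rightarrow> nat \<Rightarrow> (nat \<Rightarrow> nat \<Rightarrow> nat) \<Rightarrow> int \<Rightarrow> nat" where
  "diagonal_sum p q x d = (\<Sum>(i, j) | i \<in> {1..p} \<and> j \<in> {1..q} \<and> int j - int i = d. x i j)"

text \<open>
  The second family of conditions concerns the diagonals \<open>i - j = s - length \<nu>\<close>, that is
  \<open>j - i = length \<nu> - s\<close>.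
\<close>

definition diagonal_condition :: "nat list \<Rightarrow> nat list \<Rightarrow> (nat \<Rightarrow> nat \<Rightarrow> nat) \<Rightarrow> bool" where
  "diagonal_condition \<mu> \<nu> x \<longleftrightarrow>
     (\<forall>r\<in>{1..length \<mu>}.
        diagonal_sum (length \<mu>) (length \<nu>) x (int r - int (length \<mu>)) = sum_list (take r \<mu>)) \<and>
     (\<forall>s\<in>{1..length \<nu>}.
        diagonal_sum (length \<mu>) (length \<nu>) x (int (length \<nu>) - int s) = sum_list (take s \<nu>))"

text \<open>
  If the index set is empty, then \<open>x 1 1 = 0\<close> by the representation of arrays, so the condition
  on the corner entry is vacuous in that case, as it should be.
\<close>

definition secular_arrays :: "nat \<Rightarrow> nat list \<Rightarrow> nat list \<Rightarrow> (nat \<Rightarrow> nat \<Rightarrow> nat) set" where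
  "secular_arrays N \<mu> \<nu> =
     {x. is_array (length \<mu>) (length \<nu>) x \<and>
         x 1 1 \<le> N \<and>
         decreasing_array (length \<mu>) (length \<nu>) x \<and>
         diagonal_condition \<mu> \<nu> x}"

definition sym_arrays :: "nat \<Rightarrow> nat list \<Rightarrow> nat list \<Rightarrow> (nat \<Rightarrow> nat \<Rightarrow> nat) set" where
  "sym_arrays N \<mu> \<nu> =
     {x. is_array (length \<mu>) (length \<nu>) x \<and>
         (\<forall>i\<in>{N + 1..min (length \<mu>) (length \<nu>)}. x i i = 0) \<and>
         decreasing_array (length \<mu>) (length \<nu>) x \<and>
         diagonal_condition \<mu> \<nu> x}"

end

theory Submission
  imports Defs
begin

text \<open>
  Class functions on \<open>U(N)\<close> that are polynomial in the entries of \<open>U\<close> and \<open>U\<inverse>\<close> are studied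
  through their restrictions \<open>f\<close> to the diagonal torus.  Let \<open>a\<^sub>\<lambda>\<close> be the alternant
  \<open>det (t\<^sub>i ^ (\<lambda>\<^sub>j + \<rho>\<^sub>j))\<close>, for \<open>\<lambda>\<close> a weakly decreasing integer sequence of length \<open>N\<close>.
  If \<open>a\<^sub>0 f = \<Sum> c\<^sub>\<lambda> a\<^sub>\<lambda>\<close>, then the Haar integral of the function is \<open>c\<^sub>0\<close>.  Indeed, the Laplacian
  \<open>\<Delta> = \<Sum> D\<^sub>a\<^sub>b D\<^sub>b\<^sub>a\<close> multiplies the term of \<open>\<lambda>\<close> by the Casimir value
  \<open>|\<lambda> + \<rho>|\<^sup>2 - |\<rho>|\<^sup>2 - (N - 1) \<Sum> \<lambda>\<^sub>i\<close>, which is positive for \<open>\<lambda> \<noteq> 0\<close>, while \<open>\<integral> \<Delta> F = 0\<close> by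
  invariance; so the terms with \<open>\<lambda> \<noteq> 0\<close> can be removed one after the other by replacing \<open>F\<close>
  with \<open>F - \<Delta> F / E\<close>.

  By the Pieri rules, multiplying \<open>a\<^sub>\<lambda>\<close> by \<open>e\<^sub>r\<close> or \<open>h\<^sub>r\<close> (or their conjugates) adds (or removes) vertical or
  horizontal strips.  Hence the integrals count closed walks \<open>0 \<rightarrow> \<dots> \<rightarrow> 0\<close> of partitions that first
  add strips of sizes \<open>\<mu>\<^sub>1, \<mu>\<^sub>2, \<dots>\<close> and then remove strips of sizes \<open>\<dots>, \<nu>\<^sub>2, \<nu>\<^sub>1\<close>.  The
  partitions of a walk of horizontal strips are the diagonals of an array; a walk of vertical
  strips is first conjugated.
\<close>

text \<open>The measure is known only through translation invariance, so no density on the torus is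
  available. Invariance gives that the derivative of a polynomial function along a skew-Hermitian
  direction has integral 0, and complex combinations of such directions yield every matrix unit.
  Among the resulting second-order operators the Laplacian is chosen because it maps class functions
  to class functions and because its action on the torus can be computed: multiplication by
  \<open>alt (\<lambda>_. 0)\<close> turns it into an operator with constant coefficients in the
  \<open>t\<^sub>a \<partial>/\<partial>t\<^sub>a\<close>, for which alternants are eigenfunctions.
  The term \<open>(N - 1) \<Sum> \<lambda>\<^sub>i\<close> of the eigenvalue comes from the
  exponents N - 1, ..., 0 used for \<open>rho\<close> instead of centred ones. Positivity of the
  eigenvalues thus takes the place of Weyl's integration formula and of the orthogonality of
  characters.\<close>

no_notation fps_nth (infixl "$" 75)

section \<open>Polynomial functions on the general linear group\<close>

text \<open>Formal expressions instead of functions: a derivative is again an expression and can be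
  differentiated again. Entries of the inverse are separate generators, evaluated at a second
  matrix; on U(N) that matrix is the adjoint, which brings in complex conjugates.\<close>

datatype 'n matpoly =
    Const complex
  | Entry 'n 'n
  | Inv 'n 'n
  | Plus "'n matpoly" "'n matpoly"
  | Times "'n matpoly" "'n matpoly"

primrec eval_mp :: "'n matpoly \<Rightarrow> complex^'n^'n \<Rightarrow> complex^'n^'n \<Rightarrow> complex" where
  "eval_mp (Const c) A B = c"
| "eval_mp (Entry i j) A B = A $ i $ j"
| "eval_mp (Inv i j) A B = B $ i $ j"
| "eval_mp (Plus p q) A B = eval_mp p A B + eval_mp q A B"
| "eval_mp (Times p q) A B = eval_mp p A B * eval_mp q A B"

primrec derivation :: "('n \<Rightarrow> 'n \<Rightarrow> 'n matpoly) \<Rightarrow> ('n \<Rightarrow> 'n \<Rightarrow> 'n matpoly) \<Rightarrow> 'n matpoly \<Rightarrow> 'n matpoly" where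
  "derivation f g (Const c) = Const 0"
| "derivation f g (Entry i j) = f i j"
| "derivation f g (Inv i j) = g i j"
| "derivation f g (Plus p q) = Plus (derivation f g p) (derivation f g q)"
| "derivation f g (Times p q) = Plus (Times (derivation f g p) q) (Times p (derivation f g q))"

text \<open>\<open>Inv i j\<close> stands for an entry of the inverse matrix.  Thus \<open>left_deriv a b\<close> and \<open>right_deriv a b\<close> are the
  derivatives at \<open>s = 0\<close> along \<open>(1 + s E\<^sub>a\<^sub>b) A\<close> and \<open>A (1 + s E\<^sub>a\<^sub>b)\<close>.\<close>

definition left_deriv :: "'n \<Rightarrow> 'n \<Rightarrow> 'n matpoly \<Rightarrow> 'n matpoly" where
  "left_deriv a b = derivation (\<lambda>i j. if i = a then Entry b j else Const 0)
                       (\<lambda>i j. if j = b then Times (Const (-1)) (Inv i a) else Const 0)"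

definition right_deriv :: "'n \<Rightarrow> 'n \<Rightarrow> 'n matpoly \<Rightarrow> 'n matpoly" where
  "right_deriv a b = derivation (\<lambda>i j. if j = b then Entry i a else Const 0)
                       (\<lambda>i j. if i = a then Times (Const (-1)) (Inv b j) else Const 0)"

lemma left_deriv_simps [simp]:
  "left_deriv a b (Const c) = Const 0"
  "left_deriv a b (Entry i j) = (if i = a then Entry b j else Const 0)"
  "left_deriv a b (Inv i j) = (if j = b then Times (Const (-1)) (Inv i a) else Const 0)"
  "left_deriv a b (Plus p q) = Plus (left_deriv a b p) (left_deriv a b q)"
  "left_deriv a b (Times p q) = Plus (Times (left_deriv a b p) q) (Times p (left_deriv a b q))"
  by (simp_all add: left_deriv_def)

lemma right_deriv_simps [simp]:
  "right_deriv a b (Const c) = Const 0"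
  "right_deriv a b (Entry i j) = (if j = b then Entry i a else Const 0)"
  "right_deriv a b (Inv i j) = (if i = a then Times (Const (-1)) (Inv b j) else Const 0)"
  "right_deriv a b (Plus p q) = Plus (right_deriv a b p) (right_deriv a b q)"
  "right_deriv a b (Times p q) = Plus (Times (right_deriv a b p) q) (Times p (right_deriv a b q))"
  by (simp_all add: right_deriv_def)

lemma matrix_mult_entry: "(A ** B) $ i $ j = (\<Sum>k\<in>UNIV. A $ i $ k * B $ k $ j)"
  by (simp add: matrix_matrix_mult_def)

text \<open>If H is inverse to G and G' = X G - G Y, then H' = Y H - H X. This form covers left
  translations (Y = 0) and conjugations (X = Y) at once.\<close>

lemma eval_mp_has_vector_derivative:
  fixes G H :: "real \<Rightarrow> complex^'n^'n"
  assumes G: "\<And>i j. ((\<lambda>s. G s $ i $ j) has_vector_derivative (X ** G s0 - G s0 ** Y) $ i $ j) (at s0)"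
    and H: "\<And>i j. ((\<lambda>s. H s $ i $ j) has_vector_derivative (Y ** H s0 - H s0 ** X) $ i $ j) (at s0)"
  shows "((\<lambda>s. eval_mp e (G s) (H s)) has_vector_derivative
           (\<Sum>a\<in>UNIV. \<Sum>b\<in>UNIV. X $ a $ b * eval_mp (left_deriv a b e) (G s0) (H s0)) -
           (\<Sum>a\<in>UNIV. \<Sum>b\<in>UNIV. Y $ a $ b * eval_mp (right_deriv a b e) (G s0) (H s0))) (at s0)"
proof (induction e)
  case (Const c)
  show ?case by simp
next
  case (Entry i j)
  have 1: "(\<Sum>a\<in>UNIV. \<Sum>b\<in>UNIV. X $ a $ b * eval_mp (left_deriv a b (Entry i j)) (G s0) (H s0)) = (X ** G s0) $ i $ j"
    by (simp add: matrix_mult_entry if_distrib if_distribR sum.If_cases cong: if_cong)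
  have 2: "(\<Sum>a\<in>UNIV. \<Sum>b\<in>UNIV. Y $ a $ b * eval_mp (right_deriv a b (Entry i j)) (G s0) (H s0)) = (G s0 ** Y) $ i $ j"
    by (simp add: matrix_mult_entry if_distrib if_distribR sum.If_cases mult.commute cong: if_cong)
  show ?case unfolding 1 2 using G by simp
next
  case (Inv i j)
  have 1: "(\<Sum>a\<in>UNIV. \<Sum>b\<in>UNIV. X $ a $ b * eval_mp (left_deriv a b (Inv i j)) (G s0) (H s0)) = - (H s0 ** X) $ i $ j"
    by (simp add: matrix_mult_entry if_distrib if_distribR sum.If_cases mult.commute sum_negf cong: if_cong)
  have 2: "(\<Sum>a\<in>UNIV. \<Sum>b\<in>UNIV. Y $ a $ b * eval_mp (right_deriv a b (Inv i j)) (G s0) (H s0)) = - (Y ** H s0) $ i $ j"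
    by (simp add: matrix_mult_entry if_distrib if_distribR sum.If_cases mult.commute sum_negf cong: if_cong)
  show ?case unfolding 1 2 using H by simp
next
  case (Plus p q)
  from has_vector_derivative_add[OF Plus.IH] show ?case
    by (simp add: distrib_left sum.distrib algebra_simps)
next
  case (Times p q)
  show ?case
    unfolding eval_mp.simps
    by (rule has_vector_derivative_eq_rhs[OF has_vector_derivative_mult[OF Times.IH]])
       (simp add: distrib_left sum.distrib algebra_simps sum_distrib_left)
qed

text \<open>A commutator of derivations is a derivation, so the generators decide; in the product
  case the mixed terms cancel. The sign is opposite to that of the matrix commutator
  \<open>E\<^sub>a\<^sub>a - E\<^sub>b\<^sub>b\<close> because left translations, acting on
  functions, compose in reverse order.\<close>

lemma left_deriv_commutator:
  "eval_mp (left_deriv a b (left_deriv b a e)) A B - eval_mp (left_deriv b a (left_deriv a b e)) A B = eval_mp (left_deriv b b e) A B - eval_mp (left_deriv a a e) A B"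
proof (induction e)
  case (Times p q)
  have "eval_mp (left_deriv a b (left_deriv b a (Times p q))) A B - eval_mp (left_deriv b a (left_deriv a b (Times p q))) A B
     = (eval_mp (left_deriv a b (left_deriv b a p)) A B - eval_mp (left_deriv b a (left_deriv a b p)) A B) * eval_mp q A B
     + eval_mp p A B * (eval_mp (left_deriv a b (left_deriv b a q)) A B - eval_mp (left_deriv b a (left_deriv a b q)) A B)"
    by (simp add: algebra_simps)
  then show ?case unfolding Times.IH by (simp add: algebra_simps)
qed (auto simp: algebra_simps)

lemma left_deriv_right_deriv_commute: "eval_mp (left_deriv a b (right_deriv c d e)) A B = eval_mp (right_deriv c d (left_deriv a b e)) A B"
  by (induction e) (auto simp: algebra_simps)

section \<open>One-parameter groups of elementary matrices and derivatives along them\<close>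

definition is_inv :: "complex^'n^'n \<Rightarrow> complex^'n^'n \<Rightarrow> bool" where
  "is_inv A B \<longleftrightarrow> A ** B = mat 1 \<and> B ** A = mat 1"

text \<open>The exponential on the diagonal makes \<open>s \<mapsto> elementary a b s\<close> a one-parameter group also for \<open>a = b\<close>.\<close>

definition elementary :: "'n \<Rightarrow> 'n \<Rightarrow> real \<Rightarrow> complex^'n^'n" where
  "elementary a b s = (\<chi> i j. (if i = j then 1 else 0) +
                  (if i = a \<and> j = b then (if a = b then exp (of_real s) - 1 else of_real s) else 0))"

definition unit_mat :: "'n \<Rightarrow> 'n \<Rightarrow> complex^'n^'n" where
  "unit_mat a b = (\<chi> i j. if i = a \<and> j = b then 1 else 0)"

lemma elementary_0: "elementary a b 0 = mat 1"
  by (auto simp: elementary_def mat_def vec_eq_iff)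

lemma elementary_mult_entry:
  "(elementary a b s ** A) $ i $ j =
     A $ i $ j + (if i = a then (if a = b then exp (of_real s) - 1 else of_real s) * A $ b $ j else 0)"
proof -
  have "(elementary a b s ** A) $ i $ j = (\<Sum>k\<in>UNIV. (if k = i then A $ i $ j else 0) +
     (if k = b then (if i = a then (if a = b then exp (of_real s) - 1 else of_real s) * A $ b $ j else 0) else 0))"
    unfolding matrix_mult_entry by (intro sum.cong) (auto simp: elementary_def algebra_simps)
  then show ?thesis by (simp add: sum.distrib)
qed

lemma mult_elementary_entry:
  "(A ** elementary a b s) $ i $ j =
     A $ i $ j + (if j = b then (if a = b then exp (of_real s) - 1 else of_real s) * A $ i $ a else 0)"
proof -
  have "(A ** elementary a b s) $ i $ j = (\<Sum>k\<in>UNIV. (if k = j then A $ i $ k else 0) +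
     (if k = a then (if j = b then (if a = b then exp (of_real s) - 1 else of_real s) * A $ i $ a else 0) else 0))"
    unfolding matrix_mult_entry by (intro sum.cong) (auto simp: elementary_def algebra_simps)
  then show ?thesis by (simp add: sum.distrib)
qed

lemma is_inv_elementary: "is_inv (elementary a b s) (elementary a b (- s))"
proof -
  have "elementary a b s ** elementary a b (- s) = mat 1" for s
    unfolding vec_eq_iff elementary_mult_entry
    by (auto simp: elementary_def mat_def algebra_simps simp flip: exp_add)
  from this[of s] this[of "- s"] show ?thesis by (simp add: is_inv_def)
qed

lemma is_inv_mult:
  assumes "is_inv A B" "is_inv C D"
  shows "is_inv (A ** C) (D ** B)"
proof -
  have "A ** C ** (D ** B) = A ** (C ** D) ** B" "D ** B ** (A ** C) = D ** (B ** A) ** C"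
    by (simp_all add: matrix_mul_assoc)
  with assms show ?thesis by (simp add: is_inv_def)
qed

lemma is_inv_sym: "is_inv A B \<Longrightarrow> is_inv B A"
  by (auto simp: is_inv_def)

lemma is_inv_conj: "is_inv A B \<Longrightarrow> is_inv g h \<Longrightarrow> is_inv (g ** A ** h) (g ** B ** h)"
  using is_inv_mult[of "g ** A" "B ** h" h g] is_inv_mult[of g h A B] is_inv_sym[of g h]
  by (simp add: matrix_mul_assoc)

lemma unit_mat_mult_entry: "(unit_mat a b ** A) $ i $ j = (if i = a then A $ b $ j else 0)"
proof -
  have "(unit_mat a b ** A) $ i $ j = (\<Sum>k\<in>UNIV. if k = b then if i = a then A $ b $ j else 0 else 0)"
    unfolding matrix_mult_entry by (intro sum.cong) (auto simp: unit_mat_def)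
  then show ?thesis by simp
qed

lemma has_vector_derivative_exp_real:
  "((\<lambda>s. exp (complex_of_real s) - 1) has_vector_derivative 1) (at 0)"
proof -
  have "((\<lambda>z. exp z - 1) has_field_derivative (1::complex)) (at (of_real 0))"
    by (auto intro!: derivative_eq_intros)
  from has_vector_derivative_real_field[OF this] show ?thesis by simp
qed

lemma elementary_has_vector_derivative:
  "((\<lambda>s. elementary a b s $ i $ j) has_vector_derivative unit_mat a b $ i $ j) (at 0)"
proof -
  define \<phi> where "\<phi> s = (if i = a \<and> j = b then if a = b then exp (complex_of_real s) - 1 else of_real s else 0)" for s
  have 1: "((\<lambda>s. complex_of_real s) has_vector_derivative 1) (at 0)"
    using has_vector_derivative_of_real[OF DERIV_ident] by simp
  have "(\<phi> has_vector_derivative unit_mat a b $ i $ j) (at 0)"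
    unfolding \<phi>_def unit_mat_def using has_vector_derivative_exp_real 1
    by (cases "i = a \<and> j = b"; cases "a = b"; simp del: de_Morgan_conj)
  from has_vector_derivative_add[OF has_vector_derivative_const[of "if i = j then 1 else 0"] this]
  show ?thesis by (simp add: elementary_def \<phi>_def)
qed

lemma elementary_minus_has_vector_derivative:
  "((\<lambda>s. elementary a b (- s) $ i $ j) has_vector_derivative (- unit_mat a b) $ i $ j) (at 0)"
  using vector_diff_chain_at[of uminus "-1" 0 "\<lambda>s. elementary a b s $ i $ j" "unit_mat a b $ i $ j"]
    elementary_has_vector_derivative[of a b i j] has_vector_derivative_minus[OF has_vector_derivative_id[of "at (0::real)"]]
  by (simp add: o_def)

lemma has_vector_derivative_matrix_mult:
  assumes P: "\<And>i j. ((\<lambda>s. P s $ i $ j) has_vector_derivative P' $ i $ j) (at s0)"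
    and Q: "\<And>i j. ((\<lambda>s. Q s $ i $ j) has_vector_derivative Q' $ i $ j) (at s0)"
  shows "((\<lambda>s. (P s ** Q s) $ i $ j :: complex) has_vector_derivative (P' ** Q s0 + P s0 ** Q') $ i $ j) (at s0)"
  unfolding matrix_mult_entry vector_add_component sum.distrib[symmetric]
  by (rule has_vector_derivative_sum)
     (rule has_vector_derivative_eq_rhs[OF has_vector_derivative_mult[OF P Q]], simp)

lemma has_vector_derivative_sandwich:
  fixes C D :: "complex^'n^'n"
  assumes P: "\<And>i j. ((\<lambda>s. P s $ i $ j) has_vector_derivative P' $ i $ j) (at s0)"
  shows "((\<lambda>s. (C ** P s ** D) $ i $ j) has_vector_derivative (C ** P' ** D) $ i $ j) (at s0)"
proof -
  have 1: "((\<lambda>s. (C ** P s) $ i $ j) has_vector_derivative (C ** P') $ i $ j) (at s0)" for i j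
    using has_vector_derivative_matrix_mult[of "\<lambda>_. C" 0 s0 P P', OF _ P] by simp
  show ?thesis
    using has_vector_derivative_matrix_mult[of "\<lambda>s. C ** P s" "C ** P'" s0 "\<lambda>_. D" 0, OF 1] by simp
qed

lemma sum_unit_mat: "(\<Sum>c\<in>UNIV. \<Sum>d\<in>UNIV. unit_mat a b $ c $ d * f c d) = (f a b :: complex)"
proof -
  have "(\<Sum>c\<in>UNIV. \<Sum>d\<in>UNIV. unit_mat a b $ c $ d * f c d) =
      (\<Sum>c\<in>UNIV. if c = a then \<Sum>d\<in>UNIV. if d = b then f a b else 0 else 0)"
    by (intro sum.cong refl) (auto simp: unit_mat_def mult_if_delta intro!: sum.neutral)
  then show ?thesis by simp
qed

lemma matrix_mult_minus_right: "A ** (- B) = - (A ** B :: complex^'n^'n)"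
  by (simp add: vec_eq_iff matrix_mult_entry sum_negf)

lemma matrix_mult_minus_left: "(- A) ** B = - (A ** B :: complex^'n^'n)"
  by (simp add: vec_eq_iff matrix_mult_entry sum_negf)

text \<open>The curve multiplies from the left by a conjugate of \<open>elementary a b s\<close>,
  with velocity \<open>h ** unit_mat a b ** g\<close>. This tells how left derivatives transform
  under conjugation.\<close>

lemma eval_mp_left_translation:
  assumes "is_inv g h"
  shows "((\<lambda>s. eval_mp e (h ** elementary a b s ** g ** A) (B ** h ** elementary a b (- s) ** g)) has_vector_derivative
     (\<Sum>c\<in>UNIV. \<Sum>d\<in>UNIV. (h ** unit_mat a b ** g) $ c $ d * eval_mp (left_deriv c d e) A B)) (at 0)"
proof -
  have gh: "h ** g = mat 1" "g ** h = mat 1" using assms by (auto simp: is_inv_def)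
  have hg: "g ** (h ** X) = X" "h ** (g ** X) = X" for X :: "complex^'a^'a"
    by (simp_all add: matrix_mul_assoc gh)
  have G0: "h ** elementary a b 0 ** g ** A = A" "B ** h ** elementary a b (- 0) ** g = B"
    by (simp_all add: elementary_0 gh flip: matrix_mul_assoc)
  have 1: "((\<lambda>s. (h ** elementary a b s ** g ** A) $ i $ j) has_vector_derivative
      ((h ** unit_mat a b ** g) ** (h ** elementary a b 0 ** g ** A) - (h ** elementary a b 0 ** g ** A) ** 0) $ i $ j) (at 0)" for i j
    unfolding G0 using has_vector_derivative_sandwich[of "elementary a b" "unit_mat a b" 0 h "g ** A", OF elementary_has_vector_derivative]
    by (simp add: matrix_mul_assoc)
  have 2: "((\<lambda>s. (B ** h ** elementary a b (- s) ** g) $ i $ j) has_vector_derivative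
      (0 ** (B ** h ** elementary a b (- 0) ** g) - (B ** h ** elementary a b (- 0) ** g) ** (h ** unit_mat a b ** g)) $ i $ j) (at 0)" for i j
    unfolding G0
    using has_vector_derivative_sandwich[of "\<lambda>s. elementary a b (- s)" "- unit_mat a b" 0 "B ** h" g, OF elementary_minus_has_vector_derivative]
    by (simp add: matrix_mul_assoc matrix_mult_minus_right matrix_mult_minus_left)
  show ?thesis
    using eval_mp_has_vector_derivative[OF 1 2] unfolding G0 by simp
qed

lemma eval_mp_left_translation_elementary:
  "((\<lambda>s. eval_mp e (elementary a b s ** A) (B ** elementary a b (- s))) has_vector_derivative eval_mp (left_deriv a b e) A B) (at 0)"
  using eval_mp_left_translation[of "mat 1" "mat 1" e a b A B] by (simp add: is_inv_def sum_unit_mat)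

lemma eval_mp_conjugation_elementary:
  "((\<lambda>s. eval_mp e (elementary a b s ** A ** elementary a b (- s)) (elementary a b s ** B ** elementary a b (- s))) has_vector_derivative
      eval_mp (left_deriv a b e) A B - eval_mp (right_deriv a b e) A B) (at 0)"
proof -
  have 0: "elementary a b 0 ** A ** elementary a b (- 0) = A" for A :: "complex^'a^'a" by (simp add: elementary_0)
  have 1: "((\<lambda>s. (elementary a b s ** A ** elementary a b (- s)) $ i $ j) has_vector_derivative
     (unit_mat a b ** (elementary a b 0 ** A ** elementary a b (- 0)) - (elementary a b 0 ** A ** elementary a b (- 0)) ** unit_mat a b) $ i $ j) (at 0)" for i j and A :: "complex^'a^'a"
  proof -
    have "((\<lambda>s. (elementary a b s ** A) $ i $ j) has_vector_derivative (unit_mat a b ** A) $ i $ j) (at 0)" for i j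
      using has_vector_derivative_sandwich[of "elementary a b" "unit_mat a b" 0 "mat 1" A, OF elementary_has_vector_derivative] by simp
    from has_vector_derivative_matrix_mult[of "\<lambda>s. elementary a b s ** A" _ 0 "\<lambda>s. elementary a b (- s)" "- unit_mat a b", OF this elementary_minus_has_vector_derivative]
    show ?thesis by (simp add: elementary_0 matrix_mult_minus_right)
  qed
  show ?thesis
    using eval_mp_has_vector_derivative[OF 1 1, where e=e] unfolding 0 by (simp add: sum_unit_mat)
qed

text \<open>Invariance is demanded under conjugation by all invertible matrices, not only unitary
  ones, because it is differentiated along the curves \<open>elementary a b s\<close>, which leave
  U(N).\<close>

definition class_fn :: "'n::finite matpoly \<Rightarrow> bool" where
  "class_fn e \<longleftrightarrow> (\<forall>A B g h. is_inv A B \<longrightarrow> is_inv g h \<longrightarrow> eval_mp e (g ** A ** h) (g ** B ** h) = eval_mp e A B)"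

lemma is_inv_left_elementary: "is_inv A B \<Longrightarrow> is_inv (elementary a b s ** A) (B ** elementary a b (- s))"
  by (simp add: is_inv_elementary is_inv_mult)

text \<open>The curve behind the left derivative stays among pairs of mutually inverse matrices, so
  agreement on such pairs determines the derivative.\<close>

lemma left_deriv_cong:
  assumes "\<And>A B. is_inv A B \<Longrightarrow> eval_mp p A B = eval_mp q A B" and "is_inv A B"
  shows "eval_mp (left_deriv a b p) A B = eval_mp (left_deriv a b q) A B"
  using eval_mp_left_translation_elementary[of p a b A B] eval_mp_left_translation_elementary[of q a b A B]
    assms(1)[OF is_inv_left_elementary[OF assms(2)]]
  by (simp add: vector_derivative_unique_at)

text \<open>Differentiate the constancy of e along conjugation by
  \<open>elementary a b s\<close>.\<close>

lemma class_fn_left_deriv_eq_right_deriv: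
  assumes "class_fn e" "is_inv A B"
  shows "eval_mp (left_deriv a b e) A B = eval_mp (right_deriv a b e) A B"
proof -
  have "eval_mp e (elementary a b s ** A ** elementary a b (- s)) (elementary a b s ** B ** elementary a b (- s)) = eval_mp e A B" for s
    using assms is_inv_elementary unfolding class_fn_def by blast
  then have "((\<lambda>s. eval_mp e A B) has_vector_derivative eval_mp (left_deriv a b e) A B - eval_mp (right_deriv a b e) A B) (at 0)"
    using eval_mp_conjugation_elementary[of e a b A B] by simp
  then show ?thesis
    using vector_derivative_unique_at[OF _ has_vector_derivative_const[of "eval_mp e A B"]] by fastforce
qed

text \<open>Stated for a linear combination because the Laplacian needs it twice: first for e
  itself, a sum with one term, and then for the combination of first derivatives that this
  produces.\<close>

lemma left_deriv_conj:
  assumes e: "\<And>A B. is_inv A B \<Longrightarrow> eval_mp e (g ** A ** h) (g ** B ** h) = (\<Sum>k\<in>K. c k * eval_mp (f k) A B)"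
    and gh: "is_inv g h" and AB: "is_inv A B"
  shows "eval_mp (left_deriv a b e) (g ** A ** h) (g ** B ** h) =
    (\<Sum>k\<in>K. c k * (\<Sum>p\<in>UNIV. \<Sum>q\<in>UNIV. h $ p $ a * g $ b $ q * eval_mp (left_deriv p q (f k)) A B))"
proof -
  have gh1: "h ** g = mat 1" "g ** h = mat 1" using gh by (auto simp: is_inv_def)
  have hg: "g ** (h ** X) = X" "h ** (g ** X) = X" for X :: "complex^'a^'a"
    by (simp_all add: matrix_mul_assoc gh1)
  define G where "G s = h ** elementary a b s ** g ** A" for s
  define H where "H s = B ** h ** elementary a b (- s) ** g" for s
  have inv: "is_inv (G s) (H s)" for s
    unfolding G_def H_def
    using is_inv_mult[OF is_inv_conj[OF is_inv_elementary is_inv_sym[OF gh]] AB] by (simp add: matrix_mul_assoc)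
  have "elementary a b s ** (g ** A ** h) = g ** G s ** h" "(g ** B ** h) ** elementary a b (- s) = g ** H s ** h" for s
    unfolding G_def H_def by (simp_all add: hg gh1 flip: matrix_mul_assoc)
  then have "eval_mp e (elementary a b s ** (g ** A ** h)) ((g ** B ** h) ** elementary a b (- s)) =
      (\<Sum>k\<in>K. c k * eval_mp (f k) (G s) (H s))" for s
    using e[OF inv] by simp
  then have 1: "((\<lambda>s. \<Sum>k\<in>K. c k * eval_mp (f k) (G s) (H s)) has_vector_derivative eval_mp (left_deriv a b e) (g ** A ** h) (g ** B ** h)) (at 0)"
    using eval_mp_left_translation_elementary[of e a b "g ** A ** h" "g ** B ** h"] by simp
  have 2: "((\<lambda>s. \<Sum>k\<in>K. c k * eval_mp (f k) (G s) (H s)) has_vector_derivative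
    (\<Sum>k\<in>K. c k * (\<Sum>p\<in>UNIV. \<Sum>q\<in>UNIV. (h ** unit_mat a b ** g) $ p $ q * eval_mp (left_deriv p q (f k)) A B))) (at 0)"
    unfolding G_def H_def
    by (intro has_vector_derivative_sum has_vector_derivative_mult_right eval_mp_left_translation gh)
  have 3: "(h ** unit_mat a b ** g) $ p $ q = h $ p $ a * g $ b $ q" for p q
    unfolding matrix_mul_assoc[symmetric]
    by (simp add: matrix_mult_entry[of h] unit_mat_mult_entry if_distrib cong: if_cong)
  show ?thesis using vector_derivative_unique_at[OF 1 2] unfolding 3 .
qed

text \<open>The tensor \<open>\<Sum> E\<^sub>a\<^sub>b \<otimes> E\<^sub>b\<^sub>a\<close> is
  invariant under conjugation: each derivative contributes one entry of g and one of h, and the sums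
  over a and b contract them to deltas.\<close>

lemma class_fn_laplacian:
  assumes e: "class_fn e" and L: "\<And>A B. eval_mp L A B = (\<Sum>a\<in>UNIV. \<Sum>b\<in>UNIV. eval_mp (left_deriv a b (left_deriv b a e)) A B)"
  shows "class_fn L"
  unfolding class_fn_def
proof (intro allI impI)
  fix A B g h :: "complex^'a^'a" assume AB: "is_inv A B" and gh: "is_inv g h"
  have e1: "eval_mp e (g ** A ** h) (g ** B ** h) = (\<Sum>k\<in>{()}. 1 * eval_mp e A B)" if "is_inv A B" for A B
    using e that gh by (simp add: class_fn_def)
  have "eval_mp (left_deriv b a e) (g ** A ** h) (g ** B ** h) = (\<Sum>k\<in>{()}. 1 * (\<Sum>p\<in>UNIV. \<Sum>q\<in>UNIV. h $ p $ b * g $ a $ q * eval_mp (left_deriv p q e) A B))"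
    if "is_inv A B" for A B a b
    by (rule left_deriv_conj[OF e1 gh that])
  then have e2: "eval_mp (left_deriv b a e) (g ** A ** h) (g ** B ** h) = (\<Sum>k\<in>UNIV\<times>UNIV. (h $ fst k $ b * g $ a $ snd k) * eval_mp (left_deriv (fst k) (snd k) e) A B)"
    if "is_inv A B" for A B a b
    using that by (simp add: sum.cartesian_product split_def)
  have gh1: "(\<Sum>b\<in>UNIV. h $ p $ b * g $ b $ q) = (if p = q then 1 else 0)" for p q
    using gh by (auto simp: is_inv_def mat_def vec_eq_iff matrix_mult_entry)
  have pairs: "(\<Sum>k\<in>UNIV\<times>UNIV. F (fst k) (snd k)) = (\<Sum>p\<in>UNIV. \<Sum>q\<in>UNIV. F p q)" for F :: "'a \<Rightarrow> 'a \<Rightarrow> complex"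
    by (simp add: sum.cartesian_product split_def)
  have deltas: "(\<Sum>p\<in>UNIV. \<Sum>q\<in>UNIV. (if p = q' then 1 else 0) * (if p' = q then 1 else 0) * m p q) = m q' p'"
    for q' p' and m :: "'a \<Rightarrow> 'a \<Rightarrow> complex"
  proof -
    have "(\<Sum>p\<in>UNIV. \<Sum>q\<in>UNIV. (if p = q' then 1 else 0) * (if p' = q then 1 else 0) * m p q) =
       (\<Sum>p\<in>UNIV. if p = q' then \<Sum>q\<in>UNIV. if p' = q then m p q else 0 else 0)"
      by (intro sum.cong refl) (auto simp: mult_if_delta intro!: sum.neutral sum.cong)
    then show ?thesis by simp
  qed
  have prods: "(\<Sum>a\<in>UNIV. u a) * (\<Sum>b\<in>UNIV. v b) * m = (\<Sum>a\<in>UNIV. \<Sum>b\<in>UNIV. u a * v b * m)"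
    for u v :: "'a \<Rightarrow> complex" and m
  proof -
    have "(\<Sum>a\<in>UNIV. u a) * (\<Sum>b\<in>UNIV. v b) = (\<Sum>a\<in>UNIV. \<Sum>b\<in>UNIV. u a * v b)" by (rule sum_product)
    then show ?thesis by (simp add: sum_distrib_right)
  qed
  have "eval_mp L (g ** A ** h) (g ** B ** h) = (\<Sum>a\<in>UNIV. \<Sum>b\<in>UNIV. (\<Sum>k\<in>UNIV\<times>UNIV. (h $ fst k $ b * g $ a $ snd k) *
    (\<Sum>p\<in>UNIV. \<Sum>q\<in>UNIV. h $ p $ a * g $ b $ q * eval_mp (left_deriv p q (left_deriv (fst k) (snd k) e)) A B)))"
    unfolding L by (intro sum.cong refl left_deriv_conj[OF e2 gh AB])
  also have "\<dots> = (\<Sum>a\<in>UNIV. \<Sum>b\<in>UNIV. \<Sum>p'\<in>UNIV. \<Sum>q'\<in>UNIV. \<Sum>p\<in>UNIV. \<Sum>q\<in>UNIV.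
     (h $ p $ a * g $ a $ q') * (h $ p' $ b * g $ b $ q) * eval_mp (left_deriv p q (left_deriv p' q' e)) A B)"
    unfolding pairs[of "\<lambda>p' q'. h $ p' $ b * g $ a $ q' * (\<Sum>p\<in>UNIV. \<Sum>q\<in>UNIV. h $ p $ a * g $ b $ q * eval_mp (left_deriv p q (left_deriv p' q' e)) A B)" for a b]
    by (simp add: sum_distrib_left mult_ac)
  \<comment> \<open>The sums over a and b go innermost, where \<open>h ** g = mat 1\<close>
    evaluates them.\<close>
  also have "\<dots> = (\<Sum>p'\<in>UNIV. \<Sum>q'\<in>UNIV. \<Sum>p\<in>UNIV. \<Sum>q\<in>UNIV. \<Sum>a\<in>UNIV. \<Sum>b\<in>UNIV.
     (h $ p $ a * g $ a $ q') * (h $ p' $ b * g $ b $ q) * eval_mp (left_deriv p q (left_deriv p' q' e)) A B)"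
    unfolding sum.cartesian_product
    by (rule sum.reindex_bij_witness[where i="\<lambda>(p',q',p,q,a,b). (a,b,p',q',p,q)"
      and j="\<lambda>(a,b,p',q',p,q). (p',q',p,q,a,b)"]) auto
  also have "\<dots> = (\<Sum>p'\<in>UNIV. \<Sum>q'\<in>UNIV. \<Sum>p\<in>UNIV. \<Sum>q\<in>UNIV.
     (\<Sum>a\<in>UNIV. h $ p $ a * g $ a $ q') * (\<Sum>b\<in>UNIV. h $ p' $ b * g $ b $ q) * eval_mp (left_deriv p q (left_deriv p' q' e)) A B)"
    by (simp only: prods)
  also have "\<dots> = (\<Sum>p'\<in>UNIV. \<Sum>q'\<in>UNIV. eval_mp (left_deriv q' p' (left_deriv p' q' e)) A B)"
    unfolding gh1 by (simp only: deltas)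
  also have "\<dots> = eval_mp L A B" unfolding L by (rule sum.swap)
  finally show "eval_mp L (g ** A ** h) (g ** B ** h) = eval_mp L A B" .
qed

lemma eval_mp_sum_exists:
  "finite S \<Longrightarrow> \<exists>p. \<forall>A B. eval_mp p A B = (\<Sum>x\<in>S. eval_mp (f x) A B)"
proof (induction S rule: finite_induct)
  case empty show ?case by (rule exI[of _ "Const 0"]) simp
next
  case (insert x F)
  then obtain p where "\<forall>A B. eval_mp p A B = (\<Sum>x\<in>F. eval_mp (f x) A B)" by blast
  with insert show ?case by (intro exI[of _ "Plus (f x) p"]) simp
qed

lemma laplacian_exists:
  fixes e :: "'n::finite matpoly"
  obtains L where "\<And>A B. eval_mp L A B = (\<Sum>a\<in>UNIV. \<Sum>b\<in>UNIV. eval_mp (left_deriv a b (left_deriv b a e)) A B)"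
  using eval_mp_sum_exists[of "UNIV \<times> UNIV" "\<lambda>(a, b). left_deriv a b (left_deriv b a e)"]
  by (force simp: sum.cartesian_product split_def)

section \<open>The Haar integral\<close>

lemma adjoint_entry [simp]: "adjoint_mat A $ i $ j = cnj (A $ j $ i)"
  by (simp add: adjoint_mat_def transpose_def map_matrix_def)

lemma unitary_is_inv: "U \<in> unitary_group \<longleftrightarrow> is_inv U (adjoint_mat U)"
  by (auto simp: unitary_group_def is_inv_def)

lemma adjoint_mult: "adjoint_mat (A ** B) = adjoint_mat B ** adjoint_mat A"
  by (simp add: vec_eq_iff matrix_mult_entry mult.commute)

lemma adjoint_adjoint [simp]: "adjoint_mat (adjoint_mat A) = A"
  by (simp add: vec_eq_iff)

lemma unitary_mult: "A \<in> unitary_group \<Longrightarrow> B \<in> unitary_group \<Longrightarrow> A ** B \<in> unitary_group"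
  unfolding unitary_is_inv adjoint_mult by (rule is_inv_mult)

lemma unitary_row_norm: "U \<in> unitary_group \<Longrightarrow> (\<Sum>k\<in>UNIV. (cmod (U $ i $ k))\<^sup>2) = 1"
proof -
  assume "U \<in> unitary_group"
  then have "(U ** adjoint_mat U) $ i $ i = 1" by (simp add: unitary_group_def mat_def)
  then have "of_real (\<Sum>k\<in>UNIV. (cmod (U $ i $ k))\<^sup>2) = (1::complex)"
    by (simp add: matrix_mult_entry complex_norm_square del: of_real_power)
  then show ?thesis using of_real_eq_1_iff by blast
qed

lemma unitary_entry_le_1:
  assumes "U \<in> unitary_group" shows "cmod (U $ i $ j) \<le> 1"
proof -
  have "(cmod (U $ i $ j))\<^sup>2 \<le> (\<Sum>k\<in>UNIV. (cmod (U $ i $ k))\<^sup>2)"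
    by (rule member_le_sum) auto
  then have "(cmod (U $ i $ j))\<^sup>2 \<le> 1\<^sup>2" using unitary_row_norm[OF assms] by simp
  then show ?thesis by (rule power2_le_imp_le) simp
qed

definition eval_unitary :: "'n::finite matpoly \<Rightarrow> complex^'n^'n \<Rightarrow> complex" where
  "eval_unitary e U = eval_mp e U (adjoint_mat U)"

lemma eval_unitary_bounded: "\<exists>C\<ge>0. \<forall>U\<in>unitary_group. cmod (eval_unitary e U) \<le> C"
proof (induction e)
  case (Const c) show ?case by (intro exI[of _ "cmod c"]) (simp add: eval_unitary_def)
next
  case (Entry i j) show ?case by (intro exI[of _ 1]) (simp add: eval_unitary_def unitary_entry_le_1)
next
  case (Inv i j) show ?case by (intro exI[of _ 1]) (simp add: eval_unitary_def unitary_entry_le_1)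
next
  case (Plus p q)
  then obtain C D where "C \<ge> 0" "D \<ge> 0" "\<forall>U\<in>unitary_group. cmod (eval_unitary p U) \<le> C" "\<forall>U\<in>unitary_group. cmod (eval_unitary q U) \<le> D"
    by blast
  then show ?case by (intro exI[of _ "C + D"]) (auto simp: eval_unitary_def intro!: norm_triangle_mono)
next
  case (Times p q)
  then obtain C D where "C \<ge> 0" "D \<ge> 0" "\<forall>U\<in>unitary_group. cmod (eval_unitary p U) \<le> C" "\<forall>U\<in>unitary_group. cmod (eval_unitary q U) \<le> D"
    by blast
  then show ?case by (intro exI[of _ "C * D"]) (auto simp: eval_unitary_def norm_mult intro!: mult_mono)
qed

lemma continuous_on_eval_unitary: "continuous_on UNIV (eval_unitary e)"
  unfolding eval_unitary_def by (induction e) (auto intro!: continuous_intros)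

context
  fixes M :: "(complex^'n^'n) measure"
  assumes haar: "haar_unitary M"
begin

lemma space_haar: "space M = unitary_group"
  using haar by (simp add: haar_unitary_def)

lemma sets_haar: "sets M = sets (restrict_space borel unitary_group)"
  using haar by (simp add: haar_unitary_def)

lemma measurable_haar: "f \<in> borel_measurable borel \<Longrightarrow> f \<in> measurable M borel"
  unfolding measurable_cong_sets[OF sets_haar refl] by (rule measurable_restrict_space1)

lemma eval_unitary_measurable: "eval_unitary e \<in> borel_measurable M"
  by (intro measurable_haar borel_measurable_continuous_onI continuous_on_eval_unitary)

lemma eval_unitary_integrable: "integrable M (eval_unitary e)"
proof -
  interpret prob_space M using haar by (simp add: haar_unitary_def)
  obtain C where "\<forall>U\<in>unitary_group. cmod (eval_unitary e U) \<le> C" using eval_unitary_bounded by blast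
  then show ?thesis
    by (intro integrable_const_bound[of _ C] eval_unitary_measurable AE_I2) (simp add: space_haar)
qed

lemma continuous_on_mult_left: "continuous_on UNIV (\<lambda>B::complex^'n^'n. A ** B)"
  unfolding matrix_matrix_mult_def by (intro continuous_intros)

lemma translate_measurable:
  assumes A: "A \<in> unitary_group" shows "(\<lambda>B. A ** B) \<in> measurable M M"
proof -
  have "(\<lambda>B. A ** B) \<in> measurable M (restrict_space borel unitary_group)"
    by (rule measurable_restrict_space2)
       (auto simp: space_haar unitary_mult A intro!: measurable_haar borel_measurable_continuous_onI continuous_on_mult_left)
  then show ?thesis
    unfolding measurable_cong_sets[OF refl sets_haar] .
qed

lemma integral_translate:
  assumes A: "A \<in> unitary_group"
  shows "(\<integral>U. eval_unitary e (A ** U) \<partial>M) = (\<integral>U. eval_unitary e U \<partial>M)" and "integrable M (\<lambda>U. eval_unitary e (A ** U))"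
proof -
  have d: "distr M M (\<lambda>B. A ** B) = M" using haar A by (simp add: haar_unitary_def)
  show "(\<integral>U. eval_unitary e (A ** U) \<partial>M) = (\<integral>U. eval_unitary e U \<partial>M)"
    using integral_distr[OF translate_measurable[OF A] eval_unitary_measurable, of e] unfolding d by simp
  show "integrable M (\<lambda>U. eval_unitary e (A ** U))"
    using integrable_distr[OF translate_measurable[OF A], of "eval_unitary e"] eval_unitary_integrable unfolding d by simp
qed

end

section \<open>Vanishing of the integral of a derivative\<close>

lemma matrix_mult_lin:
  "A ** (B + C) = A ** B + A ** C" "A ** (B - C) = A ** B - A ** C"
  "(B + C) ** A = B ** A + C ** A" "(B - C) ** A = B ** A - C ** A"
  "A ** (k *\<^sub>R B) = k *\<^sub>R (A ** B)" "(k *\<^sub>R B) ** A = k *\<^sub>R (B ** A)"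
  for A B C :: "complex^'n^'n"
  by (simp_all add: vec_eq_iff matrix_mult_entry sum.distrib sum_subtractf algebra_simps scaleR_sum_right)

text \<open>If \<open>X\<^sup>3 = - X\<close> then \<open>exp (s X)\<close> is a quadratic polynomial in \<open>X\<close>.\<close>

definition one_param :: "complex^'n^'n \<Rightarrow> real \<Rightarrow> complex^'n^'n" where
  "one_param X s = mat 1 + sin s *\<^sub>R X + (1 - cos s) *\<^sub>R (X ** X)"

context
  fixes X :: "complex^'n^'n"
  assumes X3: "X ** X ** X = - X" and adj: "adjoint_mat X = - X"
begin

lemma X3': "X ** (X ** X) = - X"
  by (simp add: matrix_mul_assoc X3)

lemma X4: "X ** X ** (X ** X) = - (X ** X)"
  by (simp add: matrix_mul_assoc X3 matrix_mult_minus_left)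

lemma one_param_0: "one_param X 0 = mat 1"
  by (simp add: one_param_def)

lemma one_param_mult_X: "X ** one_param X s = cos s *\<^sub>R X + sin s *\<^sub>R (X ** X)"
  by (simp add: one_param_def matrix_mult_lin X3' algebra_simps)

lemma X_mult_one_param: "one_param X s ** X = cos s *\<^sub>R X + sin s *\<^sub>R (X ** X)"
  by (simp add: one_param_def matrix_mult_lin X3 algebra_simps)

lemma one_param_inverse: "one_param X s ** one_param X (- s) = mat 1"
proof -
  have "(mat 1 + S *\<^sub>R X + C *\<^sub>R (X ** X)) ** (mat 1 + (- S) *\<^sub>R X + C *\<^sub>R (X ** X))
      = mat 1 + (2 * C - C\<^sup>2 - S\<^sup>2) *\<^sub>R (X ** X)" for S C
    apply (simp add: matrix_mult_lin X3 X3' X4)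
    apply (simp only: vec_eq_iff vector_add_component vector_minus_component vector_uminus_component vector_scaleR_component)
    apply (simp add: scaleR_conv_of_real)
    apply (simp add: algebra_simps power2_eq_square)
    done
  from this[of "sin s" "1 - cos s"]
  have "one_param X s ** one_param X (- s) = mat 1 + (2 * (1 - cos s) - (1 - cos s)\<^sup>2 - (sin s)\<^sup>2) *\<^sub>R (X ** X)"
    by (simp add: one_param_def)
  also have "2 * (1 - cos s) - (1 - cos s)\<^sup>2 - (sin s)\<^sup>2 = 0"
    by (simp add: power2_diff sin_squared_eq algebra_simps)
  finally show ?thesis by simp
qed

lemma adjoint_one_param: "adjoint_mat (one_param X s) = one_param X (- s)"
proof -
  have 1: "cnj (X $ j $ i) = - X $ i $ j" for i j
    using adj unfolding vec_eq_iff by simp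
  have "adjoint_mat (X ** X) = X ** X" by (simp add: adjoint_mult adj matrix_mult_minus_left matrix_mult_minus_right)
  then have 2: "cnj ((X ** X) $ j $ i) = (X ** X) $ i $ j" for i j
    unfolding vec_eq_iff by simp
  show ?thesis
    by (auto simp: one_param_def vec_eq_iff 1 2 mat_def)
qed

lemma one_param_unitary: "one_param X s \<in> unitary_group"
  using one_param_inverse[of s] one_param_inverse[of "- s"]
  by (simp add: unitary_group_def adjoint_one_param)

lemma one_param_derivative:
  "((\<lambda>s. one_param X s $ i $ j) has_vector_derivative (X ** one_param X s) $ i $ j) (at s)"
  unfolding one_param_mult_X unfolding one_param_def
  by (auto intro!: derivative_eq_intros simp: has_vector_derivative_def algebra_simps)

lemma one_param_minus_derivative:
  "((\<lambda>s. one_param X (- s) $ i $ j) has_vector_derivative (- one_param X (- s) ** X) $ i $ j) (at s)"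
  unfolding matrix_mult_minus_left X_mult_one_param unfolding one_param_def
  by (auto intro!: derivative_eq_intros simp: has_vector_derivative_def algebra_simps)

lemma eval_unitary_one_param_derivative:
  assumes d: "\<And>A B. eval_mp d A B = (\<Sum>a\<in>UNIV. \<Sum>b\<in>UNIV. X $ a $ b * eval_mp (left_deriv a b e) A B)"
  shows "((\<lambda>s. eval_unitary e (one_param X s ** U)) has_vector_derivative eval_unitary d (one_param X s ** U)) (at s)"
proof -
  have 1: "((\<lambda>s. (one_param X s ** U) $ i $ j) has_vector_derivative
      (X ** (one_param X s ** U) - (one_param X s ** U) ** 0) $ i $ j) (at s)" for i j
    using has_vector_derivative_sandwich[of "one_param X" "X ** one_param X s" s "mat 1" U, OF one_param_derivative]
    by (simp add: matrix_mul_assoc)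
  have 2: "((\<lambda>s. (adjoint_mat U ** one_param X (- s)) $ i $ j) has_vector_derivative
      (0 ** (adjoint_mat U ** one_param X (- s)) - (adjoint_mat U ** one_param X (- s)) ** X) $ i $ j) (at s)" for i j
    using has_vector_derivative_sandwich[of "\<lambda>s. one_param X (- s)" "- one_param X (- s) ** X" s "adjoint_mat U" "mat 1", OF one_param_minus_derivative]
    by (simp add: matrix_mul_assoc matrix_mult_minus_left matrix_mult_minus_right)
  show ?thesis
    using eval_mp_has_vector_derivative[OF 1 2, where e=e]
    by (simp add: eval_unitary_def adjoint_mult adjoint_one_param d)
qed

lemma norm_difference_quotient:
  fixes D d :: complex
  assumes "h \<noteq> 0"
  shows "norm (D - h *\<^sub>R d) / norm h = norm (D /\<^sub>R h - d)"
proof -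
  have "D /\<^sub>R h - d = (D - h *\<^sub>R d) / of_real h"
    using assms by (simp add: scaleR_conv_of_real field_simps)
  then show ?thesis by (simp only: norm_divide norm_of_real real_norm_def)
qed

text \<open>By invariance every difference quotient of e along \<open>one_param X\<close> has
  integral 0. The mean value inequality bounds the quotients by a bound for the derivative on U(N),
  so dominated convergence passes to the limit.\<close>

lemma integral_one_param:
  assumes haar: "haar_unitary M"
  shows "(\<Sum>a\<in>UNIV. \<Sum>b\<in>UNIV. X $ a $ b * (\<integral>U. eval_unitary (left_deriv a b e) U \<partial>M)) = 0"
proof -
  interpret prob_space M using haar by (simp add: haar_unitary_def)
  obtain d :: "'n matpoly" where d': "\<And>A B. eval_mp d A B = (\<Sum>x\<in>UNIV\<times>UNIV. eval_mp (Times (Const (X $ fst x $ snd x)) (left_deriv (fst x) (snd x) e)) A B)"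
    using eval_mp_sum_exists[of "UNIV \<times> UNIV" "\<lambda>x. Times (Const (X $ fst x $ snd x)) (left_deriv (fst x) (snd x) e)"] by auto
  then have d: "eval_mp d A B = (\<Sum>a\<in>UNIV. \<Sum>b\<in>UNIV. X $ a $ b * eval_mp (left_deriv a b e) A B)" for A B
    by (simp add: sum.cartesian_product split_def)
  obtain C where C: "C \<ge> 0" "\<And>U. U \<in> unitary_group \<Longrightarrow> cmod (eval_unitary d U) \<le> C" using eval_unitary_bounded[of d] by blast
  define f where "f n U = of_nat (Suc n) * (eval_unitary e (one_param X (1 / real (Suc n)) ** U) - eval_unitary e U)" for n U
  have lim: "(\<lambda>n. f n U) \<longlonglongrightarrow> eval_unitary d U" if "U \<in> space M" for U
  proof -
    have "((\<lambda>s. eval_unitary e (one_param X s ** U)) has_vector_derivative eval_unitary d U) (at 0)"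
      using eval_unitary_one_param_derivative[OF d, of U 0] by (simp add: one_param_0)
    then have "((\<lambda>h. norm (eval_unitary e (one_param X (0 + h) ** U) - eval_unitary e (one_param X 0 ** U) - h *\<^sub>R eval_unitary d U) / norm h) \<longlongrightarrow> 0) (at 0)"
      unfolding has_vector_derivative_def has_derivative_at by (rule conjunct2)
    moreover have "norm (eval_unitary e (one_param X (0 + h) ** U) - eval_unitary e (one_param X 0 ** U) - h *\<^sub>R eval_unitary d U) / norm h =
          norm ((eval_unitary e (one_param X h ** U) - eval_unitary e U) /\<^sub>R h - eval_unitary d U)" if "h \<noteq> 0" for h
      using norm_difference_quotient[OF that] by (simp only: one_param_0 matrix_mul_lid add_0_left)
    then have "\<forall>\<^sub>F h in at 0. norm (eval_unitary e (one_param X (0 + h) ** U) - eval_unitary e (one_param X 0 ** U) - h *\<^sub>R eval_unitary d U) / norm h =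
          norm ((eval_unitary e (one_param X h ** U) - eval_unitary e U) /\<^sub>R h - eval_unitary d U)"
      by (rule eventually_mono[OF eventually_neq_at_within])
    ultimately have "((\<lambda>h. norm ((eval_unitary e (one_param X h ** U) - eval_unitary e U) /\<^sub>R h - eval_unitary d U)) \<longlongrightarrow> 0) (at 0)"
      by (rule Lim_transform_eventually)
    then have "((\<lambda>h. (eval_unitary e (one_param X h ** U) - eval_unitary e U) /\<^sub>R h) \<longlongrightarrow> eval_unitary d U) (at 0)"
      by (rule LIM_zero_cancel[OF tendsto_norm_zero_cancel])
    moreover have "filterlim (\<lambda>n. 1 / real (Suc n)) (at 0) sequentially"
      unfolding filterlim_at using LIMSEQ_inverse_real_of_nat by (auto simp: inverse_eq_divide)
    ultimately have "(\<lambda>n. (eval_unitary e (one_param X (1 / real (Suc n)) ** U) - eval_unitary e U) /\<^sub>R (1 / real (Suc n))) \<longlonglongrightarrow> eval_unitary d U"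
      by (rule filterlim_compose)
    then show ?thesis by (simp add: f_def scaleR_conv_of_real)
  qed
  have bound: "norm (f n U) \<le> C" if "U \<in> space M" for n U
  proof -
    have U: "U \<in> unitary_group" using that haar by (simp add: space_haar)
    define h where "h = 1 / real (Suc n)"
    have h: "h > 0" by (simp add: h_def)
    have "norm (eval_unitary e (one_param X h ** U) - eval_unitary e (one_param X 0 ** U)) \<le> C * h - C * 0"
    proof (rule differentiable_bound_general[OF h, where \<phi> = "\<lambda>s. C * s" and \<phi>' = "\<lambda>_. C"])
      show "continuous_on {0..h} (\<lambda>s. eval_unitary e (one_param X s ** U))"
        by (rule continuous_at_imp_continuous_on)
           (use has_vector_derivative_continuous[OF eval_unitary_one_param_derivative[OF d]] in blast)
      show "((\<lambda>s. eval_unitary e (one_param X s ** U)) has_vector_derivative eval_unitary d (one_param X s ** U)) (at s)" for s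
        by (rule eval_unitary_one_param_derivative[OF d])
      show "norm (eval_unitary d (one_param X s ** U)) \<le> C" for s
        by (intro C unitary_mult U one_param_unitary)
      show "((\<lambda>s. C * s) has_vector_derivative C) (at s)" for s
        by (auto intro!: derivative_eq_intros simp: has_real_derivative_iff_has_vector_derivative[symmetric])
    qed (intro continuous_intros)
    then have "norm (eval_unitary e (one_param X h ** U) - eval_unitary e U) \<le> C * h" by (simp add: one_param_0)
    then have "real (Suc n) * norm (eval_unitary e (one_param X h ** U) - eval_unitary e U) \<le> real (Suc n) * (C * h)"
      by (rule mult_left_mono) simp
    also have "\<dots> = C" by (simp add: h_def)
    finally show ?thesis by (simp add: f_def h_def norm_mult del: of_nat_Suc)
  qed
  have "(\<lambda>n. \<integral>U. f n U \<partial>M) \<longlonglongrightarrow> (\<integral>U. eval_unitary d U \<partial>M)"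
  proof (rule integral_dominated_convergence[where w = "\<lambda>_. C"])
    show "f n \<in> borel_measurable M" for n
      unfolding f_def using integral_translate(2)[OF haar one_param_unitary[of "1 / real (Suc n)"], where e=e] eval_unitary_integrable[OF haar, of e]
      by (intro borel_measurable_times borel_measurable_diff borel_measurable_const borel_measurable_integrable)
  qed (use lim bound eval_unitary_measurable[OF haar] in auto)
  moreover have "(\<integral>U. f n U \<partial>M) = 0" for n
    unfolding f_def using integral_translate[OF haar one_param_unitary[of "1 / real (Suc n)"], where e=e] eval_unitary_integrable[OF haar, of e]
    by (simp del: of_nat_Suc)
  ultimately have "(\<integral>U. eval_unitary d U \<partial>M) = 0"
    by (simp add: LIMSEQ_const_iff)
  moreover have "(\<integral>U. eval_unitary d U \<partial>M) = (\<Sum>a\<in>UNIV. \<Sum>b\<in>UNIV. X $ a $ b * (\<integral>U. eval_unitary (left_deriv a b e) U \<partial>M))"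
  proof -
    have "eval_unitary d U = (\<Sum>a\<in>UNIV. \<Sum>b\<in>UNIV. X $ a $ b * eval_unitary (left_deriv a b e) U)" for U
      by (simp add: eval_unitary_def d)
    then show ?thesis using eval_unitary_integrable[OF haar] by simp
  qed
  ultimately show ?thesis by simp
qed

end

lemma sum_delta2:
  fixes f :: "'a::finite \<Rightarrow> 'b::finite \<Rightarrow> complex"
  shows "(\<Sum>i\<in>UNIV. \<Sum>j\<in>UNIV. (if i = a \<and> j = b then c else 0) * f i j) = c * f a b"
proof -
  have "(\<Sum>i\<in>UNIV. \<Sum>j\<in>UNIV. (if i = a \<and> j = b then c else 0) * f i j) =
      (\<Sum>i\<in>UNIV. \<Sum>j\<in>UNIV. if j = b then if i = a then c * f a b else 0 else 0)"
    by (intro sum.cong refl) auto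
  then show ?thesis by simp
qed

text \<open>A matrix unit is not skew-Hermitian. On the diagonal
  \<open>\<i> E\<^sub>a\<^sub>a\<close> is used, off the diagonal
  \<open>w E\<^sub>a\<^sub>b - cnj w E\<^sub>b\<^sub>a\<close> with |w| = 1; all of these satisfy
  X^3 = - X. The choices w = 1 and w = \<i> give two equations that isolate the integral.\<close>

lemma integral_left_deriv:
  fixes M :: "(complex^'n^'n) measure"
  assumes haar: "haar_unitary M"
  shows "(\<integral>U. eval_unitary (left_deriv a b e) U \<partial>M) = 0"
proof (cases "a = b")
  case True
  define X :: "complex^'n^'n" where "X = (\<chi> i j. if i = a \<and> j = a then \<i> else 0)"
  have XA: "(X ** A) $ i $ j = (if i = a then \<i> * A $ a $ j else 0)" for A i j
  proof -
    have "(X ** A) $ i $ j = (\<Sum>k\<in>UNIV. if k = a then (if i = a then \<i> * A $ a $ j else 0) else 0)"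
      unfolding matrix_mult_entry by (intro sum.cong) (auto simp: X_def)
    then show ?thesis by simp
  qed
  have 1: "X ** X ** X = - X"
    unfolding matrix_mul_assoc[symmetric] by (auto simp: vec_eq_iff XA) (auto simp: X_def)
  have 2: "adjoint_mat X = - X" by (auto simp: vec_eq_iff X_def)
  show ?thesis
    using integral_one_param[OF 1 2 haar, of e] True by (simp add: X_def sum_delta2)
next
  case False
  have *: "w * (\<integral>U. eval_unitary (left_deriv a b e) U \<partial>M) - cnj w * (\<integral>U. eval_unitary (left_deriv b a e) U \<partial>M) = 0" if w: "w * cnj w = 1" for w
  proof -
    define X :: "complex^'n^'n" where "X = (\<chi> i j. (if i = a \<and> j = b then w else 0) + (if i = b \<and> j = a then - cnj w else 0))"
    have XA: "(X ** A) $ i $ j = (if i = a then w * A $ b $ j else if i = b then - cnj w * A $ a $ j else 0)" for A i j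
    proof -
      have "(X ** A) $ i $ j = (\<Sum>k\<in>UNIV. (if k = b then (if i = a then w * A $ b $ j else 0) else 0)
           + (if k = a then (if i = b then - cnj w * A $ a $ j else 0) else 0))"
        unfolding matrix_mult_entry by (intro sum.cong) (auto simp: X_def algebra_simps)
      then show ?thesis using False by (simp add: sum.distrib)
    qed
    have 1: "X ** X ** X = - X"
      unfolding matrix_mul_assoc[symmetric] using False w w[unfolded mult.commute[of w]]
      by (auto simp: vec_eq_iff XA) (auto simp: X_def)
    have 2: "adjoint_mat X = - X" using False by (auto simp: vec_eq_iff X_def)
    show ?thesis
      using integral_one_param[OF 1 2 haar, of e]
      by (simp add: X_def sum_delta2 distrib_right sum.distrib)
  qed
  from *[of 1] *[of \<i>] show ?thesis by simp
qed

section \<open>Diagonalization of unitary matrices\<close>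

lemma poly_det: "poly (det A) z = det (\<chi> i j. poly (A $ i $ j) (z :: complex))"
  by (simp add: det_def poly_sum poly_prod)

lemma det_0_kernel:
  fixes Z :: "complex^'n^'n"
  assumes "det Z = 0"
  obtains w where "Z *v w = 0" "w \<noteq> 0"
proof -
  have "\<not> (\<exists>B. B ** Z = mat 1)"
    using assms by (metis det_I det_mul mult_zero_right zero_neq_one)
  with that show thesis unfolding matrix_left_invertible_ker by blast
qed

text \<open>\<open>PM\<close> is z - U on the complement of S and the identity on S, so a root of
  its determinant gives a kernel vector supported off S. To see that the determinant is not
  constant, compare it with the reversed matrix \<open>PN\<close>, which is 1 - y U off S: a
  constant c would force \<open>det PN\<close> to be c y^m with m > 0, although \<open>PN\<close> is
  the identity at y = 0.\<close>

lemma block_eigenvector: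
  fixes U :: "complex^'n^'n"
  assumes S: "S \<noteq> UNIV" and block: "\<And>i k. i \<in> S \<Longrightarrow> k \<noteq> i \<Longrightarrow> U $ i $ k = 0 \<and> U $ k $ i = 0"
  obtains w z where "w \<noteq> 0" "\<And>i. i \<in> S \<Longrightarrow> w $ i = 0" "\<And>i. (\<Sum>k\<in>UNIV. U $ i $ k * w $ k) = z * w $ i"
proof -
  define PM :: "complex poly^'n^'n" where
    "PM = (\<chi> i k. if i \<in> S \<or> k \<in> S then (if i = k then 1 else 0) else [:- U $ i $ k, (if i = k then 1 else 0):])"
  define PN :: "complex poly^'n^'n" where
    "PN = (\<chi> i k. if i \<in> S \<or> k \<in> S then (if i = k then 1 else 0) else [:(if i = k then 1 else 0), - U $ i $ k:])"
  have "\<not> constant (poly (det PM))"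
  proof
    assume const: "constant (poly (det PM))"
    define c where "c = poly (det PM) 0"
    have c: "poly (det PM) z = c" for z using const by (auto simp: constant_def c_def)
    define m where "m = card (- S)"
    have m: "m > 0" using S by (auto simp: m_def card_gt_0_iff)
    have R: "poly (det PN) y = y ^ m * c" if "y \<noteq> 0" for y
    proof -
      have "(\<chi> i j. poly (PN $ i $ j) y) = (\<chi> i. (if i \<in> S then 1 else y) *s (\<chi> j. poly (PM $ i $ j) (1 / y)))"
        using that by (auto simp: vec_eq_iff PN_def PM_def field_simps)
      then have "poly (det PN) y = (\<Prod>i\<in>UNIV. if i \<in> S then 1 else y) * poly (det PM) (1 / y)"
        unfolding poly_det by (simp add: det_rows_mul)
      also have "(\<Prod>i\<in>UNIV. if i \<in> S then 1 else y) = y ^ m"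
        by (simp add: prod.If_cases m_def Compl_eq)
      finally show ?thesis by (simp add: c)
    qed
    \<comment> \<open>The relation is known for y \<noteq> 0 only; the factor y extends it to y =
      0.\<close>
    have "poly ((det PN - monom c m) * [:0, 1:]) y = 0" for y
      using R[of y] by (cases "y = 0") (auto simp: poly_monom)
    then have "(det PN - monom c m) * [:0, 1:] = 0"
      using poly_all_0_iff_0 by blast
    then have "det PN = monom c m" by simp
    then have "poly (det PN) 0 = 0" using m by (simp add: poly_monom)
    moreover have "(\<chi> i j. poly (PN $ i $ j) 0) = mat 1"
      by (auto simp: vec_eq_iff PN_def mat_def)
    then have "poly (det PN) 0 = 1" unfolding poly_det by simp
    ultimately show False by simp
  qed
  then obtain z where z: "poly (det PM) z = 0" using fundamental_theorem_of_algebra by blast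
  define Z where "Z = (\<chi> i j. poly (PM $ i $ j) z)"
  have "det Z = 0" using z unfolding poly_det Z_def .
  then obtain w where w: "Z *v w = 0" "w \<noteq> 0" by (rule det_0_kernel)
  have Zw: "(\<Sum>k\<in>UNIV. Z $ i $ k * w $ k) = 0" for i
    using w(1) by (simp add: matrix_vector_mult_def vec_eq_iff)
  have w0: "w $ i = 0" if "i \<in> S" for i
  proof -
    have "(\<Sum>k\<in>UNIV. Z $ i $ k * w $ k) = (\<Sum>k\<in>UNIV. if k = i then w $ i else 0)"
      using that by (intro sum.cong) (auto simp: Z_def PM_def)
    then show ?thesis using Zw[of i] by simp
  qed
  have "(\<Sum>k\<in>UNIV. U $ i $ k * w $ k) = z * w $ i" for i
  proof (cases "i \<in> S")
    case True
    then have "(\<Sum>k\<in>UNIV. U $ i $ k * w $ k) = 0"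
      by (intro sum.neutral ballI) (metis block w0 mult_zero_left mult_zero_right)
    then show ?thesis using w0[OF True] by simp
  next
    case False
    have "(\<Sum>k\<in>UNIV. Z $ i $ k * w $ k) = (\<Sum>k\<in>UNIV. (if k = i then z * w $ i else 0) - U $ i $ k * w $ k)"
      using False by (intro sum.cong refl) (auto simp: Z_def PM_def w0 algebra_simps)
    then show ?thesis using Zw[of i] by (simp add: sum_subtractf)
  qed
  with that w(2) w0 show thesis by blast
qed

definition diag_mat :: "('n::finite \<Rightarrow> complex) \<Rightarrow> complex^'n^'n" where
  "diag_mat t = (\<chi> i j. if i = j then t i else 0)"

lemma diag_mat_entry [simp]: "diag_mat t $ i $ j = (if i = j then t i else 0)"
  by (simp add: diag_mat_def)

lemma diag_mat_mult: "diag_mat s ** diag_mat t = diag_mat (\<lambda>i. s i * t i)"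
proof -
  have "(diag_mat s ** diag_mat t) $ i $ j = (\<Sum>k\<in>UNIV. if k = i then (if i = j then s i * t i else 0) else 0)" for i j
    unfolding matrix_mult_entry by (intro sum.cong) auto
  then show ?thesis by (simp add: vec_eq_iff)
qed

lemma is_inv_diag_mat: "(\<And>i. t i \<noteq> 0) \<Longrightarrow> is_inv (diag_mat t) (diag_mat (\<lambda>i. inverse (t i)))"
  by (simp add: is_inv_def diag_mat_mult) (simp add: vec_eq_iff mat_def)

text \<open>The column spends its whole norm 1 on the diagonal entry; the row also has norm 1, so
  nothing is left for its other entries.\<close>

lemma unitary_column_imp_row:
  assumes U: "U \<in> unitary_group" and col: "\<And>k. k \<noteq> i \<Longrightarrow> U $ k $ i = 0"
  shows "cmod (U $ i $ i) = 1" and "k \<noteq> i \<Longrightarrow> U $ i $ k = 0"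
proof -
  have Ua: "adjoint_mat U \<in> unitary_group" using U by (simp add: unitary_is_inv is_inv_sym)
  have "(\<Sum>k\<in>UNIV. (cmod (adjoint_mat U $ i $ k))\<^sup>2) = (\<Sum>k\<in>UNIV. if k = i then (cmod (U $ i $ i))\<^sup>2 else 0)"
    by (intro sum.cong) (auto simp: col)
  then have 1: "(cmod (U $ i $ i))\<^sup>2 = 1" using unitary_row_norm[OF Ua, of i] by simp
  then show "cmod (U $ i $ i) = 1" by (simp add: power2_eq_1_iff) (smt (verit) norm_ge_zero)
  have "(\<Sum>k\<in>UNIV. (cmod (U $ i $ k))\<^sup>2) = (cmod (U $ i $ i))\<^sup>2 + (\<Sum>k\<in>UNIV - {i}. (cmod (U $ i $ k))\<^sup>2)"
    by (rule sum.remove) auto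
  then have "(\<Sum>k\<in>UNIV - {i}. (cmod (U $ i $ k))\<^sup>2) = 0" using unitary_row_norm[OF U, of i] 1 by simp
  then show "U $ i $ k = 0" if "k \<noteq> i"
    using that by (subst (asm) sum_nonneg_eq_0_iff) auto
qed

text \<open>A Householder reflection taking the basis vector \<open>e\<^sub>j\<close> to \<open>w\<close>; the normalisation
  \<open>w\<^sub>j \<le> 0\<close> keeps \<open>e\<^sub>j - w\<close> away from \<open>0\<close>.\<close>

lemma householder:
  fixes w :: "complex^'n"
  assumes nw: "(\<Sum>k\<in>UNIV. (cmod (w $ k))\<^sup>2) = 1" and wj: "w $ j = of_real r" "r \<le> 0"
  obtains V where "V \<in> unitary_group" "adjoint_mat V = V" "\<And>i. V $ i $ j = w $ i"
    "\<And>i k. k \<noteq> j \<Longrightarrow> w $ k = 0 \<Longrightarrow> V $ i $ k = (if i = k then 1 else 0)"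
proof -
  define v where "v = (\<chi> i. (if i = j then 1 else 0) - w $ i)"
  \<comment> \<open>This is the usual factor 2 / |v|^2 of a reflection, since |v|^2 = 2 (1 - r) for
    a unit vector w.\<close>
  define c where "c = complex_of_real (1 / (1 - r))"
  have c: "c * (1 - of_real r) = 1"
  proof -
    have "c * (1 - of_real r) = of_real (1 / (1 - r) * (1 - r))"
      unfolding c_def of_real_mult of_real_diff of_real_1 ..
    then show ?thesis using wj by simp
  qed
  have cc: "cnj c = c" by (simp add: c_def)
  define V :: "complex^'n^'n" where "V = (\<chi> i k. (if i = k then 1 else 0) - c * (v $ i * cnj (v $ k)))"
  have vv: "(\<Sum>k\<in>UNIV. v $ k * cnj (v $ k)) = 2 * (1 - of_real r)"
  proof -
    have "(\<Sum>k\<in>UNIV. v $ k * cnj (v $ k)) = (\<Sum>k\<in>UNIV. w $ k * cnj (w $ k) + (if k = j then 1 - 2 * of_real r else 0))"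
      using wj by (intro sum.cong refl) (auto simp: v_def algebra_simps)
    also have "\<dots> = (\<Sum>k\<in>UNIV. w $ k * cnj (w $ k)) + (1 - 2 * of_real r)"
      by (simp add: sum.distrib)
    also have "(\<Sum>k\<in>UNIV. w $ k * cnj (w $ k)) = of_real (\<Sum>k\<in>UNIV. (cmod (w $ k))\<^sup>2)"
      by (simp add: complex_norm_square del: of_real_power)
    finally show ?thesis by (simp add: nw)
  qed
  have adj: "adjoint_mat V = V"
    by (auto simp: vec_eq_iff V_def cc)
  have "V ** V = mat 1"
  proof -
    have "(V ** V) $ i $ k = (if i = k then 1 else 0)" for i k
    proof -
      have "(V ** V) $ i $ k = (\<Sum>l\<in>UNIV. (if l = i then (if i = k then 1 else 0) - c * (v $ i * cnj (v $ k)) else 0)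
         + ((if l = k then - c * (v $ i * cnj (v $ k)) else 0)
         + c * c * v $ i * cnj (v $ k) * (v $ l * cnj (v $ l))))"
        unfolding matrix_mult_entry by (intro sum.cong refl) (auto simp: V_def algebra_simps)
      also have "\<dots> = (if i = k then 1 else 0) - c * (v $ i * cnj (v $ k)) + (- c * (v $ i * cnj (v $ k))
         + c * c * v $ i * cnj (v $ k) * (\<Sum>l\<in>UNIV. v $ l * cnj (v $ l)))"
        by (simp add: sum.distrib sum_distrib_left)
      also have "\<dots> = (if i = k then 1 else 0) + 2 * c * v $ i * cnj (v $ k) * (c * (1 - of_real r) - 1)"
        unfolding vv by (simp add: algebra_simps)
      finally show ?thesis unfolding c by simp
    qed
    then show ?thesis by (simp add: vec_eq_iff mat_def)
  qed
  then have V: "V \<in> unitary_group" by (simp add: unitary_group_def adj)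
  have "V $ i $ j = w $ i" for i
  proof -
    have "V $ i $ j = (if i = j then 1 else 0) - (c * (1 - of_real r)) * v $ i"
      using wj by (simp add: V_def v_def algebra_simps)
    then show ?thesis unfolding c by (simp add: v_def)
  qed
  moreover have "V $ i $ k = (if i = k then 1 else 0)" if "k \<noteq> j" "w $ k = 0" for i k
    using that by (simp add: V_def v_def)
  ultimately show thesis using that V adj by blast
qed

text \<open>Besides normalising, the scalar rotates the entry at j onto the nonpositive real axis,
  as \<open>householder\<close> demands.\<close>

lemma unit_vector_with_phase:
  fixes w :: "complex^'n"
  assumes "w \<noteq> 0"
  obtains c where "(\<Sum>k\<in>UNIV. (cmod (c * w $ k))\<^sup>2) = 1" "\<exists>r\<le>0. c * w $ j = of_real r"
proof -
  define n where "n = sqrt (\<Sum>k\<in>UNIV. (cmod (w $ k))\<^sup>2)"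
  have "(\<Sum>k\<in>UNIV. (cmod (w $ k))\<^sup>2) > 0"
  proof -
    obtain k where "w $ k \<noteq> 0" using assms by (auto simp: vec_eq_iff)
    then show ?thesis by (intro sum_pos2[of _ k]) auto
  qed
  then have n: "n > 0" "n\<^sup>2 = (\<Sum>k\<in>UNIV. (cmod (w $ k))\<^sup>2)" by (simp_all add: n_def)
  define u where "u = (if w $ j = 0 then 1 else - cnj (w $ j) / of_real (cmod (w $ j)))"
  have u: "cmod u = 1" by (simp add: u_def norm_divide)
  have uw: "u * w $ j = of_real (- cmod (w $ j))"
  proof (cases "w $ j = 0")
    case False
    have "u * w $ j = - (w $ j * cnj (w $ j)) / of_real (cmod (w $ j))"
      using False by (simp add: u_def)
    also have "w $ j * cnj (w $ j) = of_real (cmod (w $ j)) * of_real (cmod (w $ j))"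
      using complex_norm_square[of "w $ j"] by (simp add: power2_eq_square)
    finally show ?thesis using False by simp
  qed simp
  show thesis
  proof (rule that[of "u / of_real n"])
    have "(\<Sum>k\<in>UNIV. (cmod (u / of_real n * w $ k))\<^sup>2) = (\<Sum>k\<in>UNIV. (cmod (w $ k))\<^sup>2 / n\<^sup>2)"
      using n(1) u by (intro sum.cong refl) (simp add: norm_mult norm_divide power_divide power_mult_distrib)
    also have "\<dots> = n\<^sup>2 / n\<^sup>2" unfolding n(2) by (rule sum_divide_distrib[symmetric])
    also have "\<dots> = 1" using n(1) by simp
    finally show "(\<Sum>k\<in>UNIV. (cmod (u / of_real n * w $ k))\<^sup>2) = 1" .
    have "u / of_real n * w $ j = of_real (- cmod (w $ j) / n)"
      using uw by simp
    then show "\<exists>r\<le>0. u / of_real n * w $ j = of_real r"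
      using n(1) by (intro exI[of _ "- cmod (w $ j) / n"]) simp
  qed
qed

text \<open>One more column is cleared by a reflection taking the basis vector of j to an
  eigenvector supported outside S. It fixes the basis vectors of S, so the cleared columns stay
  cleared. Only columns are recorded, since \<open>unitary_column_imp_row\<close> supplies the
  rows.\<close>

lemma unitary_diag_partial:
  fixes U :: "complex^'n^'n"
  assumes U: "U \<in> unitary_group" and "m \<le> CARD('n)"
  shows "\<exists>V S. V \<in> unitary_group \<and> card S = m \<and>
           (\<forall>i\<in>S. \<forall>k. k \<noteq> i \<longrightarrow> (adjoint_mat V ** U ** V) $ k $ i = 0)"
  using assms(2)
proof (induction m)
  case 0
  have "adjoint_mat (mat 1) = (mat 1 :: complex^'n^'n)" by (auto simp: vec_eq_iff mat_def)
  then show ?case by (intro exI[of _ "mat 1"] exI[of _ "{}"]) (simp add: unitary_group_def)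
next
  case (Suc m)
  then obtain V S where V: "V \<in> unitary_group" and S: "card S = m"
    and diag: "\<And>i k. i \<in> S \<Longrightarrow> k \<noteq> i \<Longrightarrow> (adjoint_mat V ** U ** V) $ k $ i = 0" by auto
  define B where "B = adjoint_mat V ** U ** V"
  have Va: "adjoint_mat V \<in> unitary_group" using V by (simp add: unitary_is_inv is_inv_sym)
  have B: "B \<in> unitary_group" unfolding B_def by (intro unitary_mult V Va U)
  have block: "B $ i $ k = 0 \<and> B $ k $ i = 0" if "i \<in> S" "k \<noteq> i" for i k
    using unitary_column_imp_row(2)[OF B, of i k] diag that by (auto simp: B_def)
  have "S \<noteq> UNIV" using Suc.prems S by auto
  then obtain j where j: "j \<notin> S" by auto
  obtain w0 z where w0: "w0 \<noteq> 0" "\<And>i. i \<in> S \<Longrightarrow> w0 $ i = 0" "\<And>i. (\<Sum>k\<in>UNIV. B $ i $ k * w0 $ k) = z * w0 $ i"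
    using block_eigenvector[OF \<open>S \<noteq> UNIV\<close> block] by metis
  obtain c r where c: "(\<Sum>k\<in>UNIV. (cmod (c * w0 $ k))\<^sup>2) = 1" "r \<le> 0" "c * w0 $ j = of_real r"
    using unit_vector_with_phase[OF w0(1), of j] by metis
  define w where "w = (\<chi> k. c * w0 $ k)"
  have wS: "w $ i = 0" if "i \<in> S" for i using w0(2)[OF that] by (simp add: w_def)
  have Bw: "(\<Sum>k\<in>UNIV. B $ i $ k * w $ k) = z * w $ i" for i
  proof -
    have "(\<Sum>k\<in>UNIV. B $ i $ k * w $ k) = (\<Sum>k\<in>UNIV. c * (B $ i $ k * w0 $ k))"
      by (intro sum.cong) (simp_all add: w_def)
    also have "\<dots> = c * (z * w0 $ i)" unfolding w0(3)[symmetric] by (rule sum_distrib_left[symmetric])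
    finally show ?thesis by (simp add: w_def)
  qed
  obtain H where H: "H \<in> unitary_group" "adjoint_mat H = H" and Hj: "\<And>i. H $ i $ j = w $ i"
    and Hk: "\<And>i k. k \<noteq> j \<Longrightarrow> w $ k = 0 \<Longrightarrow> H $ i $ k = (if i = k then 1 else 0)"
    using householder[of w j r] c by (auto simp: w_def)
  have HH: "H ** H = mat 1" using H by (simp add: unitary_group_def)
  have "(H ** (B ** H)) $ k $ i = 0" if "i \<in> insert j S" "k \<noteq> i" for i k
  proof (cases "i = j")
    case True
    have "(H ** (B ** H)) $ k $ i = (\<Sum>l\<in>UNIV. H $ k $ l * (\<Sum>m\<in>UNIV. B $ l $ m * w $ m))"
      by (simp add: matrix_mult_entry True Hj)
    also have "\<dots> = z * (\<Sum>l\<in>UNIV. H $ k $ l * H $ l $ j)"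
      unfolding sum_distrib_left Bw Hj by (intro sum.cong) simp_all
    also have "\<dots> = z * (H ** H) $ k $ j" by (simp add: matrix_mult_entry)
    finally show ?thesis using that True by (simp add: HH mat_def)
  next
    case False
    with that have iS: "i \<in> S" by simp
    have Hi: "H $ l $ i = (if l = i then 1 else 0)" for l using Hk[OF False wS[OF iS]] by simp
    have BH: "(B ** H) $ l $ i = (if l = i then B $ i $ i else 0)" for l
    proof -
      have "(B ** H) $ l $ i = (\<Sum>m\<in>UNIV. if m = i then B $ l $ i else 0)"
        unfolding matrix_mult_entry by (intro sum.cong) (auto simp: Hi)
      then show ?thesis using block[OF iS, of l] by auto
    qed
    have "(H ** (B ** H)) $ k $ i = (\<Sum>l\<in>UNIV. if l = i then H $ k $ i * B $ i $ i else 0)"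
      unfolding matrix_mult_entry[of H] by (intro sum.cong) (auto simp: BH)
    then show ?thesis using that by (simp add: Hi)
  qed
  moreover have "adjoint_mat (V ** H) ** U ** (V ** H) = H ** (B ** H)"
    by (simp add: adjoint_mult H B_def matrix_mul_assoc)
  ultimately show ?case
    using V H S j by (intro exI[of _ "V ** H"] exI[of _ "insert j S"]) (simp add: unitary_mult)
qed

lemma is_inv_unique: "is_inv A B \<Longrightarrow> is_inv A C \<Longrightarrow> B = C"
  using matrix_mul_assoc[of B A C] by (simp add: is_inv_def)

lemma unitary_diagonalizable:
  fixes U :: "complex^'n^'n"
  assumes U: "U \<in> unitary_group"
  obtains g h t where "is_inv g h" "\<And>i. t i \<noteq> 0" "U = g ** diag_mat t ** h"
    "adjoint_mat U = g ** diag_mat (\<lambda>i. inverse (t i)) ** h"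
proof -
  obtain V and S :: "'n set" where V: "V \<in> unitary_group" and S: "card S = CARD('n)"
    and diag: "\<And>i k. i \<in> S \<Longrightarrow> k \<noteq> i \<Longrightarrow> (adjoint_mat V ** U ** V) $ k $ i = 0"
    using unitary_diag_partial[OF U order_refl] by metis
  have "S = UNIV" using S by (intro card_eq_UNIV_imp_eq_UNIV) auto
  define B where "B = adjoint_mat V ** U ** V"
  have Va: "adjoint_mat V \<in> unitary_group" using V by (simp add: unitary_is_inv is_inv_sym)
  have B: "B \<in> unitary_group" unfolding B_def by (intro unitary_mult V Va U)
  define t where "t i = B $ i $ i" for i
  have Bd: "B = diag_mat t"
    using diag \<open>S = UNIV\<close> by (auto simp: vec_eq_iff t_def B_def)
  have t: "t i \<noteq> 0" for i
    using unitary_column_imp_row(1)[OF B, of i] diag \<open>S = UNIV\<close> by (fastforce simp: t_def B_def[symmetric])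
  have inv: "is_inv V (adjoint_mat V)" using V by (simp add: unitary_is_inv)
  have "V ** B ** adjoint_mat V = (V ** adjoint_mat V) ** U ** (V ** adjoint_mat V)"
    by (simp add: B_def matrix_mul_assoc)
  then have 1: "U = V ** diag_mat t ** adjoint_mat V"
    using inv by (simp add: is_inv_def Bd)
  have "is_inv U (V ** diag_mat (\<lambda>i. inverse (t i)) ** adjoint_mat V)"
    unfolding 1 by (intro is_inv_conj is_inv_diag_mat t inv)
  then have "adjoint_mat U = V ** diag_mat (\<lambda>i. inverse (t i)) ** adjoint_mat V"
    using is_inv_unique U by (auto simp: unitary_is_inv)
  with that inv t 1 show thesis by blast
qed

section \<open>Alternants\<close>

text \<open>The index type has no order, but dominance and the staircase \<open>rho\<close> need
  one; an arbitrary enumeration is fixed once and for all.\<close>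

definition enum :: "nat \<Rightarrow> 'n::finite" where
  "enum = (SOME f. bij_betw f {..<CARD('n)} (UNIV :: 'n set))"

lemma bij_enum: "bij_betw (enum :: nat \<Rightarrow> 'n) {..<CARD('n::finite)} UNIV"
proof -
  have "\<exists>f. bij_betw f {..<CARD('n)} (UNIV :: 'n set)"
    using ex_bij_betw_nat_finite[of "UNIV :: 'n set"] by (simp add: atLeast0LessThan)
  then show ?thesis unfolding enum_def by (rule someI_ex)
qed

definition rank :: "'n::finite \<Rightarrow> nat" where
  "rank = inv_into {..<CARD('n)} enum"

lemma enum_rank [simp]: "enum (rank i) = i"
  unfolding rank_def using bij_enum by (metis UNIV_I bij_betw_def f_inv_into_f)

lemma rank_less [simp]: "rank (i :: 'n::finite) < CARD('n)"
  unfolding rank_def using bij_enum by (metis UNIV_I bij_betw_def inv_into_into lessThan_iff)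

lemma rank_enum [simp]: "k < CARD('n) \<Longrightarrow> rank (enum k :: 'n::finite) = k"
  unfolding rank_def using bij_enum by (metis bij_betw_inv_into_left lessThan_iff)

lemma enum_eq_iff: "j < CARD('n) \<Longrightarrow> k < CARD('n) \<Longrightarrow> (enum j :: 'n::finite) = enum k \<longleftrightarrow> j = k"
  by (metis rank_enum)

lemma inj_rank: "inj rank"
  by (metis enum_rank injI)

lemma sum_enum: "(\<Sum>i\<in>UNIV. f (i :: 'n::finite)) = (\<Sum>k<CARD('n). f (enum k))"
  using sum.reindex_bij_betw[OF bij_enum, of f] by simp

definition rho :: "'n::finite \<Rightarrow> int" where
  "rho i = int (CARD('n)) - 1 - int (rank i)"

lemma rho_nonneg: "0 \<le> rho i"
  using rank_less[of i] unfolding rho_def by linarith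

definition alt :: "('n::finite \<Rightarrow> int) \<Rightarrow> ('n \<Rightarrow> complex) \<Rightarrow> complex" where
  "alt l t = det (\<chi> i j. t i powi (l j + rho j))"

lemma alt_eq: "alt l t = (\<Sum>p | p permutes UNIV. of_int (sign p) * (\<Prod>i\<in>UNIV. t i powi (l (p i) + rho (p i))))"
  by (simp add: alt_def det_def)

definition dominant :: "('n::finite \<Rightarrow> int) \<Rightarrow> bool" where
  "dominant l \<longleftrightarrow> (\<forall>k. Suc k < CARD('n) \<longrightarrow> l (enum (Suc k)) \<le> l (enum k))"

lemma dominant_mono:
  assumes "dominant (l :: 'n::finite \<Rightarrow> int)" "j \<le> k" "k < CARD('n)"
  shows "l (enum k) \<le> l (enum j)"
  using assms(2,3)
proof (induction rule: dec_induct)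
  case (step n)
  have "l (enum (Suc n)) \<le> l (enum n)" using assms(1) step.prems by (simp add: dominant_def)
  then show ?case using step by simp
qed simp

text \<open>In the summand of the permutation p, \<gamma> may be replaced by
  \<open>\<gamma> \<circ> p\<close> because K is stable under permutations; then all exponents are
  permuted together.\<close>

lemma alt_mult_symmetric:
  fixes t :: "'n::finite \<Rightarrow> complex"
  assumes t: "\<And>i. t i \<noteq> 0" and K: "finite K" and sym: "\<And>p \<gamma>. p permutes UNIV \<Longrightarrow> \<gamma> \<in> K \<Longrightarrow> \<gamma> \<circ> p \<in> K"
  shows "alt l t * (\<Sum>\<gamma>\<in>K. \<Prod>i\<in>UNIV. t i powi \<gamma> i) = (\<Sum>\<gamma>\<in>K. alt (\<lambda>j. l j + \<gamma> j) t)"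
proof -
  have perm: "(\<Sum>\<gamma>\<in>K. \<Prod>i\<in>UNIV. t i powi \<gamma> (p i)) = (\<Sum>\<gamma>\<in>K. \<Prod>i\<in>UNIV. t i powi \<gamma> i)" if p: "p permutes UNIV" for p
    by (rule sum.reindex_bij_witness[where i = "\<lambda>\<gamma>. \<gamma> \<circ> inv p" and j = "\<lambda>\<gamma>. \<gamma> \<circ> p"])
       (use p sym permutes_inv[OF p] in \<open>auto simp: o_def permutes_inverses\<close>)
  have "(\<Sum>\<gamma>\<in>K. alt (\<lambda>j. l j + \<gamma> j) t) = (\<Sum>\<gamma>\<in>K. \<Sum>p | p permutes UNIV.
      of_int (sign p) * (\<Prod>i\<in>UNIV. t i powi (l (p i) + rho (p i))) * (\<Prod>i\<in>UNIV. t i powi \<gamma> (p i)))"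
    unfolding alt_eq
  proof (intro sum.cong refl, goal_cases)
    case (1 \<gamma> p)
    have "(\<Prod>i\<in>UNIV. t i powi (l (p i) + \<gamma> (p i) + rho (p i))) =
       (\<Prod>i\<in>UNIV. t i powi (l (p i) + rho (p i)) * t i powi \<gamma> (p i))"
      using t by (intro prod.cong refl) (simp add: power_int_add[symmetric] algebra_simps)
    then show ?case by (simp add: prod.distrib)
  qed
  also have "\<dots> = (\<Sum>p | p permutes UNIV. of_int (sign p) * (\<Prod>i\<in>UNIV. t i powi (l (p i) + rho (p i))) *
      (\<Sum>\<gamma>\<in>K. \<Prod>i\<in>UNIV. t i powi \<gamma> (p i)))"
    by (subst sum.swap) (simp add: sum_distrib_left)
  also have "\<dots> = alt l t * (\<Sum>\<gamma>\<in>K. \<Prod>i\<in>UNIV. t i powi \<gamma> i)"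
    unfolding alt_eq sum_distrib_right by (intro sum.cong refl) (simp add: perm)
  finally show ?thesis ..
qed

text \<open>An adjacent transposition acting on \<open>l + rho\<close>: neighbouring values of
  \<open>rho\<close> differ by 1, so the entries of l are shifted by 1 as they change places. The
  enumeration is a parameter because removing strips uses the reversed order.\<close>

definition dot_swap :: "(nat \<Rightarrow> 'n) \<Rightarrow> nat \<Rightarrow> ('n \<Rightarrow> int) \<Rightarrow> 'n \<Rightarrow> int" where
  "dot_swap e k l = l (e k := l (e (Suc k)) - 1, e (Suc k) := l (e k) + 1)"

lemma alt_dot_swap:
  fixes t :: "'n::finite \<Rightarrow> complex"
  assumes k: "Suc k < CARD('n)"
  shows "alt (dot_swap enum k l) t = - alt l t"
proof -
  let ?a = "enum k :: 'n" and ?b = "enum (Suc k) :: 'n"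
  have ab: "?a \<noteq> ?b" using k by (simp add: enum_eq_iff)
  have r: "rho ?a = rho ?b + 1" using k by (simp add: rho_def)
  have "alt (dot_swap enum k l) t =
      det (\<chi> i j. (\<chi> i j. t i powi (l j + rho j)) $ i $ (Transposition.transpose ?a ?b j))"
    unfolding alt_def using ab r
    by (intro arg_cong[of _ _ det]) (auto simp: vec_eq_iff dot_swap_def Transposition.transpose_def algebra_simps)
  also have "\<dots> = of_int (sign (Transposition.transpose ?a ?b)) * alt l t"
    unfolding alt_def by (rule det_permute_columns) (simp add: permutes_swap_id)
  finally show ?thesis using ab by (simp add: sign_swap_id)
qed

text \<open>Two columns of the determinant agree: the weight is fixed by a transposition that
  changes the sign.\<close>

lemma alt_eq_0:
  fixes t :: "'n::finite \<Rightarrow> complex"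
  assumes k: "Suc k < CARD('n)" and l: "l (enum (Suc k)) = l (enum k) + 1"
  shows "alt l t = 0"
proof -
  have "dot_swap enum k l = l" using l by (auto simp: dot_swap_def)
  then show ?thesis using alt_dot_swap[OF k, of l t] by simp
qed

text \<open>Alternating sums with weights: \<open>t\<^sub>a \<partial>/\<partial>t\<^sub>a\<close> multiplies the weight by the exponent of \<open>t\<^sub>a\<close>.\<close>

definition weighted_alt :: "(int \<Rightarrow> complex) \<Rightarrow> 'n \<Rightarrow> ('n::finite \<Rightarrow> int) \<Rightarrow> ('n \<Rightarrow> complex) \<Rightarrow> complex" where
  "weighted_alt w a l t = (\<Sum>p | p permutes UNIV. of_int (sign p) * w (l (p a) + rho (p a)) *
                     (\<Prod>i\<in>UNIV. t i powi (l (p i) + rho (p i))))"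

lemma weighted_alt_1: "weighted_alt (\<lambda>_. 1) a l t = alt l t"
  by (simp add: weighted_alt_def alt_eq)

text \<open>Summed over a, the weights no longer depend on the permutation.\<close>

lemma sum_weighted_alt:
  "(\<Sum>a\<in>UNIV. weighted_alt w a l t) = (\<Sum>j\<in>UNIV. w (l j + rho j)) * alt l t"
proof -
  have "(\<Sum>a\<in>UNIV. w (l (p a) + rho (p a))) = (\<Sum>j\<in>UNIV. w (l j + rho j))" if "p permutes UNIV" for p :: "'a \<Rightarrow> 'a"
    using sum.permute[OF that, of "\<lambda>j. w (l j + rho j)"] by (simp add: o_def)
  then show ?thesis
    unfolding weighted_alt_def alt_eq sum_distrib_left
    by (subst sum.swap) (auto intro!: sum.cong simp: mult_ac simp flip: sum_distrib_right sum_distrib_left)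
qed

text \<open>Differentiation at s = 0 along this curve is
  \<open>t\<^sub>a \<partial>/\<partial>t\<^sub>a\<close>; on diagonal matrices it is left
  translation by \<open>elementary a a s\<close>.\<close>

abbreviation rescale :: "'n \<Rightarrow> real \<Rightarrow> ('n \<Rightarrow> complex) \<Rightarrow> 'n \<Rightarrow> complex" where
  "rescale a s t \<equiv> t(a := exp (complex_of_real s) * t a)"

lemma weighted_alt_derivative:
  assumes t: "\<And>i. t i \<noteq> (0 :: complex)"
  shows "((\<lambda>s. weighted_alt w a l (rescale a s t)) has_vector_derivative
           weighted_alt (\<lambda>b. of_int b * w b) a l t) (at 0)"
proof -
  have e: "((\<lambda>s. exp (complex_of_real s * of_int m)) has_vector_derivative of_int m) (at 0)" for m
  proof -
    have "((\<lambda>z. exp (z * of_int m)) has_field_derivative (of_int m :: complex)) (at (of_real 0))"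
      by (auto intro!: derivative_eq_intros)
    from has_vector_derivative_real_field[OF this] show ?thesis by simp
  qed
  have *: "(\<Prod>i\<in>UNIV. (rescale a s t) i powi (g i)) =
      exp (complex_of_real s * of_int (g a)) * (\<Prod>i\<in>UNIV. t i powi g i)" for s and g :: "'a \<Rightarrow> int"
  proof -
    have "(\<Prod>i\<in>UNIV. (rescale a s t) i powi (g i)) =
      (\<Prod>i\<in>UNIV. (if i = a then exp (complex_of_real s * of_int (g a)) else 1) * t i powi g i)"
      by (intro prod.cong refl) (auto simp: power_int_mult_distrib exp_power_int mult.commute)
    then show ?thesis by (simp add: prod.distrib)
  qed
  have "((\<lambda>s. \<Sum>p | p permutes UNIV. of_int (sign p) * w (l (p a) + rho (p a)) * (\<Prod>i\<in>UNIV. t i powi (l (p i) + rho (p i))) *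
        exp (complex_of_real s * of_int (l (p a) + rho (p a))))
      has_vector_derivative (\<Sum>p | p permutes UNIV. of_int (sign p) * w (l (p a) + rho (p a)) * (\<Prod>i\<in>UNIV. t i powi (l (p i) + rho (p i))) * of_int (l (p a) + rho (p a)))) (at 0)"
    by (intro has_vector_derivative_sum has_vector_derivative_mult_right e)
  then show ?thesis unfolding weighted_alt_def * by (simp add: mult_ac)
qed

definition regular :: "('n \<Rightarrow> complex) \<Rightarrow> bool" where
  "regular t \<longleftrightarrow> inj t \<and> (\<forall>i. t i \<noteq> 0)"

lemma poly_eq_smult_prod:
  fixes q :: "complex poly"
  assumes R: "finite R" and deg: "degree q \<le> card R" and roots: "\<And>r. r \<in> R \<Longrightarrow> poly q r = 0"
  shows "q = smult (coeff q (card R)) (\<Prod>r\<in>R. [:- r, 1:])"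
proof -
  define P where "P = (\<Prod>r\<in>R. [:- r, 1:] :: complex poly)"
  have dP: "degree P = card R" using R by (simp add: P_def degree_prod_eq_sum_degree)
  have cP: "coeff P (card R) = 1"
    using R by (simp flip: dP add: P_def lead_coeff_prod)
  define d where "d = q - smult (coeff q (card R)) P"
  have dd: "degree d \<le> card R" unfolding d_def
    using deg dP by (intro degree_diff_le) (auto intro: order_trans[OF degree_smult_le])
  have "coeff d (card R) = 0" by (simp add: d_def cP)
  have "d = 0"
  proof (rule ccontr)
    assume "d \<noteq> 0"
    then have "degree d \<noteq> card R" using \<open>coeff d (card R) = 0\<close> by (metis leading_coeff_0_iff)
    then have "degree d < card R" using dd by simp
    moreover have "card R \<le> card {x. poly d x = 0}"
      using R roots by (intro card_mono poly_roots_finite \<open>d \<noteq> 0\<close>) (auto simp: d_def P_def poly_prod)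
    ultimately show False using card_poly_roots_bound[OF \<open>d \<noteq> 0\<close>] by simp
  qed
  then show ?thesis by (simp add: d_def P_def)
qed

text \<open>As a polynomial in \<open>t\<^sub>a\<close>, the alternant has degree at most N - 1 and
  vanishes at the N - 1 values \<open>t\<^sub>b\<close>, so it is a constant times
  \<open>\<Prod> (t\<^sub>a - t\<^sub>b)\<close>, whose logarithmic derivative is the sum. The
  constant involves the other variables and can stay unknown.\<close>

lemma rho_log_derivative:
  fixes t :: "'n::finite \<Rightarrow> complex"
  assumes t: "regular t"
  shows "weighted_alt (\<lambda>b. of_int b) a (\<lambda>_. 0) t = (\<Sum>b\<in>UNIV - {a}. t a / (t a - t b)) * alt (\<lambda>_. 0) t"
proof -
  have t0: "t i \<noteq> 0" for i using t by (simp add: regular_def)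
  have tinj: "t i = t j \<longleftrightarrow> i = j" for i j using t by (auto simp: regular_def inj_def)
  define q :: "complex poly" where
    "q = (\<Sum>p | p permutes UNIV. monom (of_int (sign p) * (\<Prod>i\<in>UNIV - {a}. t i powi rho (p i))) (nat (rho (p a))))"
  have q: "poly q x = alt (\<lambda>_. 0) (t(a := x))" for x
  proof -
    have "alt (\<lambda>_. 0) (t(a := x)) = (\<Sum>p | p permutes UNIV. of_int (sign p) * (x powi rho (p a) * (\<Prod>i\<in>UNIV - {a}. t i powi rho (p i))))"
      unfolding alt_eq
    proof (intro sum.cong refl, goal_cases)
      case (1 p)
      have "(\<Prod>i\<in>UNIV. (t(a := x)) i powi (0 + rho (p i))) = x powi rho (p a) * (\<Prod>i\<in>UNIV - {a}. (t(a := x)) i powi (0 + rho (p i)))"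
        by (subst prod.remove[of _ a]) auto
      also have "(\<Prod>i\<in>UNIV - {a}. (t(a := x)) i powi (0 + rho (p i))) = (\<Prod>i\<in>UNIV - {a}. t i powi rho (p i))"
        by (intro prod.cong) auto
      finally show ?case by simp
    qed
    also have "\<dots> = poly q x"
      unfolding q_def poly_sum poly_monom
      by (intro sum.cong refl) (simp add: power_int_def rho_nonneg mult_ac)
    finally show ?thesis ..
  qed
  define R where "R = t ` (UNIV - {a})"
  have injR: "inj_on t (UNIV - {a})" by (auto simp: inj_on_def tinj)
  have cR: "card R = CARD('n) - 1" by (simp add: R_def card_image[OF injR] card_Diff_singleton)
  have deg: "degree q \<le> card R"
    unfolding q_def cR
  proof (intro degree_sum_le order_trans[OF degree_monom_le])
    fix p :: "'n \<Rightarrow> 'n"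
    show "nat (rho (p a)) \<le> CARD('n) - 1" by (simp add: rho_def)
  qed (rule finite_permutations, simp)
  have "poly q r = 0" if r: "r \<in> R" for r
  proof -
    obtain b where b: "b \<noteq> a" "r = t b" using r by (auto simp: R_def)
    show ?thesis unfolding q alt_def
      by (rule det_identical_rows[of a b]) (use b in \<open>auto simp: row_def vec_eq_iff\<close>)
  qed
  then have "q = smult (coeff q (card R)) (\<Prod>r\<in>R. [:- r, 1:])"
    by (intro poly_eq_smult_prod deg) (auto simp: R_def)
  then obtain C where "q = smult C (\<Prod>r\<in>R. [:- r, 1:])" by blast
  then have qC: "poly q x = C * (\<Prod>b\<in>UNIV - {a}. x - t b)" for x
    by (simp add: poly_prod R_def prod.reindex[OF injR] o_def)
  have "((\<lambda>u. exp u * t a - t b) has_field_derivative t a) (at (of_real 0))" for b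
    by (auto intro!: derivative_eq_intros)
  then have "((\<lambda>u. \<Prod>b\<in>UNIV - {a}. exp u * t a - t b) has_field_derivative
     (\<Prod>b\<in>UNIV - {a}. exp (of_real 0) * t a - t b) * (\<Sum>b\<in>UNIV - {a}. t a / (exp (of_real 0) * t a - t b))) (at (of_real 0))"
    by (intro has_field_derivative_prod') (auto simp: tinj)
  from DERIV_cmult[OF this, of C] has_vector_derivative_real_field
  have "((\<lambda>s. C * (\<Prod>b\<in>UNIV - {a}. exp (complex_of_real s) * t a - t b)) has_vector_derivative
    C * ((\<Prod>b\<in>UNIV - {a}. exp (of_real 0) * t a - t b) * (\<Sum>b\<in>UNIV - {a}. t a / (exp (of_real 0) * t a - t b)))) (at 0)"
    by fastforce
  then have "((\<lambda>s. alt (\<lambda>_. 0) (rescale a s t)) has_vector_derivative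
    alt (\<lambda>_. 0) t * (\<Sum>b\<in>UNIV - {a}. t a / (t a - t b))) (at 0)"
    using q[of "t a"] by (simp add: qC mult.assoc[symmetric] flip: q)
  moreover have "((\<lambda>s. alt (\<lambda>_. 0) (rescale a s t)) has_vector_derivative
     weighted_alt (\<lambda>b. of_int b) a (\<lambda>_. 0) t) (at 0)"
    using weighted_alt_derivative[OF t0, of "\<lambda>_. 1" a "\<lambda>_. 0"] by (simp add: weighted_alt_1)
  ultimately show ?thesis
    using vector_derivative_unique_at by (fastforce simp: mult.commute)
qed

text \<open>A kernel vector of the matrix would be the coefficient vector of a nonzero polynomial of
  degree less than N with the N distinct roots \<open>t\<^sub>i\<close>.\<close>

lemma alt_rho_nonzero:
  fixes t :: "'n::finite \<Rightarrow> complex"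
  assumes t: "regular t"
  shows "alt (\<lambda>_. 0) t \<noteq> 0"
proof
  assume "alt (\<lambda>_. 0) t = 0"
  define Z where "Z = (\<chi> i j. t i powi rho (j :: 'n))"
  have "det Z = 0" using \<open>alt (\<lambda>_. 0) t = 0\<close> by (simp add: alt_def Z_def)
  then obtain w where w: "Z *v w = 0" "w \<noteq> 0" by (rule det_0_kernel)
  define q where "q = (\<Sum>j\<in>UNIV. monom (w $ j) (nat (rho j)))"
  have inj: "nat (rho i) = nat (rho j) \<longleftrightarrow> i = j" for i j :: 'n
    using rho_nonneg[of i] rho_nonneg[of j] inj_rank by (auto simp: nat_eq_iff rho_def inj_def)
  have "poly q (t i) = 0" for i
    using w(1) by (simp add: q_def poly_sum poly_monom Z_def matrix_vector_mult_def vec_eq_iff power_int_def rho_nonneg mult.commute)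
  have cq: "coeff q (nat (rho j)) = w $ j" for j
    by (simp add: q_def coeff_sum inj sum.If_cases)
  have "degree q < CARD('n)"
  proof -
    have "degree q \<le> CARD('n) - 1" unfolding q_def
    proof (intro degree_sum_le order_trans[OF degree_monom_le])
      fix j :: "'n" show "nat (rho j) \<le> CARD('n) - 1" by (simp add: rho_def)
    qed simp
    moreover have "CARD('n) > 0" by simp
    ultimately show ?thesis by linarith
  qed
  have "q \<noteq> 0" using w(2) cq by (auto simp: vec_eq_iff)
  have "CARD('n) = card (range t)" using t by (simp add: regular_def card_image)
  also have "\<dots> \<le> card {x. poly q x = 0}"
    using \<open>\<And>i. poly q (t i) = 0\<close> by (intro card_mono poly_roots_finite \<open>q \<noteq> 0\<close>) auto
  also have "\<dots> \<le> degree q" by (rule card_poly_roots_bound[OF \<open>q \<noteq> 0\<close>])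
  finally show False using \<open>degree q < CARD('n)\<close> by simp
qed

definition casimir :: "('n::finite \<Rightarrow> int) \<Rightarrow> int" where
  "casimir l = (\<Sum>j\<in>UNIV. (l j + rho j)\<^sup>2) - (\<Sum>j\<in>UNIV. (rho (j::'n))\<^sup>2) -
                (int CARD('n) - 1) * ((\<Sum>j\<in>UNIV. l j + rho j) - (\<Sum>j\<in>UNIV. rho (j::'n)))"

lemma casimir_0: "casimir (\<lambda>_. 0) = 0"
  by (simp add: casimir_def)

text \<open>Expanding the squares gives
  \<open>\<Sum> l\<^sub>j\<^sup>2 + \<Sum> l\<^sub>j r\<^sub>j\<close> with
  \<open>r = 2 rho - (N - 1)\<close>, which decreases along the enumeration and has sum 0. Since l
  decreases as well, Chebyshev's inequality makes the second sum nonnegative.\<close>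

lemma casimir_pos:
  fixes l :: "'n::finite \<Rightarrow> int"
  assumes dom: "dominant l" and "l \<noteq> (\<lambda>_. 0)"
  shows "casimir l > 0"
proof -
  define N where "N = CARD('n)"
  define r where "r j = 2 * rho j - (int N - 1)" for j :: 'n
  have 1: "casimir l = (\<Sum>j\<in>UNIV. (l j)\<^sup>2) + (\<Sum>j\<in>UNIV. l j * r j)"
    unfolding casimir_def r_def N_def[symmetric]
    by (simp add: power2_sum sum.distrib sum_distrib_left algebra_simps sum_subtractf)
  obtain j where "l j \<noteq> 0" using assms(2) by auto
  then have 2: "(\<Sum>j\<in>UNIV. (l j)\<^sup>2) > 0" by (intro sum_pos2[of _ j]) auto
  have r: "r (enum k) = int N - 1 - 2 * int k" if "k < N" for k
    using that by (simp add: r_def rho_def N_def)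
  have "2 * (\<Sum>k=0..<m. int k) = int m * (int m - 1)" for m
    by (induction m) (simp_all add: algebra_simps)
  then have "(\<Sum>k=0..<N. int N - 1 - 2 * int k) = 0"
    by (simp add: sum_subtractf flip: sum_distrib_left)
  note sr = this
  \<comment> \<open>The upper form of Chebyshev's inequality wants oppositely ordered sequences,
    hence the negated l.\<close>
  have "int N * (\<Sum>k=0..<N. (- l (enum k)) * (int N - 1 - 2 * int k)) \<le>
      (\<Sum>k=0..<N. - l (enum k)) * (\<Sum>k=0..<N. int N - 1 - 2 * int k)"
    by (rule Chebyshev_sum_upper) (auto simp: N_def intro!: dominant_mono dom)
  then have "int N * (\<Sum>k=0..<N. l (enum k) * (int N - 1 - 2 * int k)) \<ge> 0"
    unfolding sr by (simp add: sum_negf)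
  moreover have "N > 0" by (simp add: N_def)
  ultimately have "(\<Sum>k=0..<N. l (enum k) * (int N - 1 - 2 * int k)) \<ge> 0"
    by (simp add: zero_le_mult_iff)
  also have "(\<Sum>k=0..<N. l (enum k) * (int N - 1 - 2 * int k)) = (\<Sum>j\<in>UNIV. l j * r j)"
    unfolding sum_enum N_def[symmetric] atLeast0LessThan by (intro sum.cong) (auto simp: r)
  finally show ?thesis using 1 2 by simp
qed

section \<open>Pieri rules\<close>

definition indic :: "'n set \<Rightarrow> 'n \<Rightarrow> int" where
  "indic S j = (if j \<in> S then 1 else 0)"

definition esym :: "nat \<Rightarrow> ('n::finite \<Rightarrow> complex) \<Rightarrow> complex" where
  "esym r t = (\<Sum>S | card S = r. \<Prod>i\<in>S. t i)"

definition hsym :: "nat \<Rightarrow> ('n::finite \<Rightarrow> complex) \<Rightarrow> complex" where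
  "hsym r t = (\<Sum>\<gamma> | (\<forall>i. \<gamma> i \<ge> 0) \<and> (\<Sum>i\<in>UNIV. \<gamma> i) = int r. \<Prod>i\<in>UNIV. t i powi \<gamma> i)"

definition vstrip :: "nat \<Rightarrow> ('n::finite \<Rightarrow> int) \<Rightarrow> ('n \<Rightarrow> int) \<Rightarrow> bool" where
  "vstrip r l k \<longleftrightarrow> (\<exists>S. card S = r \<and> k = (\<lambda>j. l j + indic S j))"

text \<open>The interlacing \<open>k\<^sub>i\<^sub>+\<^sub>1 \<le> l\<^sub>i \<le> k\<^sub>i\<close>
  already makes l and k dominant. \<open>vstrip\<close> implies no such thing, which is why
  dominance stands beside it in the Pieri rule for \<open>esym\<close>.\<close>

definition hstrip :: "nat \<Rightarrow> ('n::finite \<Rightarrow> int) \<Rightarrow> ('n \<Rightarrow> int) \<Rightarrow> bool" where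
  "hstrip r l k \<longleftrightarrow> (\<forall>j. l j \<le> k j) \<and> (\<Sum>j\<in>UNIV. k j) = (\<Sum>j\<in>UNIV. l j) + int r \<and>
     (\<forall>i. Suc i < CARD('n) \<longrightarrow> k (enum (Suc i)) \<le> l (enum i))"

lemma prod_powi_indic: "(\<Prod>i\<in>UNIV. t i powi indic S i) = (\<Prod>i\<in>(S::'n::finite set). t i :: complex)"
  by (simp add: indic_def if_distrib prod.If_cases cong: if_cong)

lemma prod_powi_minus_indic: "(\<Prod>i\<in>UNIV. t i powi (- indic S i)) = (\<Prod>i\<in>(S::'n::finite set). inverse (t i :: complex))"
  by (simp add: indic_def if_distrib prod.If_cases power_int_minus cong: if_cong)

lemma indic_permute:
  assumes "p permutes (UNIV :: 'n::finite set)"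
  shows "\<exists>T. card T = card S \<and> indic S \<circ> p = indic T"
proof (intro exI conjI)
  show "card (inv p ` S) = card S"
    using permutes_inj[OF permutes_inv[OF assms]] by (intro card_image) (auto intro: inj_on_subset)
  show "indic S \<circ> p = indic (inv p ` S)"
  proof
    fix j
    have "p j \<in> S \<longleftrightarrow> j \<in> inv p ` S"
      using permutes_inverses[OF assms] by (metis image_iff)
    then show "(indic S \<circ> p) j = indic (inv p ` S) j" by (simp add: indic_def)
  qed
qed

text \<open>Changing each row of a dominant weight by at most one box, all in the same direction,
  can break dominance between neighbours only by exactly 1, and then the alternant vanishes by
  \<open>alt_eq_0\<close>. The sign s treats both directions together.\<close>

lemma alt_mult_esym:
  fixes t :: "'n::finite \<Rightarrow> complex"
  assumes t: "\<And>i. t i \<noteq> 0" and l: "dominant l"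
  shows "alt l t * esym r t = (\<Sum>k | dominant k \<and> vstrip r l k. alt k t)"
    and "alt l t * esym r (\<lambda>i. inverse (t i)) = (\<Sum>k | dominant k \<and> vstrip r k l. alt k t)"
proof -
  have up: "alt l t * (\<Sum>S | card S = r. \<Prod>i\<in>UNIV. t i powi (s * indic S i)) =
      (\<Sum>k | dominant k \<and> (\<exists>S. card S = r \<and> k = (\<lambda>j. l j + s * indic S j)). alt k t)"
    if s: "s = 1 \<or> s = -1" for s :: int
  proof -
    define K where "K = (\<lambda>S i. s * indic S i) ` {S. card (S :: 'n set) = r}"
    have inj: "inj_on (\<lambda>S i. s * indic S i) {S. card (S :: 'n set) = r}"
      using s by (intro inj_onI) (auto simp: indic_def fun_eq_iff split: if_splits)
    have "alt l t * (\<Sum>\<gamma>\<in>K. \<Prod>i\<in>UNIV. t i powi \<gamma> i) = (\<Sum>\<gamma>\<in>K. alt (\<lambda>j. l j + \<gamma> j) t)"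
    proof (rule alt_mult_symmetric[OF t])
      fix p :: "'n \<Rightarrow> 'n" and \<gamma> assume p: "p permutes UNIV" and "\<gamma> \<in> K"
      then obtain S where S: "card S = r" "\<gamma> = (\<lambda>i. s * indic S i)" by (auto simp: K_def)
      obtain T where "card T = card S" "indic S \<circ> p = indic T" using indic_permute[OF p] by blast
      then show "\<gamma> \<circ> p \<in> K" unfolding K_def S
        by (intro image_eqI[of _ _ T]) (auto simp: fun_eq_iff S)
    qed (simp add: K_def)
    also have "(\<Sum>\<gamma>\<in>K. \<Prod>i\<in>UNIV. t i powi \<gamma> i) = (\<Sum>S | card S = r. \<Prod>i\<in>UNIV. t i powi (s * indic S i))"
      unfolding K_def by (subst sum.reindex[OF inj]) (simp add: o_def)
    also have "(\<Sum>\<gamma>\<in>K. alt (\<lambda>j. l j + \<gamma> j) t) = (\<Sum>k\<in>(\<lambda>\<gamma> j. l j + \<gamma> j) ` K. alt k t)"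
      by (subst sum.reindex) (auto simp: inj_on_def fun_eq_iff)
    also have "\<dots> = (\<Sum>k\<in>{k \<in> (\<lambda>\<gamma> j. l j + \<gamma> j) ` K. dominant k}. alt k t)"
    proof (rule sum.mono_neutral_right)
      show "\<forall>k\<in>(\<lambda>\<gamma> j. l j + \<gamma> j) ` K - {k \<in> (\<lambda>\<gamma> j. l j + \<gamma> j) ` K. dominant k}. alt k t = 0"
      proof
        fix k assume "k \<in> (\<lambda>\<gamma> j. l j + \<gamma> j) ` K - {k \<in> (\<lambda>\<gamma> j. l j + \<gamma> j) ` K. dominant k}"
        then obtain S where k: "k = (\<lambda>j. l j + s * indic S j)" and nd: "\<not> dominant k" by (auto simp: K_def)
        then obtain i where i: "Suc i < CARD('n)" "k (enum (Suc i)) > k (enum i)" by (auto simp: dominant_def not_le)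
        moreover have "l (enum (Suc i)) \<le> l (enum i)" using l i(1) by (simp add: dominant_def)
        ultimately have "k (enum (Suc i)) = k (enum i) + 1"
          using s by (auto simp: k indic_def split: if_splits)
        then show "alt k t = 0" by (rule alt_eq_0[OF i(1)])
      qed
    qed (auto simp: K_def)
    also have "{k \<in> (\<lambda>\<gamma> j. l j + \<gamma> j) ` K. dominant k} =
        {k. dominant k \<and> (\<exists>S. card S = r \<and> k = (\<lambda>j. l j + s * indic S j))}"
      by (auto simp: K_def)
    finally show ?thesis .
  qed
  show "alt l t * esym r t = (\<Sum>k | dominant k \<and> vstrip r l k. alt k t)"
    using up[of 1] by (simp add: esym_def prod_powi_indic vstrip_def)
  have "k = (\<lambda>j. l j - indic S j) \<longleftrightarrow> l = (\<lambda>j. k j + indic S j)" for k and S :: "'n set"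
    by (auto simp: fun_eq_iff)
  then show "alt l t * esym r (\<lambda>i. inverse (t i)) = (\<Sum>k | dominant k \<and> vstrip r k l. alt k t)"
    using up[of "-1"] by (simp add: esym_def prod_powi_minus_indic vstrip_def)
qed

text \<open>The exponents that violate the strip condition cancel in pairs under the dot action of an
  adjacent transposition; choosing the last violation makes this an involution.\<close>

lemma strip_cancel:
  fixes \<alpha> :: "('n::finite \<Rightarrow> int) \<Rightarrow> complex" and e :: "nat \<Rightarrow> 'n"
  assumes e: "\<And>i j. i < CARD('n) \<Longrightarrow> j < CARD('n) \<Longrightarrow> e i = e j \<Longrightarrow> i = j"
    and alt: "\<And>i k. Suc i < CARD('n) \<Longrightarrow> \<alpha> (dot_swap e i k) = - \<alpha> k"
    and l: "\<And>i. Suc i < CARD('n) \<Longrightarrow> l (e (Suc i)) \<le> l (e i)"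
    and K: "finite K" "K = {k. (\<forall>j. l j \<le> k j) \<and> (\<Sum>j\<in>UNIV. k j) = m}"
  shows "(\<Sum>k\<in>K. \<alpha> k) = (\<Sum>k\<in>{k\<in>K. \<forall>i. Suc i < CARD('n) \<longrightarrow> k (e (Suc i)) \<le> l (e i)}. \<alpha> k)"
proof -
  define viol where "viol k i \<longleftrightarrow> Suc i < CARD('n) \<and> k (e (Suc i)) > l (e i)" for k i
  define B where "B = {k\<in>K. \<exists>i. viol k i}"
  define last where "last k = Max {i. viol k i}" for k
  define \<tau> where "\<tau> k = dot_swap e (last k) k" for k
  have fin: "finite {i. viol k i}" for k
    by (rule finite_subset[of _ "{..<CARD('n)}"]) (auto simp: viol_def)
  have last: "viol k (last k)" "\<And>i. viol k i \<Longrightarrow> i \<le> last k" if "k \<in> B" for k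
    using Max_in[OF fin, of k] Max_ge[OF fin, of _ k] that by (auto simp: B_def last_def)
  have tau: "\<tau> k \<in> B" "last (\<tau> k) = last k" "\<tau> (\<tau> k) = k" "\<alpha> (\<tau> k) = - \<alpha> k" if k: "k \<in> B" for k
  proof -
    define i where "i = last k"
    have i: "viol k i" "\<And>i'. viol k i' \<Longrightarrow> i' \<le> i" using last[OF k] by (simp_all add: i_def)
    then have Si: "Suc i < CARD('n)" and v: "k (e (Suc i)) > l (e i)" by (auto simp: viol_def)
    have ne: "e i \<noteq> e (Suc i)" using e[of i "Suc i"] Si by auto
    have kl: "l j \<le> k j" for j using k by (auto simp: B_def K)
    have tk: "\<tau> k = k (e i := k (e (Suc i)) - 1, e (Suc i) := k (e i) + 1)"
      by (simp add: \<tau>_def dot_swap_def i_def)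
    \<comment> \<open>The violation gives \<open>k (e (Suc i)) - 1 \<ge> l (e i)\<close>, and
      \<open>k (e i) + 1\<close> exceeds \<open>l (e i) \<ge> l (e (Suc i))\<close>.\<close>
    have ge: "l j \<le> \<tau> k j" for j
      using kl[of j] kl[of "e i"] v l[OF Si] by (auto simp: tk)
    have "(\<Sum>j\<in>UNIV. \<tau> k j) = (\<Sum>j\<in>UNIV. k j + (if j = e i then k (e (Suc i)) - 1 - k (e i) else 0) +
        (if j = e (Suc i) then k (e i) + 1 - k (e (Suc i)) else 0))"
      using ne by (intro sum.cong) (auto simp: tk)
    then have sum: "(\<Sum>j\<in>UNIV. \<tau> k j) = m" using k by (simp add: sum.distrib B_def K)
    have vi: "viol (\<tau> k) i" using Si kl[of "e i"] ne by (simp add: viol_def tk)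
    show B: "\<tau> k \<in> B" using ge sum vi by (auto simp: B_def K)
    \<comment> \<open>The swap changes only the entries at positions i and i + 1, while a violation
      at i' concerns the entry at position i' + 1.\<close>
    have "\<not> viol (\<tau> k) i'" if "i' > i" for i'
    proof
      assume v': "viol (\<tau> k) i'"
      then have "e (Suc i') \<noteq> e i" "e (Suc i') \<noteq> e (Suc i)"
        using e[of "Suc i'" i] e[of "Suc i'" "Suc i"] that Si by (auto simp: viol_def)
      then have "viol k i'" using v' by (simp add: viol_def tk)
      then show False using i(2) that by fastforce
    qed
    then have "last (\<tau> k) = i"
      using last[OF B] vi by (metis linorder_neqE_nat not_le)
    then show lst: "last (\<tau> k) = last k" by (simp add: i_def)
    show "\<tau> (\<tau> k) = k"
      unfolding \<tau>_def[of "\<tau> k"] lst using ne by (auto simp: dot_swap_def tk i_def[symmetric])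
    show "\<alpha> (\<tau> k) = - \<alpha> k" unfolding \<tau>_def i_def[symmetric] by (rule alt[OF Si])
  qed
  have "(\<Sum>k\<in>B. \<alpha> k) = (\<Sum>k\<in>B. - \<alpha> k)"
    by (rule sum.reindex_bij_witness[where i=\<tau> and j=\<tau>]) (auto simp: tau)
  then have "(\<Sum>k\<in>B. \<alpha> k) = 0" by (simp add: sum_negf)
  moreover have "K = {k\<in>K. \<forall>i. Suc i < CARD('n) \<longrightarrow> k (e (Suc i)) \<le> l (e i)} \<union> B"
    by (auto simp: B_def viol_def not_le)
  then have "(\<Sum>k\<in>K. \<alpha> k) = (\<Sum>k\<in>{k\<in>K. \<forall>i. Suc i < CARD('n) \<longrightarrow> k (e (Suc i)) \<le> l (e i)}. \<alpha> k) + (\<Sum>k\<in>B. \<alpha> k)"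
    using K(1) by (subst sum.union_disjoint[symmetric]) (auto simp: B_def viol_def)
  ultimately show ?thesis by simp
qed

lemma finite_compositions: "finite {\<gamma> :: 'n::finite \<Rightarrow> int. (\<forall>i. \<gamma> i \<ge> 0) \<and> (\<Sum>i\<in>UNIV. \<gamma> i) = m}"
proof (rule finite_subset)
  show "{\<gamma> :: 'n \<Rightarrow> int. (\<forall>i. \<gamma> i \<ge> 0) \<and> (\<Sum>i\<in>UNIV. \<gamma> i) = m} \<subseteq> PiE UNIV (\<lambda>_. {0..m})"
  proof
    fix \<gamma> :: "'n \<Rightarrow> int" assume "\<gamma> \<in> {\<gamma>. (\<forall>i. \<gamma> i \<ge> 0) \<and> (\<Sum>i\<in>UNIV. \<gamma> i) = m}"
    then have "\<gamma> i \<ge> 0" "\<gamma> i \<le> m" for i using member_le_sum[of i UNIV \<gamma>] by auto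
    then show "\<gamma> \<in> PiE UNIV (\<lambda>_. {0..m})" by auto
  qed
  show "finite (PiE (UNIV :: 'n set) (\<lambda>_. {0..m}))" by (rule finite_PiE) auto
qed

text \<open>Multiplication produces all weights above l of the right size, and
  \<open>strip_cancel\<close> leaves those that interlace. For the inverse variables, negating the
  weights and reversing the enumeration turns the removal of a strip into an addition.\<close>

lemma alt_mult_hsym:
  fixes t :: "'n::finite \<Rightarrow> complex"
  assumes t: "\<And>i. t i \<noteq> 0" and l: "dominant l"
  shows "alt l t * hsym r t = (\<Sum>k | hstrip r l k. alt k t)"
    and "alt l t * hsym r (\<lambda>i. inverse (t i)) = (\<Sum>k | hstrip r k l. alt k t)"
proof -
  define C where "C = {\<gamma> :: 'n \<Rightarrow> int. (\<forall>i. \<gamma> i \<ge> 0) \<and> (\<Sum>i\<in>UNIV. \<gamma> i) = int r}"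
  have C: "finite C" unfolding C_def by (rule finite_compositions)
  have Cp: "\<gamma> \<circ> p \<in> C" if "p permutes UNIV" "\<gamma> \<in> C" for p \<gamma>
    using that sum.permute[OF that(1), of \<gamma>] by (auto simp: C_def)
  have "alt l t * hsym r t = (\<Sum>\<gamma>\<in>C. alt (\<lambda>j. l j + \<gamma> j) t)"
    unfolding hsym_def C_def[symmetric] by (rule alt_mult_symmetric[OF t C Cp])
  also have "\<dots> = (\<Sum>k | (\<forall>j. l j \<le> k j) \<and> (\<Sum>j\<in>UNIV. k j) = (\<Sum>j\<in>UNIV. l j) + int r. alt k t)"
    by (rule sum.reindex_bij_witness[where i = "\<lambda>k j. k j - l j" and j = "\<lambda>\<gamma> j. l j + \<gamma> j"])
       (auto simp: C_def sum.distrib sum_subtractf)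
  also have "\<dots> = (\<Sum>k | hstrip r l k. alt k t)"
  proof (subst strip_cancel[where e = enum and l = l and m = "(\<Sum>j\<in>UNIV. l j) + int r"])
    show "finite {k. (\<forall>j. l j \<le> k j) \<and> (\<Sum>j\<in>UNIV. k j) = (\<Sum>j\<in>UNIV. l j) + int r}"
    proof (rule finite_subset)
      show "{k. (\<forall>j. l j \<le> k j) \<and> (\<Sum>j\<in>UNIV. k j) = (\<Sum>j\<in>UNIV. l j) + int r} \<subseteq> (\<lambda>\<gamma> j. l j + \<gamma> j) ` C"
        by (auto simp: C_def sum_subtractf intro!: image_eqI[where x = "\<lambda>j. _ j - l j"])
    qed (use C in simp)
  qed (use l in \<open>auto simp: enum_eq_iff alt_dot_swap dominant_def hstrip_def intro!: sum.cong\<close>)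
  finally show "alt l t * hsym r t = (\<Sum>k | hstrip r l k. alt k t)" .
  \<comment> \<open>Along the reversed enumeration \<open>- l\<close> is again decreasing, as
    \<open>strip_cancel\<close> requires.\<close>
  define e' where "e' i = (enum (CARD('n) - 1 - i) :: 'n)" for i
  have nn: "0 \<le> k j + l j" if "\<forall>j. - l j \<le> k j" for k j
    using that[rule_format, of j] by linarith
  have Cp': "\<gamma> \<circ> p \<in> (\<lambda>\<gamma> j. - \<gamma> j) ` C" if "p permutes UNIV" "\<gamma> \<in> (\<lambda>\<gamma> j. - \<gamma> j) ` C" for p \<gamma>
  proof -
    obtain \<delta> where "\<delta> \<in> C" "\<gamma> = (\<lambda>j. - \<delta> j)" using \<open>\<gamma> \<in> _\<close> by auto
    then show ?thesis using Cp[OF that(1), of \<delta>] by (intro image_eqI[of _ _ "\<delta> \<circ> p"]) auto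
  qed
  have "alt l t * hsym r (\<lambda>i. inverse (t i)) = alt l t * (\<Sum>\<gamma>\<in>(\<lambda>\<gamma> j. - \<gamma> j) ` C. \<Prod>i\<in>UNIV. t i powi \<gamma> i)"
    unfolding hsym_def C_def[symmetric]
    by (subst sum.reindex) (auto simp: inj_on_def fun_eq_iff power_int_minus power_int_inverse)
  also have "\<dots> = (\<Sum>\<gamma>\<in>(\<lambda>\<gamma> j. - \<gamma> j) ` C. alt (\<lambda>j. l j + \<gamma> j) t)"
    by (rule alt_mult_symmetric[OF t _ Cp']) (use C in simp)
  also have "\<dots> = (\<Sum>k | (\<forall>j. - l j \<le> k j) \<and> (\<Sum>j\<in>UNIV. k j) = - (\<Sum>j\<in>UNIV. l j) + int r. alt (\<lambda>j. - k j) t)"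
    by (rule sum.reindex_bij_witness[where i = "\<lambda>k j. - (k j + l j)" and j = "\<lambda>\<gamma> j. - l j - \<gamma> j"])
       (auto simp: C_def sum.distrib sum_subtractf sum_negf intro!: image_eqI[where x = "\<lambda>j. _ j + l j"] nn)
  also have "\<dots> = (\<Sum>k | (\<forall>j. - l j \<le> k j) \<and> (\<Sum>j\<in>UNIV. k j) = - (\<Sum>j\<in>UNIV. l j) + int r \<and>
      (\<forall>i. Suc i < CARD('n) \<longrightarrow> k (e' (Suc i)) \<le> - l (e' i)). alt (\<lambda>j. - k j) t)"
  proof (subst strip_cancel[where e = e' and l = "\<lambda>j. - l j" and m = "- (\<Sum>j\<in>UNIV. l j) + int r"])
    show "finite {k. (\<forall>j. - l j \<le> k j) \<and> (\<Sum>j\<in>UNIV. k j) = - (\<Sum>j\<in>UNIV. l j) + int r}"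
    proof (rule finite_subset)
      show "{k. (\<forall>j. - l j \<le> k j) \<and> (\<Sum>j\<in>UNIV. k j) = - (\<Sum>j\<in>UNIV. l j) + int r} \<subseteq> (\<lambda>\<gamma> j. \<gamma> j - l j) ` C"
      proof
        fix k assume "k \<in> {k. (\<forall>j. - l j \<le> k j) \<and> (\<Sum>j\<in>UNIV. k j) = - (\<Sum>j\<in>UNIV. l j) + int r}"
        then have "- l j \<le> k j" "(\<Sum>j\<in>UNIV. k j) = - (\<Sum>j\<in>UNIV. l j) + int r" for j by auto
        then have "0 \<le> k j + l j" "(\<Sum>j\<in>UNIV. k j + l j) = int r" for j
          using add_le_cancel_right[of "- l j" "l j" "k j"] by (simp_all add: sum.distrib)
        then show "k \<in> (\<lambda>\<gamma> j. \<gamma> j - l j) ` C"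
          by (intro image_eqI[of _ _ "\<lambda>j. k j + l j"]) (auto simp: C_def)
      qed
    qed (use C in simp)
    fix i :: nat assume i: "Suc i < CARD('n)"
    then have i': "Suc (CARD('n) - 2 - i) < CARD('n)" "CARD('n) - 1 - Suc i = CARD('n) - 2 - i"
       "CARD('n) - 1 - i = Suc (CARD('n) - 2 - i)" by auto
    \<comment> \<open>Negation flips the shifts by 1 in \<open>dot_swap\<close>, and the reversed
      order flips them back.\<close>
    have "(\<lambda>j. - dot_swap e' i k j) = dot_swap enum (CARD('n) - 2 - i) (\<lambda>j. - k j)" for k
      using enum_eq_iff[where 'n='n, of "Suc (CARD('n) - 2 - i)" "CARD('n) - 2 - i"] i'
      by (auto simp: dot_swap_def e'_def i' fun_eq_iff)
    then show "alt (\<lambda>j. - dot_swap e' i k j) t = - alt (\<lambda>j. - k j) t" for k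
      using alt_dot_swap[OF i'(1)] by simp
    show "- l (e' (Suc i)) \<le> - l (e' i)"
      using l i' unfolding e'_def dominant_def by simp
  qed (auto simp: e'_def enum_eq_iff intro!: sum.cong)
  also have "\<dots> = (\<Sum>k | hstrip r k l. alt k t)"
  proof (rule sum.reindex_bij_witness[where i = "\<lambda>k j. - k j" and j = "\<lambda>k j. - k j"])
    have *: "(\<forall>i. Suc i < CARD('n) \<longrightarrow> k (e' (Suc i)) \<le> - l (e' i)) \<longleftrightarrow>
       (\<forall>i. Suc i < CARD('n) \<longrightarrow> l (enum (Suc i)) \<le> - k (enum i))" for k
    proof (intro iffI allI impI)
      fix i assume a: "\<forall>i. Suc i < CARD('n) \<longrightarrow> k (e' (Suc i)) \<le> - l (e' i)" and i: "Suc i < CARD('n)"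
      then have "CARD('n) - 1 - (CARD('n) - 2 - i) = Suc i" "CARD('n) - 1 - Suc (CARD('n) - 2 - i) = i" "Suc (CARD('n) - 2 - i) < CARD('n)" by auto
      with a[rule_format, of "CARD('n) - 2 - i"] show "l (enum (Suc i)) \<le> - k (enum i)" by (simp add: e'_def)
    next
      fix i assume a: "\<forall>i. Suc i < CARD('n) \<longrightarrow> l (enum (Suc i)) \<le> - k (enum i)" and i: "Suc i < CARD('n)"
      then have "CARD('n) - 1 - i = Suc (CARD('n) - 2 - i)" "CARD('n) - 1 - Suc i = CARD('n) - 2 - i" "Suc (CARD('n) - 2 - i) < CARD('n)" by auto
      with a[rule_format, of "CARD('n) - 2 - i"] show "k (e' (Suc i)) \<le> - l (e' i)" by (simp add: e'_def)
    qed
    fix k assume "k \<in> {k. (\<forall>j. - l j \<le> k j) \<and> (\<Sum>j\<in>UNIV. k j) = - (\<Sum>j\<in>UNIV. l j) + int r \<and>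
      (\<forall>i. Suc i < CARD('n) \<longrightarrow> k (e' (Suc i)) \<le> - l (e' i))}"
    then have k: "\<And>j. - l j \<le> k j" "(\<Sum>j\<in>UNIV. k j) = - (\<Sum>j\<in>UNIV. l j) + int r"
      "\<forall>i. Suc i < CARD('n) \<longrightarrow> l (enum (Suc i)) \<le> - k (enum i)" unfolding * by auto
    have "- k j \<le> l j" for j using k(1)[of j] by simp
    with k(2,3) show "(\<lambda>j. - k j) \<in> {k. hstrip r k l}" by (simp add: hstrip_def sum_negf)
  next
    have *: "(\<forall>i. Suc i < CARD('n) \<longrightarrow> - k (e' (Suc i)) \<le> - l (e' i))"
      if a: "\<forall>i. Suc i < CARD('n) \<longrightarrow> l (enum (Suc i)) \<le> k (enum i)" for k
    proof (intro allI impI)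
      fix i assume i: "Suc i < CARD('n)"
      then have "CARD('n) - 1 - i = Suc (CARD('n) - 2 - i)" "CARD('n) - 1 - Suc i = CARD('n) - 2 - i" "Suc (CARD('n) - 2 - i) < CARD('n)" by auto
      with a[rule_format, of "CARD('n) - 2 - i"] show "- k (e' (Suc i)) \<le> - l (e' i)" by (simp add: e'_def)
    qed
    fix k assume "k \<in> {k. hstrip r k l}"
    then show "(\<lambda>j. - k j) \<in> {k. (\<forall>j. - l j \<le> k j) \<and> (\<Sum>j\<in>UNIV. k j) = - (\<Sum>j\<in>UNIV. l j) + int r \<and>
      (\<forall>i. Suc i < CARD('n) \<longrightarrow> k (e' (Suc i)) \<le> - l (e' i))}"
      using *[of k] by (auto simp: hstrip_def sum_negf)
  qed auto
  finally show "alt l t * hsym r (\<lambda>i. inverse (t i)) = (\<Sum>k | hstrip r k l. alt k t)" .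
qed

lemma hstrip_dominant:
  "hstrip r l k \<Longrightarrow> dominant k" "hstrip r l k \<Longrightarrow> dominant l"
  unfolding hstrip_def dominant_def by (meson order_trans)+

section \<open>The Laplacian on class functions\<close>

definition eval_torus :: "'n::finite matpoly \<Rightarrow> ('n \<Rightarrow> complex) \<Rightarrow> complex" where
  "eval_torus e t = eval_mp e (diag_mat t) (diag_mat (\<lambda>i. inverse (t i)))"

lemma elementary_diag_mat:
  "elementary a a s ** diag_mat t = diag_mat (t(a := exp (of_real s) * t a))"
  by (auto simp: vec_eq_iff elementary_mult_entry algebra_simps)

lemma diag_mat_elementary:
  "diag_mat t ** elementary a a s = diag_mat (t(a := exp (of_real s) * t a))"
  by (auto simp: vec_eq_iff mult_elementary_entry algebra_simps)

lemma eval_torus_derivative: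
  "((\<lambda>s. eval_torus e (rescale a s t)) has_vector_derivative eval_torus (left_deriv a a e) t) (at 0)"
proof -
  have "diag_mat (\<lambda>i. inverse ((rescale a s t) i)) =
      diag_mat (\<lambda>i. inverse (t i)) ** elementary a a (- s)" for s
    unfolding diag_mat_elementary by (intro arg_cong[of _ _ diag_mat]) (auto simp: fun_eq_iff exp_minus)
  then show ?thesis
    using eval_mp_left_translation_elementary[of e a a "diag_mat t" "diag_mat (\<lambda>i. inverse (t i))"]
    by (simp add: eval_torus_def elementary_diag_mat)
qed

text \<open>Identities known at regular points only may therefore be differentiated there along
  \<open>rescale\<close>.\<close>

lemma regular_update:
  fixes t :: "'n::finite \<Rightarrow> complex"
  assumes "regular t"
  shows "\<forall>\<^sub>F s in at 0. regular (rescale a s t)"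
proof -
  have lim: "((\<lambda>s. exp (complex_of_real s) * t a) \<longlongrightarrow> exp (of_real 0) * t a) (at 0)"
    by (intro tendsto_intros)
  have "\<forall>\<^sub>F s in at 0. exp (complex_of_real s) * t a \<noteq> t b" if "b \<noteq> a" for b
  proof (rule tendsto_imp_eventually_ne[OF lim])
    show "exp (of_real 0) * t a \<noteq> t b" using assms that by (auto simp: regular_def inj_def)
  qed
  then have "\<forall>\<^sub>F s in at 0. \<forall>b\<in>UNIV - {a}. exp (complex_of_real s) * t a \<noteq> t b"
    by (intro eventually_ball_finite) auto
  then show ?thesis
  proof (rule eventually_mono)
    fix s assume "\<forall>b\<in>UNIV - {a}. exp (complex_of_real s) * t a \<noteq> t b"
    then have ne: "exp (complex_of_real s) * t a \<noteq> t b" if "b \<noteq> a" for b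
      using that by blast
    show "regular (rescale a s t)"
      using assms by (auto simp: regular_def inj_def ne ne[symmetric])
  qed
qed

text \<open>Off the diagonal, \<open>D\<^sub>a\<^sub>b D\<^sub>b\<^sub>a\<close> of a class function is a first-order operator on the torus:
  \<open>D\<^sub>b\<^sub>a\<close> may be replaced by the right translation, which at a torus point is
  \<open>t\<^sub>b / t\<^sub>a\<close> times the left translation, and the commutator is \<open>D\<^sub>b\<^sub>b - D\<^sub>a\<^sub>a\<close>.\<close>

lemma right_deriv_diag_mat:
  assumes t: "\<And>i. t i \<noteq> 0"
  shows "eval_mp (right_deriv b a e) (diag_mat t) (diag_mat (\<lambda>i. inverse (t i))) = t b / t a * eval_mp (left_deriv b a e) (diag_mat t) (diag_mat (\<lambda>i. inverse (t i)))"
proof (induction e)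
  case (Times p q)
  then show ?case by (simp add: algebra_simps)
qed (use t in \<open>auto simp: field_simps\<close>)

lemma off_diagonal:
  assumes e: "class_fn e" and t: "regular t" and ab: "a \<noteq> b"
  shows "eval_torus (left_deriv a b (left_deriv b a e)) t = t b / (t b - t a) * (eval_torus (left_deriv b b e) t - eval_torus (left_deriv a a e) t)"
proof -
  have t0: "t i \<noteq> 0" for i using t by (simp add: regular_def)
  have tab: "t b \<noteq> t a" using t ab by (auto simp: regular_def inj_def)
  have inv: "is_inv (diag_mat t) (diag_mat (\<lambda>i. inverse (t i)))" using t0 by (rule is_inv_diag_mat)
  have "eval_torus (left_deriv a b (left_deriv b a e)) t = eval_torus (left_deriv a b (right_deriv b a e)) t"
    unfolding eval_torus_def by (rule left_deriv_cong[OF class_fn_left_deriv_eq_right_deriv[OF e] inv])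
  also have "\<dots> = eval_torus (right_deriv b a (left_deriv a b e)) t" unfolding eval_torus_def by (rule left_deriv_right_deriv_commute)
  also have "\<dots> = t b / t a * eval_torus (left_deriv b a (left_deriv a b e)) t" unfolding eval_torus_def by (rule right_deriv_diag_mat[OF t0])
  finally have 1: "eval_torus (left_deriv b a (left_deriv a b e)) t = t a / t b * eval_torus (left_deriv a b (left_deriv b a e)) t"
    using t0 by (simp add: field_simps)
  have "eval_torus (left_deriv a b (left_deriv b a e)) t - eval_torus (left_deriv b a (left_deriv a b e)) t = eval_torus (left_deriv b b e) t - eval_torus (left_deriv a a e) t"
    unfolding eval_torus_def by (rule left_deriv_commutator)
  then show ?thesis unfolding 1 using t0[of b] tab by (simp add: field_simps)
qed

lemma sum_swap_off_diagonal:
  "(\<Sum>a\<in>UNIV. \<Sum>b\<in>UNIV - {a}. f a b) = (\<Sum>b\<in>UNIV. \<Sum>a\<in>UNIV - {b}. f (a :: 'a::finite) b :: complex)"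
proof -
  have *: "(\<Sum>b\<in>UNIV - {a}. g b) = (\<Sum>b\<in>UNIV. if a \<noteq> b then g b else 0)" for a :: 'a and g :: "'a \<Rightarrow> complex"
    by (rule sum.mono_neutral_cong_left) auto
  have "(\<Sum>a\<in>UNIV. \<Sum>b\<in>UNIV - {a}. f a b) = (\<Sum>b\<in>UNIV. \<Sum>a\<in>UNIV. if a \<noteq> b then f a b else 0)"
    unfolding * by (rule sum.swap)
  also have "\<dots> = (\<Sum>b\<in>UNIV. \<Sum>a\<in>UNIV - {b}. f a b)"
    unfolding * by (intro sum.cong refl) auto
  finally show ?thesis .
qed

text \<open>With \<theta> for the first derivatives, the term of (a, b) is \<open>t\<^sub>b /
  (t\<^sub>b - t\<^sub>a) (\<theta>\<^sub>b - \<theta>\<^sub>a)\<close>. Writing the coefficient of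
  \<open>\<theta>\<^sub>a\<close> as \<open>t\<^sub>a / (t\<^sub>a - t\<^sub>b) - 1\<close> makes
  both halves contribute the same sum, hence the factor 2; for each a the terms -1 add up to - (N -
  1).\<close>

lemma laplacian_torus:
  fixes t :: "'n::finite \<Rightarrow> complex"
  assumes e: "class_fn e" and t: "regular t"
  shows "(\<Sum>a\<in>UNIV. \<Sum>b\<in>UNIV. eval_torus (left_deriv a b (left_deriv b a e)) t) =
    (\<Sum>a\<in>UNIV. eval_torus (left_deriv a a (left_deriv a a e)) t)
    + 2 * (\<Sum>a\<in>UNIV. (\<Sum>b\<in>UNIV - {a}. t a / (t a - t b)) * eval_torus (left_deriv a a e) t)
    - (of_nat CARD('n) - 1) * (\<Sum>a\<in>UNIV. eval_torus (left_deriv a a e) t)"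
proof -
  define \<theta> where "\<theta> a = eval_torus (left_deriv a a e) t" for a
  define c where "c a = (\<Sum>b\<in>UNIV - {a}. t a / (t a - t b))" for a
  have tab: "t b \<noteq> t a" if "a \<noteq> b" for a b using t that by (auto simp: regular_def inj_def)
  have offd: "eval_torus (left_deriv a b (left_deriv b a e)) t = t b / (t b - t a) * \<theta> b + (t a / (t a - t b) - 1) * \<theta> a" if "a \<noteq> b" for a b
  proof -
    have "t a / (t a - t b) - 1 = - (t b / (t b - t a))"
      using tab[OF that] by (simp add: field_simps)
    then show ?thesis unfolding off_diagonal[OF e t that] \<theta>_def[symmetric] by (simp add: right_diff_distrib)
  qed
  have "(\<Sum>a\<in>UNIV. \<Sum>b\<in>UNIV. eval_torus (left_deriv a b (left_deriv b a e)) t) =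
      (\<Sum>a\<in>UNIV. eval_torus (left_deriv a a (left_deriv a a e)) t + (\<Sum>b\<in>UNIV - {a}. eval_torus (left_deriv a b (left_deriv b a e)) t))"
    by (intro sum.cong refl sum.remove) auto
  also have "\<dots> = (\<Sum>a\<in>UNIV. eval_torus (left_deriv a a (left_deriv a a e)) t) + (\<Sum>a\<in>UNIV. \<Sum>b\<in>UNIV - {a}. eval_torus (left_deriv a b (left_deriv b a e)) t)"
    by (rule sum.distrib)
  also have "(\<Sum>a\<in>UNIV. \<Sum>b\<in>UNIV - {a}. eval_torus (left_deriv a b (left_deriv b a e)) t) =
      (\<Sum>a\<in>UNIV. \<Sum>b\<in>UNIV - {a}. t b / (t b - t a) * \<theta> b) + (\<Sum>a\<in>UNIV. \<Sum>b\<in>UNIV - {a}. (t a / (t a - t b) - 1) * \<theta> a)"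
    by (subst sum.distrib[symmetric], intro sum.cong refl, subst sum.distrib[symmetric], intro sum.cong refl) (auto simp: offd)
  also have "(\<Sum>a\<in>UNIV. \<Sum>b\<in>UNIV - {a}. t b / (t b - t a) * \<theta> b) = (\<Sum>b\<in>UNIV. \<Sum>a\<in>UNIV - {b}. t b / (t b - t a) * \<theta> b)"
    by (rule sum_swap_off_diagonal)
  also have "\<dots> = (\<Sum>b\<in>UNIV. c b * \<theta> b)"
    by (simp add: c_def sum_distrib_right)
  also have "(\<Sum>a\<in>UNIV. \<Sum>b\<in>UNIV - {a}. (t a / (t a - t b) - 1) * \<theta> a) =
     (\<Sum>a\<in>UNIV. c a * \<theta> a - (of_nat CARD('n) - 1) * \<theta> a)"
  proof (intro sum.cong refl)
    fix a
    have "(\<Sum>b\<in>UNIV - {a}. t a / (t a - t b) - 1) = c a - (of_nat CARD('n) - 1)"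
      by (simp add: c_def sum_subtractf card_Diff_singleton of_nat_diff)
    then show "(\<Sum>b\<in>UNIV - {a}. (t a / (t a - t b) - 1) * \<theta> a) = c a * \<theta> a - (of_nat CARD('n) - 1) * \<theta> a"
      by (simp only: sum_distrib_right[symmetric] left_diff_distrib[symmetric])
  qed
  also have "\<dots> = (\<Sum>a\<in>UNIV. c a * \<theta> a) - (of_nat CARD('n) - 1) * (\<Sum>a\<in>UNIV. \<theta> a)"
    by (simp add: sum_subtractf sum_distrib_left)
  finally show ?thesis unfolding \<theta>_def c_def by simp
qed

text \<open>Write \<theta> for \<open>t\<^sub>a \<partial>/\<partial>t\<^sub>a\<close> and A for
  \<open>alt (\<lambda>_. 0)\<close>. In \<open>\<theta>\<^sup>2 (A F) = (\<theta>\<^sup>2 A) F + 2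
  (\<theta> A) (\<theta> F) + A \<theta>\<^sup>2 F\<close> the middle term is, by
  \<open>rho_log_derivative\<close>, A times the first-order term with factor 2 in
  \<open>laplacian_torus\<close>. So A times the Laplacian of F is obtained from derivatives of A F
  and of A, and these act on alternants through the exponents.\<close>

lemma torus_expansion_laplacian:
  fixes e :: "'n::finite matpoly"
  assumes e: "class_fn e" and t: "regular t" and W: "finite W"
    and exp: "\<And>t. regular t \<Longrightarrow> alt (\<lambda>_. 0) t * eval_torus e t = (\<Sum>l\<in>W. c l * alt l t)"
  shows "alt (\<lambda>_. 0) t * (\<Sum>a\<in>UNIV. \<Sum>b\<in>UNIV. eval_torus (left_deriv a b (left_deriv b a e)) t) =
           (\<Sum>l\<in>W. c l * of_int (casimir l) * alt l t)"
proof -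
  \<comment> \<open>One product in an identity is differentiated along \<open>rescale\<close>; d
    collects terms whose derivative is supplied separately. Used with d = 0 for the first derivative
    and with A \<theta> F for the second.\<close>
  have step: "weighted_alt (\<lambda>b. of_int b * w b) a (\<lambda>_. 0) t * eval_torus p t + weighted_alt w a (\<lambda>_. 0) t * eval_torus (left_deriv a a p) t + d' = d''"
    if "\<And>t. regular t \<Longrightarrow> weighted_alt w a (\<lambda>_. 0) t * eval_torus p t + d t = g t" and t: "regular t"
      "((\<lambda>s. d (rescale a s t)) has_vector_derivative d') (at 0)"
      "((\<lambda>s. g (rescale a s t)) has_vector_derivative d'') (at 0)"
    for w a p d g d' d'' and t :: "'n \<Rightarrow> complex"
  proof -
    have t0: "t i \<noteq> 0" for i using t(1) by (simp add: regular_def)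
    have self: "rescale a 0 t = t" by simp
    have 1: "((\<lambda>s. weighted_alt w a (\<lambda>_. 0) (rescale a s t) * eval_torus p (rescale a s t)
         + d (rescale a s t)) has_vector_derivative
       weighted_alt (\<lambda>b. of_int b * w b) a (\<lambda>_. 0) t * eval_torus p t + weighted_alt w a (\<lambda>_. 0) t * eval_torus (left_deriv a a p) t + d') (at 0)"
      using has_vector_derivative_add[OF has_vector_derivative_mult[OF weighted_alt_derivative[of t w a "\<lambda>_. 0", OF t0] eval_torus_derivative[of p t a]] t(2)]
      unfolding self by (simp add: add.commute)
    have *: "\<forall>\<^sub>F s in nhds 0. weighted_alt w a (\<lambda>_. 0) (rescale a s t) * eval_torus p (rescale a s t)
         + d (rescale a s t) = g (rescale a s t)"
      unfolding eventually_nhds_conv_at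
    proof
      show "\<forall>\<^sub>F s in at 0. weighted_alt w a (\<lambda>_. 0) (rescale a s t) * eval_torus p (rescale a s t)
         + d (rescale a s t) = g (rescale a s t)"
        by (rule eventually_mono[OF regular_update[OF t(1)]]) (rule that(1))
      show "weighted_alt w a (\<lambda>_. 0) (rescale a 0 t) * eval_torus p (rescale a 0 t)
         + d (rescale a 0 t) = g (rescale a 0 t)"
        unfolding self by (rule that(1)[OF t(1)])
    qed
    then have "((\<lambda>s. g (rescale a s t)) has_vector_derivative
       weighted_alt (\<lambda>b. of_int b * w b) a (\<lambda>_. 0) t * eval_torus p t + weighted_alt w a (\<lambda>_. 0) t * eval_torus (left_deriv a a p) t + d') (at 0)"
      using eventually_nhds_x_imp_x[OF *] * by (intro has_vector_derivative_cong_ev[THEN iffD1, OF _ _ 1]) simp_all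
    then show ?thesis using t(3) by (rule vector_derivative_unique_at)
  qed
  have t0: "t i \<noteq> 0" if "regular t" for t :: "'n \<Rightarrow> complex" and i using that by (simp add: regular_def)
  have der: "((\<lambda>s. \<Sum>l\<in>W. c l * weighted_alt w a l (rescale a s t)) has_vector_derivative
      (\<Sum>l\<in>W. c l * weighted_alt (\<lambda>b. of_int b * w b) a l t)) (at 0)" if "regular t" for w a and t :: "'n \<Rightarrow> complex"
    by (intro has_vector_derivative_sum has_vector_derivative_mult_right weighted_alt_derivative t0 that)
  have first: "weighted_alt of_int a (\<lambda>_. 0) t * eval_torus e t + alt (\<lambda>_. 0) t * eval_torus (left_deriv a a e) t = (\<Sum>l\<in>W. c l * weighted_alt of_int a l t)"
    if t: "regular t" for a and t :: "'n \<Rightarrow> complex"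
    using step[of "\<lambda>_. 1" a e "\<lambda>_. 0" "\<lambda>t. \<Sum>l\<in>W. c l * weighted_alt (\<lambda>_. 1) a l t" t 0, OF _ t _ der[OF t]]
    by (simp add: weighted_alt_1 exp)
  have second: "weighted_alt (\<lambda>b. of_int (b\<^sup>2)) a (\<lambda>_. 0) t * eval_torus e t + 2 * weighted_alt of_int a (\<lambda>_. 0) t * eval_torus (left_deriv a a e) t
      + alt (\<lambda>_. 0) t * eval_torus (left_deriv a a (left_deriv a a e)) t = (\<Sum>l\<in>W. c l * weighted_alt (\<lambda>b. of_int (b\<^sup>2)) a l t)" for a
  proof -
    have d: "((\<lambda>s. alt (\<lambda>_. 0) (rescale a s t) * eval_torus (left_deriv a a e) (rescale a s t))
       has_vector_derivative weighted_alt of_int a (\<lambda>_. 0) t * eval_torus (left_deriv a a e) t + alt (\<lambda>_. 0) t * eval_torus (left_deriv a a (left_deriv a a e)) t) (at 0)"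
      using has_vector_derivative_mult[OF weighted_alt_derivative[of t "\<lambda>_. 1" a "\<lambda>_. 0", OF t0[OF t]] eval_torus_derivative[of "left_deriv a a e" t a]]
      by (simp add: weighted_alt_1 add.commute)
    show ?thesis
      using step[of of_int a e "\<lambda>t. alt (\<lambda>_. 0) t * eval_torus (left_deriv a a e) t" "\<lambda>t. \<Sum>l\<in>W. c l * weighted_alt of_int a l t" t, OF first t d der[OF t]]
      by (simp add: power2_eq_square algebra_simps)
  qed
  let ?F = "eval_torus e t" and ?\<theta> = "\<lambda>a. eval_torus (left_deriv a a e) t" and ?A = "alt (\<lambda>_. 0) t"
  define S1 where "S1 l = (\<Sum>j\<in>UNIV. of_int (l j + rho j) :: complex)" for l :: "'n \<Rightarrow> int"
  define S2 where "S2 l = (\<Sum>j\<in>UNIV. of_int ((l j + rho j)\<^sup>2) :: complex)" for l :: "'n \<Rightarrow> int"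
  have "(\<Sum>a\<in>UNIV. weighted_alt of_int a (\<lambda>_. 0) t * ?F + ?A * ?\<theta> a) = (\<Sum>l\<in>W. c l * (\<Sum>a\<in>UNIV. weighted_alt of_int a l t))"
    unfolding first[OF t] sum_distrib_left by (rule sum.swap)
  then have f: "?A * (\<Sum>a\<in>UNIV. ?\<theta> a) = (\<Sum>l\<in>W. c l * (S1 l * alt l t)) - S1 (\<lambda>_. 0) * ?A * ?F"
    unfolding sum.distrib sum_distrib_left[symmetric] sum_distrib_right[symmetric] sum_weighted_alt
    by (simp add: S1_def eq_diff_eq add.commute)
  have "(\<Sum>a\<in>UNIV. weighted_alt (\<lambda>b. of_int (b\<^sup>2)) a (\<lambda>_. 0) t * ?F + 2 * weighted_alt of_int a (\<lambda>_. 0) t * ?\<theta> a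
      + ?A * eval_torus (left_deriv a a (left_deriv a a e)) t) = (\<Sum>l\<in>W. c l * (\<Sum>a\<in>UNIV. weighted_alt (\<lambda>b. of_int (b\<^sup>2)) a l t))"
    unfolding second sum_distrib_left by (rule sum.swap)
  moreover have "(\<Sum>a\<in>UNIV. weighted_alt (\<lambda>b. of_int (b\<^sup>2)) a (\<lambda>_. 0) t * ?F + 2 * weighted_alt of_int a (\<lambda>_. 0) t * ?\<theta> a
      + ?A * eval_torus (left_deriv a a (left_deriv a a e)) t) =
     (\<Sum>a\<in>UNIV. weighted_alt (\<lambda>b. of_int (b\<^sup>2)) a (\<lambda>_. 0) t) * ?F
     + ?A * (2 * (\<Sum>a\<in>UNIV. (\<Sum>b\<in>UNIV - {a}. t a / (t a - t b)) * ?\<theta> a) + (\<Sum>a\<in>UNIV. eval_torus (left_deriv a a (left_deriv a a e)) t))"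
    unfolding rho_log_derivative[OF t]
    by (simp only: sum.distrib sum_distrib_left sum_distrib_right distrib_left mult_ac add_ac)
  ultimately have s: "?A * (2 * (\<Sum>a\<in>UNIV. (\<Sum>b\<in>UNIV - {a}. t a / (t a - t b)) * ?\<theta> a) + (\<Sum>a\<in>UNIV. eval_torus (left_deriv a a (left_deriv a a e)) t)) =
     (\<Sum>l\<in>W. c l * (S2 l * alt l t)) - S2 (\<lambda>_. 0) * ?A * ?F"
    unfolding sum_weighted_alt S2_def by simp
  have cas: "of_int (casimir l) = S2 l - S2 (\<lambda>_. 0) - (of_nat CARD('n) - 1) * (S1 l - S1 (\<lambda>_. 0))" for l :: "'n \<Rightarrow> int"
    unfolding casimir_def S1_def S2_def by simp
  have "?A * (\<Sum>a\<in>UNIV. \<Sum>b\<in>UNIV. eval_torus (left_deriv a b (left_deriv b a e)) t) =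
     ?A * (2 * (\<Sum>a\<in>UNIV. (\<Sum>b\<in>UNIV - {a}. t a / (t a - t b)) * ?\<theta> a) + (\<Sum>a\<in>UNIV. eval_torus (left_deriv a a (left_deriv a a e)) t))
     - (of_nat CARD('n) - 1) * (?A * (\<Sum>a\<in>UNIV. ?\<theta> a))"
    unfolding laplacian_torus[OF e t] by (simp add: algebra_simps)
  also have "\<dots> = (\<Sum>l\<in>W. c l * (S2 l * alt l t)) - S2 (\<lambda>_. 0) * (?A * ?F)
     - (of_nat CARD('n) - 1) * ((\<Sum>l\<in>W. c l * (S1 l * alt l t)) - S1 (\<lambda>_. 0) * (?A * ?F))"
    unfolding s f by (simp add: mult.assoc)
  also have "\<dots> = (\<Sum>l\<in>W. c l * of_int (casimir l) * alt l t)"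
    unfolding exp[OF t] cas
    by (simp add: sum_distrib_left sum_subtractf[symmetric] algebra_simps sum.distrib[symmetric])
  finally show ?thesis .
qed

text \<open>Regular points are dense: adding s times the distinct ranks to the coordinates makes
  them distinct and keeps them nonzero for small s \<noteq> 0. The rest is continuity.\<close>

lemma eval_torus_regular_imp_all:
  fixes e :: "'n::finite matpoly"
  assumes reg: "\<And>t. regular t \<Longrightarrow> eval_torus e t = c" and t: "\<And>i. t i \<noteq> 0"
  shows "eval_torus e t = c"
proof -
  define u where "u s i = t i + of_real s * of_nat (rank i)" for s :: real and i :: 'n
  have cont: "((\<lambda>s. eval_mp e (diag_mat (u s)) (diag_mat (\<lambda>i. inverse (u s i)))) \<longlongrightarrow>
      eval_mp e (diag_mat (u 0)) (diag_mat (\<lambda>i. inverse (u 0 i)))) (at 0)"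
    by (induction e) (auto simp: u_def t intro!: tendsto_eq_intros)
  have "\<forall>\<^sub>F s in at 0. u s i \<noteq> 0" for i
  proof (rule tendsto_imp_eventually_ne)
    show "((\<lambda>s. u s i) \<longlongrightarrow> t i) (at 0)" by (auto simp: u_def intro!: tendsto_eq_intros)
  qed (rule t)
  then have 1: "\<forall>\<^sub>F s in at 0. \<forall>i\<in>UNIV. u s i \<noteq> 0" by (intro eventually_ball_finite) auto
  have "\<forall>\<^sub>F s in at 0. u s i \<noteq> u s j" if "i \<noteq> j" for i j
  proof (cases "t i = t j")
    case True
    have "rank i \<noteq> rank j" using inj_rank that by (auto simp: inj_def)
    have "\<forall>\<^sub>F s in at (0::real). s \<noteq> 0" by (rule eventually_neq_at_within)
    then show ?thesis
      by (rule eventually_mono) (use True \<open>rank i \<noteq> rank j\<close> in \<open>auto simp: u_def\<close>)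
  next
    case False
    have "((\<lambda>s. u s i - u s j) \<longlongrightarrow> t i - t j) (at 0)" by (auto simp: u_def intro!: tendsto_eq_intros)
    from tendsto_imp_eventually_ne[OF this, of 0] False show ?thesis by simp
  qed
  then have "\<forall>\<^sub>F s in at 0. \<forall>p\<in>{p. fst p \<noteq> snd p}. u s (fst p) \<noteq> u s (snd p)"
    by (intro eventually_ball_finite) auto
  with 1 have "\<forall>\<^sub>F s in at 0. regular (u s)"
    by eventually_elim (force simp: regular_def inj_def)
  then have "\<forall>\<^sub>F s in at 0. eval_mp e (diag_mat (u s)) (diag_mat (\<lambda>i. inverse (u s i))) = c"
    by (rule eventually_mono) (use reg in \<open>simp add: eval_torus_def\<close>)
  then have "((\<lambda>s. eval_mp e (diag_mat (u s)) (diag_mat (\<lambda>i. inverse (u s i)))) \<longlongrightarrow> c) (at 0)"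
    by (rule tendsto_eventually)
  moreover have "u 0 = t" by (simp add: u_def fun_eq_iff)
  ultimately show ?thesis using tendsto_unique[OF _ cont] by (simp add: eval_torus_def)
qed

text \<open>Induction on the set of nonzero weights. With none left, division by the nonvanishing
  \<open>alt (\<lambda>_. 0)\<close> shows that e is constant at regular points, then on the whole
  torus and, by diagonalization, on U(N).\<close>

lemma class_fn_integral:
  fixes e :: "'n::finite matpoly" and M :: "(complex^'n^'n) measure"
  assumes haar: "haar_unitary M"
    and "finite W" "(\<lambda>_. 0) \<notin> W" "\<And>l. l \<in> W \<Longrightarrow> dominant l" "class_fn e"
    and "\<And>t. regular t \<Longrightarrow> alt (\<lambda>_. 0) t * eval_torus e t = c (\<lambda>_. 0) * alt (\<lambda>_. 0) t + (\<Sum>l\<in>W. c l * alt l t)"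
  shows "(\<integral>U. eval_unitary e U \<partial>M) = c (\<lambda>_. 0)"
  using assms(2-)
proof (induction W arbitrary: e c rule: finite_induct)
  case empty
  interpret prob_space M using haar by (simp add: haar_unitary_def)
  have "eval_torus e t = c (\<lambda>_. 0)" if "regular t" for t
    using empty(4)[OF that] alt_rho_nonzero[OF that] by (simp add: mult.commute)
  then have const: "eval_torus e t = c (\<lambda>_. 0)" if "\<And>i. t i \<noteq> 0" for t
    using eval_torus_regular_imp_all that by blast
  have "eval_unitary e U = c (\<lambda>_. 0)" if U: "U \<in> unitary_group" for U
  proof -
    obtain g h t where ght: "is_inv g h" "\<And>i. t i \<noteq> 0" "U = g ** diag_mat t ** h"
      "adjoint_mat U = g ** diag_mat (\<lambda>i. inverse (t i)) ** h" using unitary_diagonalizable[OF U] by metis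
    then have "eval_unitary e U = eval_torus e t"
      using empty(3) is_inv_diag_mat[of t] by (simp add: eval_unitary_def eval_torus_def class_fn_def)
    then show ?thesis using const ght(2) by simp
  qed
  then have "(\<integral>U. eval_unitary e U \<partial>M) = (\<integral>U. c (\<lambda>_. 0) \<partial>M)"
    by (intro Bochner_Integration.integral_cong) (simp_all add: space_haar[OF haar])
  then show ?case by (simp add: prob_space)
next
  case (insert l0 W)
  define E where "E = complex_of_int (casimir l0)"
  have "E \<noteq> 0" using casimir_pos[of l0] insert.prems(1,2) by (auto simp: E_def)
  obtain L where L: "\<And>A B. eval_mp L A B = (\<Sum>a\<in>UNIV. \<Sum>b\<in>UNIV. eval_mp (left_deriv a b (left_deriv b a e)) A B)"
    using laplacian_exists by blast
  have cL: "class_fn L" by (rule class_fn_laplacian[OF insert.prems(3) L])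
  have tL: "eval_torus L t = (\<Sum>a\<in>UNIV. \<Sum>b\<in>UNIV. eval_torus (left_deriv a b (left_deriv b a e)) t)" for t by (simp add: eval_torus_def L)
  have uL: "eval_unitary L U = (\<Sum>a\<in>UNIV. \<Sum>b\<in>UNIV. eval_unitary (left_deriv a b (left_deriv b a e)) U)" for U by (simp add: eval_unitary_def L)
  define e' where "e' = Plus e (Times (Const (- 1 / E)) L)"
  \<comment> \<open>The factor removes \<open>l0\<close> and, because \<open>casimir\<close>
    vanishes at 0, fixes the wanted coefficient; the others may change, so c is arbitrary in the
    induction.\<close>
  define c' where "c' l = c l * (1 - of_int (casimir l) / E)" for l
  have "(\<integral>U. eval_unitary e' U \<partial>M) = c' (\<lambda>_. 0)"
  proof (rule insert.IH)
    show "(\<lambda>_. 0) \<notin> W" "\<And>l. l \<in> W \<Longrightarrow> dominant l" using insert.prems by auto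
    show "class_fn e'" using insert.prems(3) cL by (simp add: class_fn_def e'_def)
    fix t :: "'n \<Rightarrow> complex" assume t: "regular t"
    have ex: "alt (\<lambda>_. 0) t * eval_torus e t = (\<Sum>l\<in>insert (\<lambda>_. 0) (insert l0 W). c l * alt l t)" if "regular t" for t
      using insert.prems(4)[OF that] insert.hyps insert.prems(1) by simp
    have "alt (\<lambda>_. 0) t * eval_torus L t = (\<Sum>l\<in>insert (\<lambda>_. 0) (insert l0 W). c l * of_int (casimir l) * alt l t)"
      unfolding tL using insert.hyps by (intro torus_expansion_laplacian[OF insert.prems(3) t _ ex]) simp_all
    then have "alt (\<lambda>_. 0) t * eval_torus e' t = (\<Sum>l\<in>insert (\<lambda>_. 0) (insert l0 W). c l * alt l t) -
        (\<Sum>l\<in>insert (\<lambda>_. 0) (insert l0 W). c l * of_int (casimir l) * alt l t) / E"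
      using ex[OF t] by (simp add: e'_def eval_torus_def algebra_simps)
    also have "\<dots> = (\<Sum>l\<in>insert (\<lambda>_. 0) (insert l0 W). c' l * alt l t)"
      unfolding sum_divide_distrib sum_subtractf[symmetric] by (intro sum.cong refl) (simp add: c'_def algebra_simps)
    also have "\<dots> = c' (\<lambda>_. 0) * alt (\<lambda>_. 0) t + (\<Sum>l\<in>W. c' l * alt l t)"
      using insert.hyps insert.prems(1) \<open>E \<noteq> 0\<close> by (simp add: c'_def E_def)
    finally show "alt (\<lambda>_. 0) t * eval_torus e' t = c' (\<lambda>_. 0) * alt (\<lambda>_. 0) t + (\<Sum>l\<in>W. c' l * alt l t)" .
  qed
  also have "c' (\<lambda>_. 0) = c (\<lambda>_. 0)" by (simp add: c'_def casimir_0)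
  also have "(\<integral>U. eval_unitary e' U \<partial>M) = (\<integral>U. eval_unitary e U + (- 1 / E) * eval_unitary L U \<partial>M)"
    by (simp add: e'_def eval_unitary_def)
  also have "\<dots> = (\<integral>U. eval_unitary e U \<partial>M) + (- 1 / E) * (\<integral>U. eval_unitary L U \<partial>M)"
    using eval_unitary_integrable[OF haar] by (subst Bochner_Integration.integral_add) simp_all
  also have "(\<integral>U. eval_unitary L U \<partial>M) = 0"
    unfolding uL using eval_unitary_integrable[OF haar] by (simp add: integral_left_deriv[OF haar])
  finally show ?case by simp
qed

section \<open>Secular coefficients and symmetric powers\<close>

definition polyfun :: "(complex^'n^'n \<Rightarrow> complex^'n^'n \<Rightarrow> complex) \<Rightarrow> bool" where
  "polyfun F \<longleftrightarrow> (\<exists>e. \<forall>A B. eval_mp e A B = F A B)"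

lemma polyfun_const: "polyfun (\<lambda>A B. c)"
  unfolding polyfun_def by (intro exI[of _ "Const c"]) simp

lemma polyfun_entry: "polyfun (\<lambda>A B. A $ i $ j)"
  unfolding polyfun_def by (intro exI[of _ "Entry i j"]) simp

lemma polyfun_add: "polyfun F \<Longrightarrow> polyfun G \<Longrightarrow> polyfun (\<lambda>A B. F A B + G A B)"
proof -
  assume "polyfun F" "polyfun G"
  then obtain p q where "\<And>A B. eval_mp p A B = F A B" "\<And>A B. eval_mp q A B = G A B"
    unfolding polyfun_def by auto
  then show ?thesis unfolding polyfun_def by (intro exI[of _ "Plus p q"]) simp
qed

lemma polyfun_mult: "polyfun F \<Longrightarrow> polyfun G \<Longrightarrow> polyfun (\<lambda>A B. F A B * G A B)"
proof -
  assume "polyfun F" "polyfun G"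
  then obtain p q where "\<And>A B. eval_mp p A B = F A B" "\<And>A B. eval_mp q A B = G A B"
    unfolding polyfun_def by auto
  then show ?thesis unfolding polyfun_def by (intro exI[of _ "Times p q"]) simp
qed

lemma polyfun_sum: "(\<And>x. x \<in> S \<Longrightarrow> polyfun (F x)) \<Longrightarrow> polyfun (\<lambda>A B. \<Sum>x\<in>S. F x A B)"
  by (induction S rule: infinite_finite_induct) (auto intro: polyfun_const polyfun_add)

lemma polyfun_prod: "(\<And>x. x \<in> S \<Longrightarrow> polyfun (F x)) \<Longrightarrow> polyfun (\<lambda>A B. \<Prod>x\<in>S. F x A B)"
  by (induction S rule: infinite_finite_induct) (auto intro: polyfun_const polyfun_mult)

lemma polyfun_power: "polyfun F \<Longrightarrow> polyfun (\<lambda>A B. F A B ^ n)"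
  by (induction n) (auto intro: polyfun_const polyfun_mult)

text \<open>Exchange \<open>Entry\<close> and \<open>Inv\<close>. This is how the conjugated factors
  of the integrand become expressions: they are evaluated at the adjoint.\<close>

lemma polyfun_swap: "polyfun F \<Longrightarrow> polyfun (\<lambda>A B. F B A)"
proof -
  have "\<exists>e'. \<forall>A B. eval_mp e' A B = eval_mp e B A" for e :: "'a matpoly"
  proof (induction e)
    case (Const c) show ?case by (intro exI[of _ "Const c"]) simp
  next
    case (Entry i j) show ?case by (intro exI[of _ "Inv i j"]) simp
  next
    case (Inv i j) show ?case by (intro exI[of _ "Entry i j"]) simp
  next
    case (Plus p q)
    then obtain p' q' where "\<And>A B. eval_mp p' A B = eval_mp p B A" "\<And>A B. eval_mp q' A B = eval_mp q B A" by auto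
    then show ?case by (intro exI[of _ "Plus p' q'"]) simp
  next
    case (Times p q)
    then obtain p' q' where "\<And>A B. eval_mp p' A B = eval_mp p B A" "\<And>A B. eval_mp q' A B = eval_mp q B A" by auto
    then show ?case by (intro exI[of _ "Times p' q'"]) simp
  qed
  note swap = this
  assume "polyfun F"
  then obtain e where "\<And>A B. eval_mp e A B = F A B" unfolding polyfun_def by auto
  moreover obtain e' where "\<And>A B. eval_mp e' A B = eval_mp e B A" using swap[of e] by auto
  ultimately show "polyfun (\<lambda>A B. F B A)" unfolding polyfun_def by (intro exI[of _ e']) simp
qed

definition coeffs_polyfun :: "(complex^'n^'n \<Rightarrow> complex poly) \<Rightarrow> bool" where
  "coeffs_polyfun P \<longleftrightarrow> (\<forall>k. polyfun (\<lambda>A B. coeff (P A) k))"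

lemma coeffs_polyfun_mult: "coeffs_polyfun P \<Longrightarrow> coeffs_polyfun Q \<Longrightarrow> coeffs_polyfun (\<lambda>A. P A * Q A)"
  unfolding coeffs_polyfun_def coeff_mult by (intro allI polyfun_sum polyfun_mult) auto

lemma coeffs_polyfun_sum: "(\<And>x. x \<in> S \<Longrightarrow> coeffs_polyfun (P x)) \<Longrightarrow> coeffs_polyfun (\<lambda>A. \<Sum>x\<in>S. P x A)"
  unfolding coeffs_polyfun_def coeff_sum by (auto intro: polyfun_sum)

lemma coeffs_polyfun_const: "coeffs_polyfun (\<lambda>A. p)"
  unfolding coeffs_polyfun_def by (auto intro: polyfun_const)

lemma coeffs_polyfun_prod: "(\<And>x. x \<in> S \<Longrightarrow> coeffs_polyfun (P x)) \<Longrightarrow> coeffs_polyfun (\<lambda>A. \<Prod>x\<in>S. P x A)"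
  by (induction S rule: infinite_finite_induct) (auto intro: coeffs_polyfun_const coeffs_polyfun_mult)

section \<open>The polynomial det (z I + A) and its roots\<close>

definition plus_det :: "complex^'n^'n \<Rightarrow> complex poly" where
  "plus_det A = det (mat [:0, 1:] + map_matrix (\<lambda>c. [:c:]) A)"

lemma plus_det_entry:
  "(mat [:0, 1:] + map_matrix (\<lambda>c. [:c:]) A) $ i $ j = (if i = j then [:A $ i $ j, 1:] else [:A $ i $ j:])"
  by (simp add: mat_def map_matrix_def)

lemma coeffs_polyfun_plus_det: "coeffs_polyfun plus_det"
proof -
  have "coeffs_polyfun (\<lambda>A. (mat [:0, 1:] + map_matrix (\<lambda>c. [:c:]) A) $ i $ j)" for i j :: 'a
    unfolding coeffs_polyfun_def
  proof
    fix k
    show "polyfun (\<lambda>A B. coeff ((mat [:0, 1:] + map_matrix (\<lambda>c. [:c:]) A) $ i $ j) k)"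
      unfolding plus_det_entry
      by (cases "i = j"; cases k) (auto simp: coeff_pCons intro: polyfun_const polyfun_entry)
  qed
  then show ?thesis
    unfolding plus_det_def[abs_def] det_def by (intro coeffs_polyfun_sum coeffs_polyfun_mult coeffs_polyfun_prod coeffs_polyfun_const)
qed

lemma secular_eq: "secular n (A :: complex^'n^'n) = (if n \<le> CARD('n) then coeff (plus_det A) (CARD('n) - n) else 0)"
  by (simp add: secular_def plus_det_def)

lemma polyfun_secular: "polyfun (\<lambda>A B. secular n A)"
  using coeffs_polyfun_plus_det unfolding secular_eq coeffs_polyfun_def
  by (cases "n \<le> CARD('a)") (auto intro: polyfun_const)

lemma map_matrix_const_mult:
  "map_matrix (\<lambda>c. [:c:]) (A ** B) = map_matrix (\<lambda>c. [:c:]) A ** (map_matrix (\<lambda>c. [:c:]) B :: complex poly^'n^'n)"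
proof -
  have "(\<Sum>k\<in>S. [:f k:]) = [:\<Sum>k\<in>S. f k:]" for f :: "'n \<Rightarrow> complex" and S
    by (induction S rule: infinite_finite_induct) auto
  then show ?thesis by (simp add: vec_eq_iff map_matrix_def matrix_matrix_mult_def mult.commute)
qed

lemma matrix_mult_add_right_distrib: "(A + B) ** C = A ** C + B ** (C :: 'a::comm_ring_1^'n^'n)"
  by (simp add: vec_eq_iff matrix_matrix_mult_def distrib_right sum.distrib)

text \<open>As constant matrices over the polynomial ring g and h are still mutually inverse, and z
  I commutes with everything.\<close>

lemma plus_det_conj:
  assumes "is_inv g h"
  shows "plus_det (g ** A ** h) = plus_det A"
proof -
  let ?c = "map_matrix (\<lambda>c. [:c:]) :: complex^'a^'a \<Rightarrow> complex poly^'a^'a"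
  have one: "?c (mat 1) = mat 1" by (auto simp: vec_eq_iff map_matrix_def mat_def one_pCons)
  have gh: "?c g ** ?c h = mat 1" using assms by (simp add: is_inv_def one flip: map_matrix_const_mult)
  have z: "X ** mat [:0, 1:] = mat [:0, 1:] ** X" for X :: "complex poly^'a^'a"
  proof -
    have "(X ** mat [:0, 1:]) $ i $ j = (\<Sum>k\<in>UNIV. if k = j then X $ i $ j * [:0, 1:] else 0)" for i j
      unfolding matrix_matrix_mult_def vec_lambda_beta by (intro sum.cong refl) (auto simp: mat_def)
    moreover have "(mat [:0, 1:] ** X) $ i $ j = (\<Sum>k\<in>UNIV. if k = i then X $ i $ j * [:0, 1:] else 0)" for i j
      unfolding matrix_matrix_mult_def vec_lambda_beta by (intro sum.cong refl) (auto simp: mat_def)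
    ultimately show ?thesis unfolding vec_eq_iff by simp
  qed
  have "?c g ** (mat [:0, 1:] + ?c A) ** ?c h = mat [:0, 1:] ** (?c g ** ?c h) + ?c g ** ?c A ** ?c h"
    by (simp add: matrix_add_ldistrib matrix_mult_add_right_distrib matrix_mul_assoc z)
  then have "mat [:0, 1:] + ?c (g ** A ** h) = ?c g ** (mat [:0, 1:] + ?c A) ** ?c h"
    by (simp add: gh map_matrix_const_mult)
  then have "plus_det (g ** A ** h) = det (?c g) * plus_det A * det (?c h)"
    by (simp add: plus_det_def det_mul)
  also have "\<dots> = det (?c g ** ?c h) * plus_det A" by (simp add: det_mul mult_ac)
  finally show ?thesis by (simp add: gh)
qed

lemma poly_plus_det: "poly (plus_det A) z = det (\<chi> i j. (if i = j then z else 0) + A $ i $ j)"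
  unfolding plus_det_def poly_det plus_det_entry by (intro arg_cong[of _ _ det]) (auto simp: vec_eq_iff)

lemma poly_char_polynomial: "poly (char_polynomial A) z = det (\<chi> i j. (if i = j then z else 0) - A $ i $ j)"
  unfolding char_polynomial_def poly_det
  by (intro arg_cong[of _ _ det]) (auto simp: vec_eq_iff mat_def map_matrix_def)

lemma coeff_mult_top:
  assumes "degree p \<le> m" "degree q \<le> n"
  shows "coeff (p * q :: complex poly) (m + n) = coeff p m * coeff q n"
proof -
  have "coeff p i * coeff q (m + n - i) = (if i = m then coeff p m * coeff q n else 0)" if "i \<le> m + n" for i
  proof (cases i m rule: linorder_cases)
    case less
    then have "degree q < m + n - i" using assms(2) by linarith
    then show ?thesis using less by (simp add: coeff_eq_0)
  next
    case greater
    then have "degree p < i" using assms(1) by linarith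
    then show ?thesis using greater by (simp add: coeff_eq_0)
  qed simp
  then show ?thesis by (simp add: coeff_mult)
qed

lemma prod_linear_top_coeff:
  fixes P :: "'b \<Rightarrow> complex poly"
  assumes "finite S" "\<And>i. degree (P i) \<le> 1"
  shows "coeff (\<Prod>i\<in>S. P i) (card S) = (\<Prod>i\<in>S. coeff (P i) 1) \<and> degree (\<Prod>i\<in>S. P i) \<le> card S"
  using assms(1)
proof (induction S rule: finite_induct)
  case (insert x S)
  have "degree (P x * (\<Prod>i\<in>S. P i)) \<le> 1 + card S"
    using assms(2)[of x] insert.IH by (intro order_trans[OF degree_mult_le]) auto
  moreover have "coeff (P x * (\<Prod>i\<in>S. P i)) (1 + card S) = coeff (P x) 1 * coeff (\<Prod>i\<in>S. P i) (card S)"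
    using assms(2)[of x] insert.IH by (intro coeff_mult_top) auto
  ultimately show ?case using insert by simp
qed simp

lemma det_linear_top_coeff:
  fixes A :: "complex poly^'n^'n"
  assumes "\<And>i j. degree (A $ i $ j) \<le> 1"
  shows "coeff (det A) CARD('n) = det (\<chi> i j. coeff (A $ i $ j) 1)" "degree (det A) \<le> CARD('n)"
proof -
  have 1: "coeff (\<Prod>i\<in>UNIV. A $ i $ p i) CARD('n) = (\<Prod>i\<in>UNIV. coeff (A $ i $ p i) 1)"
     "degree (\<Prod>i\<in>UNIV. A $ i $ p i) \<le> CARD('n)" for p
    using prod_linear_top_coeff[of UNIV "\<lambda>i. A $ i $ p i"] assms by auto
  have c: "of_int k * p = smult (of_int k) p" for k and p :: "complex poly"
    by (simp add: of_int_poly)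
  show "coeff (det A) CARD('n) = det (\<chi> i j. coeff (A $ i $ j) 1)"
    unfolding det_def coeff_sum c coeff_smult 1 by simp
  show "degree (det A) \<le> CARD('n)"
    unfolding det_def c
    by (intro degree_sum_le finite_permutations finite order_trans[OF degree_smult_le]) (rule 1)
qed

lemma char_polynomial_monic:
  fixes A :: "complex^'n^'n"
  shows "degree (char_polynomial A) = CARD('n)" "lead_coeff (char_polynomial A) = 1"
proof -
  let ?Z = "mat [:0, 1:] - map_matrix (\<lambda>c. [:c:]) A :: complex poly^'n^'n"
  have Z: "?Z $ i $ j = (if i = j then [:- A $ i $ j, 1:] else [:- A $ i $ j:])" for i j
    by (simp add: mat_def map_matrix_def)
  have d: "degree (?Z $ i $ j) \<le> 1" for i j unfolding Z by auto
  have "(\<chi> i j. coeff (?Z $ i $ j) 1) = mat 1"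
    unfolding Z by (auto simp: vec_eq_iff mat_def)
  then have c: "coeff (char_polynomial A) CARD('n) = 1"
    using det_linear_top_coeff(1)[OF d] by (simp add: char_polynomial_def)
  moreover have "degree (char_polynomial A) \<le> CARD('n)"
    using det_linear_top_coeff(2)[OF d] by (simp add: char_polynomial_def)
  ultimately show "degree (char_polynomial A) = CARD('n)"
    by (metis le_antisym le_degree one_neq_zero)
  with c show "lead_coeff (char_polynomial A) = 1" by simp
qed

text \<open>Negating every row relates \<open>plus_det A\<close> at z to the characteristic
  polynomial at - z; the sign (-1)^N is absorbed by the N linear factors.\<close>

lemma plus_det_eigenvalues:
  fixes A :: "complex^'n^'n"
  shows "plus_det A = (\<Prod>x\<in>#eigenvalues A. [:x, 1:])" "size (eigenvalues A) = CARD('n)"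
proof -
  show sz: "size (eigenvalues A) = CARD('n)"
    by (simp add: eigenvalues_def size_proots_complex char_polynomial_monic)
  have c: "char_polynomial A = (\<Prod>x\<in>#eigenvalues A. [:- x, 1:])"
    using complex_poly_decompose_multiset[of "char_polynomial A"]
    by (simp add: eigenvalues_def char_polynomial_monic(2))
  have "poly (plus_det A) z = poly (\<Prod>x\<in>#eigenvalues A. [:x, 1:]) z" for z
  proof -
    have "(\<chi> i j. (if i = j then z else 0) + A $ i $ j) = (\<chi> i. (- 1) *s (\<chi> j. (if i = j then - z else 0) - A $ i $ j))"
      by (auto simp: vec_eq_iff)
    then have "poly (plus_det A) z = (- 1) ^ CARD('n) * poly (char_polynomial A) (- z)"
      unfolding poly_plus_det poly_char_polynomial by (simp only: det_rows_mul prod_constant)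
    also have "poly (\<Prod>x\<in>#E. [:x, 1:]) z = (- 1) ^ size E * poly (\<Prod>x\<in>#E. [:- x, 1:]) (- z)" for E :: "complex multiset"
      by (induction E) (auto simp: algebra_simps)
    from this[of "eigenvalues A"] have "(- 1) ^ CARD('n) * poly (char_polynomial A) (- z) = poly (\<Prod>x\<in>#eigenvalues A. [:x, 1:]) z"
      by (simp add: sz c)
    finally show ?thesis .
  qed
  then show "plus_det A = (\<Prod>x\<in>#eigenvalues A. [:x, 1:])"
    by (subst poly_eq_poly_eq_iff[symmetric]) auto
qed

lemma plus_det_adjoint: "plus_det (adjoint_mat A) = map_poly cnj (plus_det A)"
proof -
  have "poly (plus_det (adjoint_mat A)) z = poly (map_poly cnj (plus_det A)) z" for z
  proof -
    have "poly (plus_det (adjoint_mat A)) z = det (transpose (\<chi> i j. cnj ((if i = j then cnj z else 0) + A $ i $ j)))"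
      unfolding poly_plus_det by (intro arg_cong[of _ _ det]) (auto simp: vec_eq_iff transpose_def)
    also have "\<dots> = cnj (det (\<chi> i j. (if i = j then cnj z else 0) + A $ i $ j))"
      unfolding det_transpose by (simp add: det_def)
    also have "\<dots> = poly (map_poly cnj (plus_det A)) z"
      unfolding poly_plus_det[symmetric] poly_cnj by simp
    finally show ?thesis .
  qed
  then show ?thesis by (subst poly_eq_poly_eq_iff[symmetric]) auto
qed

lemma secular_adjoint: "secular n (adjoint_mat A) = cnj (secular n A)"
  by (simp add: secular_eq plus_det_adjoint coeff_map_poly)

lemma secular_conj: "is_inv g h \<Longrightarrow> secular n (g ** A ** h) = secular n A"
  by (simp add: secular_eq plus_det_conj)

lemma plus_det_diag: "plus_det (diag_mat t) = (\<Prod>i\<in>UNIV. [:t i, 1:])"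
proof -
  have "plus_det (diag_mat t) = (\<Prod>i\<in>UNIV. (mat [:0, 1:] + map_matrix (\<lambda>c. [:c:]) (diag_mat t)) $ i $ i)"
    unfolding plus_det_def by (rule det_diagonal) (simp add: mat_def map_matrix_def)
  then show ?thesis by (simp add: mat_def map_matrix_def)
qed

lemma secular_diag:
  fixes t :: "'n::finite \<Rightarrow> complex"
  shows "secular r (diag_mat t) = esym r t"
proof -
  have 1: "(\<Prod>i\<in>X. [:t i:]) = [:\<Prod>i\<in>X. t i:]" for X
    by (induction X rule: infinite_finite_induct) auto
  have "(\<Prod>i\<in>UNIV. [:t i, 1:]) = (\<Prod>i\<in>UNIV. [:t i:] + monom 1 1)"
    by (intro prod.cong) (auto simp: monom_altdef)
  also have "\<dots> = (\<Sum>X\<in>UNIV. [:\<Prod>i\<in>X. t i:] * monom 1 (card (UNIV - X)))"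
    by (subst prod_add) (simp_all add: 1 monom_power)
  also have "\<dots> = (\<Sum>X\<in>UNIV. monom (\<Prod>i\<in>X. t i) (CARD('n) - card X))"
    by (simp add: smult_monom card_Diff_subset)
  finally have q: "plus_det (diag_mat t) = (\<Sum>X\<in>UNIV. monom (\<Prod>i\<in>X. t i) (CARD('n) - card X))"
    by (simp add: plus_det_diag)
  have le: "card X \<le> CARD('n)" for X :: "'n set" by (rule card_mono) auto
  show ?thesis
  proof (cases "r \<le> CARD('n)")
    case True
    have "CARD('n) - card X = CARD('n) - r \<longleftrightarrow> card X = r" for X :: "'n set" using True le[of X] by linarith
    then show ?thesis using True by (simp add: secular_eq q coeff_sum esym_def sum.If_cases)
  next
    case False
    then have "{X :: 'n set. card X = r} = {}" using le by (metis (mono_tags, lifting) Collect_empty_eq)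
    then show ?thesis using False by (simp add: secular_eq esym_def)
  qed
qed

section \<open>Generating functions of secular coefficients and symmetric powers\<close>

definition mset_sum :: "nat \<Rightarrow> 'b set \<Rightarrow> ('b \<Rightarrow> complex) \<Rightarrow> complex" where
  "mset_sum n S v = (\<Sum>K\<in>multisets_of_size S n. \<Prod>p\<in>#K. v p)"

lemma finite_multisets_of_size:
  assumes "finite S" shows "finite (multisets_of_size S n)"
  using assms
proof (induction S arbitrary: n rule: finite_induct)
  case empty show ?case by (cases n) auto
qed (simp add: multisets_of_size_insert)

lemma mset_sum_insert:
  assumes "finite S" "a \<notin> S"
  shows "mset_sum n (insert a S) v = (\<Sum>m\<in>{0..n}. v a ^ m * mset_sum (n - m) S v)"
proof -
  have "mset_sum n (insert a S) v = (\<Sum>(m, K)\<in>(SIGMA m:{0..n}. multisets_of_size S (n - m)). (\<Prod>p\<in>#K + replicate_mset m a. v p))"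
    unfolding mset_sum_def
    using sum.reindex_bij_betw[OF bij_betw_multisets_of_size_insert[OF assms(2)], of "\<lambda>K. \<Prod>p\<in>#K. v p" n]
    by (simp add: split_def)
  also have "\<dots> = (\<Sum>m\<in>{0..n}. \<Sum>K\<in>multisets_of_size S (n - m). (\<Prod>p\<in>#K + replicate_mset m a. v p))"
    using assms by (subst sum.Sigma) (auto simp: finite_multisets_of_size)
  also have "\<dots> = (\<Sum>m\<in>{0..n}. v a ^ m * mset_sum (n - m) S v)"
    unfolding mset_sum_def sum_distrib_left by (intro sum.cong refl) (simp add: mult.commute)
  finally show ?thesis .
qed

text \<open>Splitting a multiset by its number of occurrences of a gives a geometric series in
  \<open>v a\<close>, which the factor belonging to a cancels.\<close>

lemma mset_sum_fps:
  assumes "finite S"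
  shows "(\<Prod>p\<in>S. 1 - fps_const (v p) * fps_X) * Abs_fps (\<lambda>n. mset_sum n S v) = 1"
  using assms
proof (induction S rule: finite_induct)
  case empty
  show ?case
    by (rule fps_ext) (auto simp: mset_sum_def)
next
  case (insert a S)
  have "(1 - fps_const (v a) * fps_X) * Abs_fps (\<lambda>n. mset_sum n (insert a S) v) = Abs_fps (\<lambda>n. mset_sum n S v)"
  proof (rule fps_ext)
    fix n
    show "fps_nth ((1 - fps_const (v a) * fps_X) * Abs_fps (\<lambda>n. mset_sum n (insert a S) v)) n =
        fps_nth (Abs_fps (\<lambda>n. mset_sum n S v)) n"
    proof (cases n)
      case (Suc m)
      have "mset_sum n (insert a S) v = mset_sum n S v + v a * mset_sum m (insert a S) v"
        unfolding mset_sum_insert[OF insert.hyps] Suc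
        by (subst sum.atLeast0_atMost_Suc_shift) (simp add: sum_distrib_left mult.assoc)
      then show ?thesis using Suc
        by (simp add: left_diff_distrib mult.assoc)
    qed (simp add: left_diff_distrib mult.assoc mset_sum_insert[OF insert.hyps])
  qed
  then have "(\<Prod>p\<in>S. 1 - fps_const (v p) * fps_X) *
      ((1 - fps_const (v a) * fps_X) * Abs_fps (\<lambda>n. mset_sum n (insert a S) v)) = 1"
    using insert.IH by simp
  then show ?case by (simp only: prod.insert[OF insert.hyps] mult_ac)
qed

text \<open>Read backwards, det (z I + A) is the generating function
  \<open>\<Prod> (1 + v\<^sub>p X)\<close> of the secular coefficients, and its inverse generates
  the complete homogeneous polynomials with alternating signs. The index set is arbitrary so that it
  can be the set of occurrences of eigenvalues or, for diagonal matrices, the index type.\<close>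

lemma secular_fps:
  fixes A :: "complex^'n^'n"
  assumes S: "finite S" "card S = CARD('n)" and A: "plus_det A = (\<Prod>p\<in>S. [:v p, 1:])"
  shows "Abs_fps (\<lambda>k. secular k A) * Abs_fps (\<lambda>n. (- 1) ^ n * mset_sum n S v) = 1"
proof -
  have deg: "degree (plus_det A) = CARD('n)"
    using S by (simp add: A degree_prod_eq_sum_degree)
  have r: "reflect_poly [:x, 1:] = [:1, x:]" for x :: complex
    by (rule poly_eqI) (auto simp: coeff_reflect_poly coeff_pCons split: nat.split)
  have lin: "fps_of_poly [:1, x:] = 1 + fps_const x * fps_X" for x :: complex
    by (rule fps_ext) (auto simp: coeff_pCons split: nat.split)
  have "Abs_fps (\<lambda>k. secular k A) = fps_of_poly (reflect_poly (plus_det A))"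
    by (rule fps_ext) (auto simp: secular_eq coeff_reflect_poly deg)
  also have "\<dots> = (\<Prod>p\<in>S. 1 - fps_const (- v p) * fps_X)"
    unfolding A by (simp add: reflect_poly_prod r fps_of_poly_prod lin flip: fps_const_neg)
  finally have "Abs_fps (\<lambda>k. secular k A) * Abs_fps (\<lambda>n. mset_sum n S (\<lambda>p. - v p)) = 1"
    using mset_sum_fps[OF S(1), of "\<lambda>p. - v p"] by simp
  moreover have "mset_sum n S (\<lambda>p. - v p) = (- 1) ^ n * mset_sum n S v" for n
  proof -
    have "(\<Prod>p\<in>#K. - v p) = (- 1) ^ size K * (\<Prod>p\<in>#K. v p)" for K by (induction K) auto
    then show ?thesis
      unfolding mset_sum_def sum_distrib_left by (intro sum.cong refl) (auto simp: multisets_of_size_def)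
  qed
  ultimately show ?thesis by simp
qed

lemma tr_sym_eq:
  "tr_sym n A = mset_sum n (Sigma (set_mset (eigenvalues A)) (\<lambda>x. {..<count (eigenvalues A) x})) fst"
proof -
  have "{(x, k). k < count (eigenvalues A) x} = Sigma (set_mset (eigenvalues A)) (\<lambda>x. {..<count (eigenvalues A) x})"
    by (auto simp flip: count_greater_zero_iff)
  then show ?thesis by (simp add: tr_sym_def complete_homogeneous_def mset_sum_def multisets_of_size_def)
qed

lemma secular_tr_sym_fps:
  "Abs_fps (\<lambda>k. secular k A) * Abs_fps (\<lambda>n. (- 1) ^ n * tr_sym n A) = 1"
proof -
  let ?E = "eigenvalues A"
  let ?S = "Sigma (set_mset ?E) (\<lambda>x. {..<count ?E x})"
  have "card ?S = size ?E" by (simp add: size_multiset_overloaded_eq)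
  moreover have "plus_det A = (\<Prod>p\<in>?S. [:fst p, 1:])"
  proof -
    have "(\<Prod>p\<in>?S. [:fst p, 1:]) = (\<Prod>x\<in>set_mset ?E. \<Prod>k\<in>{..<count ?E x}. [:x, 1:])"
      by (subst prod.Sigma) (auto simp: split_def)
    then show ?thesis by (simp add: plus_det_eigenvalues image_prod_mset_multiplicity)
  qed
  ultimately show ?thesis
    unfolding tr_sym_eq by (intro secular_fps) (simp_all add: plus_det_eigenvalues(2))
qed

text \<open>A power series has at most one inverse, so the secular coefficients determine all
  \<open>tr_sym\<close>. Conjugation invariance, adjoints and values on the torus are transferred in
  this way, without looking at eigenvalues again.\<close>

lemma tr_sym_unique:
  assumes "Abs_fps (\<lambda>k. secular k A) * Abs_fps (\<lambda>n. (- 1) ^ n * f n) = 1"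
  shows "tr_sym n A = f n"
proof -
  let ?S = "Abs_fps (\<lambda>k. secular k A)" and ?T = "Abs_fps (\<lambda>n. (- 1) ^ n * tr_sym n A)" and ?F = "Abs_fps (\<lambda>n. (- 1) ^ n * f n)"
  have "?T = ?T * (?S * ?F)" using assms by simp
  also have "\<dots> = (?S * ?T) * ?F" by (simp only: mult_ac)
  finally have "?T = ?F" by (simp add: secular_tr_sym_fps)
  then have "fps_nth ?T n = fps_nth ?F n" by simp
  then show ?thesis by simp
qed

lemma secular_0: "secular 0 A = 1"
  using secular_tr_sym_fps[of A, THEN arg_cong[where f = "\<lambda>F. fps_nth F 0"]]
  by (auto simp: tr_sym_eq mset_sum_def)

lemma tr_sym_cong: "(\<And>k. secular k A = secular k B) \<Longrightarrow> tr_sym n A = tr_sym n B"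
  by (rule tr_sym_unique) (simp add: secular_tr_sym_fps)

lemma tr_sym_conj: "is_inv g h \<Longrightarrow> tr_sym n (g ** A ** h) = tr_sym n A"
  by (rule tr_sym_cong) (rule secular_conj)

lemma secular_tr_sym_sum:
  "(\<Sum>i=0..n. secular i A * ((- 1) ^ (n - i) * tr_sym (n - i) A)) = (if n = 0 then 1 else 0)"
  using secular_tr_sym_fps[of A, THEN arg_cong[where f = "\<lambda>F. fps_nth F n"]]
  by (simp add: fps_mult_nth)

lemma tr_sym_adjoint: "tr_sym n (adjoint_mat A) = cnj (tr_sym n A)"
proof (rule tr_sym_unique, rule fps_ext)
  fix n
  have "fps_nth (Abs_fps (\<lambda>k. secular k (adjoint_mat A)) * Abs_fps (\<lambda>n. (- 1) ^ n * cnj (tr_sym n A))) n =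
      cnj (\<Sum>i=0..n. secular i A * ((- 1) ^ (n - i) * tr_sym (n - i) A))"
    by (simp add: fps_mult_nth secular_adjoint)
  also have "\<dots> = fps_nth 1 n" unfolding secular_tr_sym_sum by simp
  finally show "fps_nth (Abs_fps (\<lambda>k. secular k (adjoint_mat A)) * Abs_fps (\<lambda>n. (- 1) ^ n * cnj (tr_sym n A))) n = fps_nth 1 n" .
qed

text \<open>Eigenvalues are not polynomial in the entries, but comparing coefficients in
  \<open>secular_tr_sym_fps\<close> expresses \<open>tr_sym n\<close> recursively through secular
  coefficients and smaller symmetric powers.\<close>

lemma polyfun_tr_sym: "polyfun (\<lambda>A B. tr_sym n A)"
proof (induction n rule: less_induct)
  case (less n)
  show ?case
  proof (cases "n = 0")
    case True
    then show ?thesis by (simp add: tr_sym_eq mset_sum_def polyfun_const)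
  next
    case False
    have eq: "tr_sym n A = (- 1) ^ n * (- 1) * (\<Sum>i=1..n. secular i A * ((- 1) ^ (n - i) * tr_sym (n - i) A))" for A :: "complex^'a^'a"
    proof -
      define R where "R = (\<Sum>i=1..n. secular i A * ((- 1) ^ (n - i) * tr_sym (n - i) A))"
      have "(- 1) ^ n * tr_sym n A + R = 0"
        using secular_tr_sym_sum[of A n] False by (simp add: sum.atLeast_Suc_atMost secular_0 R_def)
      then have R: "(- 1) ^ n * tr_sym n A = - R" by (simp only: eq_neg_iff_add_eq_0)
      have "(- 1) ^ n * (- 1) ^ n = (1 :: complex)" by (simp flip: power_mult_distrib)
      then have "tr_sym n A = (- 1) ^ n * ((- 1) ^ n * tr_sym n A)" by (simp only: mult.assoc[symmetric] mult_1_left)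
      then show ?thesis unfolding R R_def[symmetric] by simp
    qed
    show ?thesis
      unfolding eq by (intro polyfun_mult polyfun_sum polyfun_const polyfun_secular less) auto
  qed
qed

text \<open>Here det (z I + A) factors over the index type, so multisets of indices are summed;
  their multiplicities are the exponent vectors of \<open>hsym\<close>.\<close>

lemma tr_sym_diag:
  fixes t :: "'n::finite \<Rightarrow> complex"
  shows "tr_sym n (diag_mat t) = hsym n t"
proof -
  have "tr_sym n (diag_mat t) = mset_sum n UNIV t"
    by (rule tr_sym_unique, rule secular_fps) (simp_all add: plus_det_diag)
  also have "\<dots> = hsym n t"
    unfolding mset_sum_def hsym_def
  proof (rule sum.reindex_bij_witness[where i = "\<lambda>\<gamma>. Abs_multiset (\<lambda>i. nat (\<gamma> i))" and j = "\<lambda>K i. int (count K i)"])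
    fix K :: "'n multiset" assume K: "K \<in> multisets_of_size UNIV n"
    show "Abs_multiset (\<lambda>i. nat (int (count K i))) = K" by simp
    have sz: "size K = (\<Sum>i\<in>UNIV. count K i)"
      unfolding size_multiset_overloaded_eq by (rule sum.mono_neutral_left) (auto simp: not_in_iff)
    then show "(\<lambda>i. int (count K i)) \<in> {\<gamma>. (\<forall>i. 0 \<le> \<gamma> i) \<and> sum \<gamma> UNIV = int n}"
      using K by (auto simp: multisets_of_size_def simp flip: of_nat_sum)
    have "(\<Prod>p\<in>#K. t p) = (\<Prod>i\<in>UNIV. t i ^ count K i)"
      unfolding image_prod_mset_multiplicity by (rule prod.mono_neutral_left) (auto simp: not_in_iff)
    then show "(\<Prod>i\<in>UNIV. t i powi int (count K i)) = (\<Prod>p\<in>#K. t p)" by simp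
  next
    fix \<gamma> :: "'n \<Rightarrow> int" assume \<gamma>: "\<gamma> \<in> {\<gamma>. (\<forall>i. 0 \<le> \<gamma> i) \<and> sum \<gamma> UNIV = int n}"
    have c: "count (Abs_multiset (\<lambda>i. nat (\<gamma> i))) = (\<lambda>i. nat (\<gamma> i))"
      by (rule count_Abs_multiset) (auto intro: finite_subset[OF subset_UNIV])
    show "(\<lambda>i. int (count (Abs_multiset (\<lambda>i. nat (\<gamma> i))) i)) = \<gamma>"
      using \<gamma> unfolding c by auto
    have "int (size (Abs_multiset (\<lambda>i. nat (\<gamma> i)))) = (\<Sum>i\<in>UNIV. int (nat (\<gamma> i)))"
      unfolding size_multiset_overloaded_eq of_nat_sum
      by (subst sum.mono_neutral_left[of UNIV]) (auto simp: not_in_iff c)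
    also have "\<dots> = int n" using \<gamma> by simp
    finally show "Abs_multiset (\<lambda>i. nat (\<gamma> i)) \<in> multisets_of_size UNIV n"
      by (simp add: multisets_of_size_def)
  qed
  finally show ?thesis .
qed

section \<open>Walks\<close>

text \<open>A walk is continued by \<open>0\<close> after its last step, so that each walk has exactly one representative.\<close>

definition walks :: "(nat \<Rightarrow> ('n::finite \<Rightarrow> int) \<Rightarrow> ('n \<Rightarrow> int) set) \<Rightarrow> nat \<Rightarrow> (nat \<Rightarrow> 'n \<Rightarrow> int) set" where
  "walks R n = {w. w 0 = (\<lambda>_. 0) \<and> (\<forall>d<n. w (Suc d) \<in> R d (w d)) \<and> (\<forall>d>n. w d = (\<lambda>_. 0))}"

lemma walks_0: "walks R 0 = {\<lambda>_ _. 0}"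
  by (auto simp: walks_def fun_eq_iff) (metis neq0_conv)

lemma walks_Suc:
  "bij_betw (\<lambda>(w, k). w(Suc n := k)) (SIGMA w:walks R n. R n (w n)) (walks R (Suc n))"
  by (rule bij_betwI[where g = "\<lambda>w. (w(Suc n := (\<lambda>_. 0)), w (Suc n))"])
     (auto simp: walks_def less_Suc_eq fun_eq_iff)

lemma finite_walks:
  assumes "\<And>d l. d < n \<Longrightarrow> finite (R d l)"
  shows "finite (walks R n)"
  using assms
proof (induction n)
  case (Suc n)
  then have "finite (SIGMA w:walks R n. R n (w n))" by (intro finite_SigmaI) auto
  then show ?case using bij_betw_finite[OF walks_Suc] by blast
qed (simp add: walks_0)

lemma walks_expansion:
  assumes fin: "\<And>d l. d < n \<Longrightarrow> finite (R d l)"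
    and dom: "\<And>d l k. d < n \<Longrightarrow> k \<in> R d l \<Longrightarrow> dominant k"
    and step: "\<And>d l. d < n \<Longrightarrow> dominant l \<Longrightarrow> alt l t * \<phi> d = (\<Sum>k\<in>R d l. alt k t)"
  shows "alt (\<lambda>_. 0) t * (\<Prod>d<n. \<phi> d) = (\<Sum>w\<in>walks R n. alt (w n) t)"
  using assms
proof (induction n)
  case (Suc n)
  have dw: "dominant (w n)" if "w \<in> walks R n" for w
  proof (cases n)
    case 0
    then show ?thesis using that by (simp add: walks_0 dominant_def)
  next
    case (Suc m)
    then show ?thesis using that Suc.prems(2)[of m "w n" "w m"] by (auto simp: walks_def)
  qed
  have "alt (\<lambda>_. 0) t * (\<Prod>d<Suc n. \<phi> d) = (\<Sum>w\<in>walks R n. alt (w n) t) * \<phi> n"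
  proof -
    have "alt (\<lambda>_. 0) t * (\<Prod>d<n. \<phi> d) = (\<Sum>w\<in>walks R n. alt (w n) t)"
      by (rule Suc.IH; (rule Suc.prems)?; simp?)
    then show ?thesis by (simp flip: mult.assoc)
  qed
  also have "\<dots> = (\<Sum>w\<in>walks R n. \<Sum>k\<in>R n (w n). alt k t)"
    unfolding sum_distrib_right using Suc.prems(3)[of n] dw by (intro sum.cong) auto
  also have "\<dots> = (\<Sum>(w, k)\<in>(SIGMA w:walks R n. R n (w n)). alt k t)"
    using Suc.prems(1) by (subst sum.Sigma) (auto intro: finite_walks)
  also have "\<dots> = (\<Sum>w\<in>walks R (Suc n). alt (w (Suc n)) t)"
    using sum.reindex_bij_betw[OF walks_Suc[of n R], of "\<lambda>w. alt (w (Suc n)) t"] by (simp add: split_def)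
  finally show ?case .
qed (simp add: walks_0)

text \<open>Grouping the walks by end point makes the coefficient of an alternant the number of
  walks ending at its weight.\<close>

lemma integral_eq_card_walks:
  fixes e :: "'n::finite matpoly" and M :: "(complex^'n^'n) measure"
  assumes haar: "haar_unitary M" and e: "class_fn e"
    and fin: "\<And>d l. d < n \<Longrightarrow> finite (R d l)"
    and dom: "\<And>d l k. d < n \<Longrightarrow> k \<in> R d l \<Longrightarrow> dominant k"
    and step: "\<And>d l t. regular t \<Longrightarrow> d < n \<Longrightarrow> dominant l \<Longrightarrow> alt l t * \<phi> d t = (\<Sum>k\<in>R d l. alt k t)"
    and eval_torus: "\<And>t. regular t \<Longrightarrow> eval_torus e t = (\<Prod>d<n. \<phi> d t)"
  shows "(\<integral>U. eval_unitary e U \<partial>M) = of_nat (card {w \<in> walks R n. w n = (\<lambda>_. 0)})"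
proof -
  let ?W = "walks R n"
  define c where "c l = (of_nat (card {w \<in> ?W. w n = l}) :: complex)" for l
  have finW: "finite ?W" by (rule finite_walks[OF fin])
  have dw: "dominant (w n)" if "w \<in> walks R n" for w
  proof (cases n)
    case 0
    then show ?thesis using that by (simp add: walks_0 dominant_def)
  next
    case (Suc m)
    then show ?thesis using that dom[of m "w n" "w m"] by (auto simp: walks_def)
  qed
  have "(\<integral>U. eval_unitary e U \<partial>M) = c (\<lambda>_. 0)"
  proof (rule class_fn_integral[OF haar _ _ _ e, where W = "(\<lambda>w. w n) ` ?W - {\<lambda>_. 0}"])
    fix t :: "'n \<Rightarrow> complex" assume t: "regular t"
    have "alt (\<lambda>_. 0) t * eval_torus e t = (\<Sum>w\<in>?W. alt (w n) t)"
      unfolding eval_torus[OF t] by (rule walks_expansion[OF fin dom step[OF t]])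
    also have "\<dots> = (\<Sum>l\<in>(\<lambda>w. w n) ` ?W. \<Sum>w\<in>{w \<in> ?W. w n = l}. alt (w n) t)"
      by (rule sum.image_gen[OF finW])
    also have "\<dots> = (\<Sum>l\<in>(\<lambda>w. w n) ` ?W. c l * alt l t)"
      by (intro sum.cong refl) (simp add: c_def)
    \<comment> \<open>Possibly no walk ends at 0; the inserted term then has coefficient 0.\<close>
    also have "\<dots> = (\<Sum>l\<in>insert (\<lambda>_. 0) ((\<lambda>w. w n) ` ?W). c l * alt l t)"
    proof (rule sum.mono_neutral_left)
      show "\<forall>l\<in>insert (\<lambda>_. 0) ((\<lambda>w. w n) ` ?W) - (\<lambda>w. w n) ` ?W. c l * alt l t = 0"
      proof
        fix l assume "l \<in> insert (\<lambda>_. 0) ((\<lambda>w. w n) ` ?W) - (\<lambda>w. w n) ` ?W"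
        then have "{w \<in> ?W. w n = l} = {}" by auto
        then have "c l = 0" unfolding c_def by (simp only: card.empty of_nat_0)
        then show "c l * alt l t = 0" by simp
      qed
    qed (use finW in auto)
    also have "\<dots> = c (\<lambda>_. 0) * alt (\<lambda>_. 0) t + (\<Sum>l\<in>(\<lambda>w. w n) ` ?W - {\<lambda>_. 0}. c l * alt l t)"
      using finW by (subst sum.insert_remove) auto
    finally show "alt (\<lambda>_. 0) t * eval_torus e t = \<dots>" .
  qed (use finW dw in auto)
  then show ?thesis by (simp add: c_def)
qed

text \<open>The first \<open>length \<mu>\<close> steps go up by the parts of \<open>\<mu>\<close>, the others go down by the parts of
  \<open>\<nu>\<close> in reverse order.\<close>

definition nat_walks :: "nat \<Rightarrow> nat list \<Rightarrow> nat list \<Rightarrow> (nat \<Rightarrow> (nat \<Rightarrow> nat) \<Rightarrow> (nat \<Rightarrow> nat) \<Rightarrow> bool) \<Rightarrow> (nat \<Rightarrow> nat \<Rightarrow> nat) set" where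
  "nat_walks N \<mu> \<nu> P = {v. (\<forall>d k. N \<le> k \<longrightarrow> v d k = 0) \<and> (\<forall>k. v 0 k = 0) \<and>
     (\<forall>d k. length \<mu> + length \<nu> \<le> d \<longrightarrow> v d k = 0) \<and>
     (\<forall>d<length \<mu>. P (\<mu> ! d) (v d) (v (Suc d))) \<and>
     (\<forall>d. length \<mu> \<le> d \<longrightarrow> d < length \<mu> + length \<nu> \<longrightarrow>
        P (\<nu> ! (length \<mu> + length \<nu> - 1 - d)) (v (Suc d)) (v d))}"

definition extend :: "(nat \<Rightarrow> nat) \<Rightarrow> 'n::finite \<Rightarrow> int" where
  "extend u i = int (u (rank i))"

definition strip_steps :: "nat list \<Rightarrow> nat list \<Rightarrow> (nat \<Rightarrow> ('n::finite \<Rightarrow> int) \<Rightarrow> ('n \<Rightarrow> int) \<Rightarrow> bool) \<Rightarrow> nat \<Rightarrow> ('n \<Rightarrow> int) \<Rightarrow> ('n \<Rightarrow> int) set" where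
  "strip_steps \<mu> \<nu> Q d l = (if d < length \<mu> then {k. Q (\<mu> ! d) l k} else {k. Q (\<nu> ! (length \<mu> + length \<nu> - 1 - d)) k l})"

text \<open>Weights may have negative entries, but those of a closed walk cannot: it rises from 0 up
  to step \<open>length \<mu>\<close> and, read backwards from its end, rises from 0 again. So it
  consists of sequences of naturals, which are padded by zeros beyond N.\<close>

lemma card_closed_walks:
  fixes Q :: "nat \<Rightarrow> ('n::finite \<Rightarrow> int) \<Rightarrow> ('n \<Rightarrow> int) \<Rightarrow> bool"
  assumes PQ: "\<And>r u v. (\<And>k. CARD('n) \<le> k \<Longrightarrow> u k = 0) \<Longrightarrow> (\<And>k. CARD('n) \<le> k \<Longrightarrow> v k = 0) \<Longrightarrow>
       Q r (extend u) (extend v) \<longleftrightarrow> P r u v"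
    and mono: "\<And>r l k i. Q r l k \<Longrightarrow> l i \<le> k i"
  shows "card {w \<in> walks (strip_steps \<mu> \<nu> Q) (length \<mu> + length \<nu>). w (length \<mu> + length \<nu>) = (\<lambda>_. 0)} =
     card (nat_walks CARD('n) \<mu> \<nu> P)"
proof -
  let ?p = "length \<mu>" and ?L = "length \<mu> + length \<nu>"
  define C where "C = {w \<in> walks (strip_steps \<mu> \<nu> Q) ?L. w ?L = (\<lambda>_. 0)}"
  define F where "F v d = (extend (v d) :: 'n \<Rightarrow> int)" for v :: "nat \<Rightarrow> nat \<Rightarrow> nat" and d
  define G where "G w d k = (if k < CARD('n) then nat (w d (enum k)) else 0)" for w :: "nat \<Rightarrow> 'n \<Rightarrow> int" and d k
  have up: "Q (\<mu> ! d) (w d) (w (Suc d))" if w: "w \<in> C" and d: "d < ?p" for w d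
  proof -
    have "w (Suc d) \<in> strip_steps \<mu> \<nu> Q d (w d)" using w d by (simp add: C_def walks_def)
    then show ?thesis using d by (simp add: strip_steps_def)
  qed
  have down: "Q (\<nu> ! (?L - 1 - d)) (w (Suc d)) (w d)" if w: "w \<in> C" and d: "?p \<le> d" "d < ?L" for w d
  proof -
    have "w (Suc d) \<in> strip_steps \<mu> \<nu> Q d (w d)" using w d by (simp add: C_def walks_def)
    then show ?thesis using d by (simp add: strip_steps_def)
  qed
  have nonneg: "w d i \<ge> 0" if w: "w \<in> C" for w d i
  proof -
    consider "d \<le> ?p" | "?p \<le> d" "d \<le> ?L" | "d > ?L" by linarith
    then show ?thesis
    proof cases
      case 1
      then show ?thesis
      proof (induction d)
        case 0 then show ?case using w by (simp add: C_def walks_def)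
      next
        case (Suc d)
        then show ?case using mono[OF up[OF w, of d], of i] by simp
      qed
    next
      case 2
      from 2(2,1) show ?thesis
      proof (induction rule: inc_induct)
        case base then show ?case using w by (simp add: C_def)
      next
        case (step m)
        then show ?case using mono[OF down[OF w, of m], of i] by simp
      qed
    next
      case 3 then show ?thesis using w by (simp add: C_def walks_def)
    qed
  qed
  have ext: "extend (G w d) = w d" if "w \<in> C" for w d
    using nonneg[OF that] by (auto simp: extend_def G_def fun_eq_iff)
  have supp: "CARD('n) \<le> k \<Longrightarrow> G w d k = 0" for w d k by (simp add: G_def)
  have "bij_betw F (nat_walks CARD('n) \<mu> \<nu> P) C"
  proof (rule bij_betwI[where g = G])
    show "F \<in> nat_walks CARD('n) \<mu> \<nu> P \<rightarrow> C"
    proof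
      fix v assume v: "v \<in> nat_walks CARD('n) \<mu> \<nu> P"
      have s: "CARD('n) \<le> k \<Longrightarrow> v d k = 0" for d k using v by (simp add: nat_walks_def)
      have z: "F v d = (\<lambda>_. 0)" if "d = 0 \<or> ?L \<le> d" for d
        using v that by (auto simp: F_def extend_def nat_walks_def fun_eq_iff)
      have "F v (Suc d) \<in> strip_steps \<mu> \<nu> Q d (F v d)" if "d < ?L" for d
        using v that by (auto simp: F_def strip_steps_def PQ s nat_walks_def)
      then show "F v \<in> C" using z by (simp add: C_def walks_def)
    qed
    show "G \<in> C \<rightarrow> nat_walks CARD('n) \<mu> \<nu> P"
    proof
      fix w assume w: "w \<in> C"
      have 1: "P (\<mu> ! d) (G w d) (G w (Suc d))" if "d < ?p" for d
        using up[OF w that] PQ[of "G w d" "G w (Suc d)", OF supp supp] by (simp add: ext[OF w])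
      have 2: "P (\<nu> ! (?L - 1 - d)) (G w (Suc d)) (G w d)" if "?p \<le> d" "d < ?L" for d
        using down[OF w that] PQ[of "G w (Suc d)" "G w d", OF supp supp] by (simp add: ext[OF w])
      have z: "w d = (\<lambda>_. 0)" if "d = 0 \<or> ?L \<le> d" for d
        using w that by (cases "d = ?L") (auto simp: C_def walks_def)
      show "G w \<in> nat_walks CARD('n) \<mu> \<nu> P"
        unfolding nat_walks_def using 1 2 z supp by (auto simp: G_def)
    qed
    show "F (G w) = w" if "w \<in> C" for w using ext[OF that] by (auto simp: F_def fun_eq_iff)
    show "G (F v) = v" if "v \<in> nat_walks CARD('n) \<mu> \<nu> P" for v
      using that by (auto simp: G_def F_def extend_def nat_walks_def fun_eq_iff)
  qed
  from bij_betw_same_card[OF this] show ?thesis by (simp add: C_def)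
qed

section \<open>Horizontal and vertical strips as relations between sequences of naturals\<close>

definition interlacing :: "nat \<Rightarrow> nat \<Rightarrow> (nat \<Rightarrow> nat) \<Rightarrow> (nat \<Rightarrow> nat) \<Rightarrow> bool" where
  "interlacing N r u v \<longleftrightarrow> (\<forall>k. u k \<le> v k \<and> v (Suc k) \<le> u k) \<and> (\<Sum>k<N. v k) = (\<Sum>k<N. u k) + r"

definition vertical :: "nat \<Rightarrow> nat \<Rightarrow> (nat \<Rightarrow> nat) \<Rightarrow> (nat \<Rightarrow> nat) \<Rightarrow> bool" where
  "vertical N r u v \<longleftrightarrow> antimono u \<and> antimono v \<and> (\<forall>k. u k \<le> v k \<and> v k \<le> Suc (u k)) \<and> (\<Sum>k<N. v k) = (\<Sum>k<N. u k) + r"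

lemma sum_extend: "(\<Sum>i\<in>UNIV. extend u (i :: 'n::finite)) = int (\<Sum>k<CARD('n). u k)"
  unfolding sum_enum of_nat_sum by (intro sum.cong) (auto simp: extend_def)

lemma extend_enum: "k < CARD('n) \<Longrightarrow> extend u (enum k :: 'n::finite) = int (u k)"
  by (simp add: extend_def)

lemma dominant_extend:
  assumes "\<And>k. CARD('n) \<le> k \<Longrightarrow> u k = 0"
  shows "dominant (extend u :: 'n::finite \<Rightarrow> int) \<longleftrightarrow> antimono u"
proof -
  have "u (Suc k) \<le> u k" if "Suc k < CARD('n) \<Longrightarrow> u (Suc k) \<le> u k" for k
    using that assms[of "Suc k"] by (cases "Suc k < CARD('n)") auto
  then show ?thesis
    by (auto simp: dominant_def extend_enum antimono_iff_le_Suc)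
qed

lemma hstrip_extend:
  assumes "\<And>k. CARD('n) \<le> k \<Longrightarrow> u k = 0" "\<And>k. CARD('n) \<le> k \<Longrightarrow> v k = 0"
  shows "hstrip r (extend u) (extend v :: 'n::finite \<Rightarrow> int) \<longleftrightarrow> interlacing CARD('n) r u v"
proof -
  have 1: "(\<forall>j. extend u (j :: 'n) \<le> extend v j) \<longleftrightarrow> (\<forall>k. u k \<le> v k)"
  proof
    assume a: "\<forall>j. extend u (j :: 'n) \<le> extend v j"
    show "\<forall>k. u k \<le> v k"
    proof
      fix k
      show "u k \<le> v k" using a[rule_format, of "enum k"] assms(1)[of k]
        by (cases "k < CARD('n)") (auto simp: extend_enum)
    qed
  qed (simp add: extend_def)
  have 2: "(\<forall>i. Suc i < CARD('n) \<longrightarrow> extend v (enum (Suc i) :: 'n) \<le> extend u (enum i :: 'n)) \<longleftrightarrow> (\<forall>k. v (Suc k) \<le> u k)"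
  proof
    assume a: "\<forall>i. Suc i < CARD('n) \<longrightarrow> extend v (enum (Suc i) :: 'n) \<le> extend u (enum i :: 'n)"
    show "\<forall>k. v (Suc k) \<le> u k"
    proof
      fix k
      show "v (Suc k) \<le> u k" using a[rule_format, of k] assms(2)[of "Suc k"] extend_enum[where 'n='n, of k u]
        by (cases "Suc k < CARD('n)") (simp_all add: extend_enum)
    qed
  qed (simp add: extend_enum)
  show ?thesis
    unfolding hstrip_def interlacing_def 1 2 sum_extend of_nat_add[symmetric] of_nat_eq_iff by blast
qed

lemma vstrip_iff:
  "vstrip r l k \<longleftrightarrow> (\<forall>j. l j \<le> k j \<and> k j \<le> l j + 1) \<and> (\<Sum>j\<in>UNIV. k j) = (\<Sum>j\<in>UNIV. l j) + int r"
proof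
  assume "vstrip r l k"
  then obtain S where "card S = r" "k = (\<lambda>j. l j + indic S j)" by (auto simp: vstrip_def)
  then show "(\<forall>j. l j \<le> k j \<and> k j \<le> l j + 1) \<and> (\<Sum>j\<in>UNIV. k j) = (\<Sum>j\<in>UNIV. l j) + int r"
    by (auto simp: indic_def sum.distrib sum.If_cases)
next
  assume a: "(\<forall>j. l j \<le> k j \<and> k j \<le> l j + 1) \<and> (\<Sum>j\<in>UNIV. k j) = (\<Sum>j\<in>UNIV. l j) + int r"
  define S where "S = {j. k j = l j + 1}"
  have k: "k = (\<lambda>j. l j + indic S j)"
  proof
    fix j
    have "l j \<le> k j" "k j \<le> l j + 1" using a by auto
    then show "k j = l j + indic S j" by (auto simp: S_def indic_def)
  qed
  have "(\<Sum>j\<in>UNIV. k j) = (\<Sum>j\<in>UNIV. l j) + int (card S)"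
    unfolding k by (simp add: indic_def sum.distrib sum.If_cases)
  then have "card S = r" using a by simp
  with k show "vstrip r l k" by (auto simp: vstrip_def)
qed

lemma vstrip_extend:
  assumes "\<And>k. CARD('n) \<le> k \<Longrightarrow> u k = 0" "\<And>k. CARD('n) \<le> k \<Longrightarrow> v k = 0"
  shows "(dominant (extend u :: 'n::finite \<Rightarrow> int) \<and> dominant (extend v :: 'n \<Rightarrow> int) \<and> vstrip r (extend u) (extend v :: 'n \<Rightarrow> int)) \<longleftrightarrow> vertical CARD('n) r u v"
proof -
  have 1: "(\<forall>j. extend u (j :: 'n) \<le> extend v j \<and> extend v j \<le> extend u j + 1) \<longleftrightarrow> (\<forall>k. u k \<le> v k \<and> v k \<le> Suc (u k))"
  proof
    assume a: "\<forall>j. extend u (j :: 'n) \<le> extend v j \<and> extend v j \<le> extend u j + 1"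
    show "\<forall>k. u k \<le> v k \<and> v k \<le> Suc (u k)"
    proof
      fix k
      show "u k \<le> v k \<and> v k \<le> Suc (u k)" using a[rule_format, of "enum k"] assms(1)[of k] assms(2)[of k]
        by (cases "k < CARD('n)") (auto simp: extend_enum)
    qed
  next
    assume a: "\<forall>k. u k \<le> v k \<and> v k \<le> Suc (u k)"
    show "\<forall>j. extend u (j :: 'n) \<le> extend v j \<and> extend v j \<le> extend u j + 1"
    proof
      fix j :: 'n
      show "extend u j \<le> extend v j \<and> extend v j \<le> extend u j + 1"
        using a[rule_format, of "rank j"] unfolding extend_def by linarith
    qed
  qed
  show ?thesis
    unfolding vstrip_iff vertical_def 1 sum_extend of_nat_add[symmetric] of_nat_eq_iff
    using dominant_extend[where 'n='n, of u] dominant_extend[where 'n='n, of v] assms by blast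
qed

lemma finite_vstrip: "finite {k. vstrip r l k}" "finite {k. vstrip r k l}"
proof -
  have "{k. vstrip r l k} \<subseteq> (\<lambda>S j. l j + indic S j) ` UNIV" by (auto simp: vstrip_def)
  then show "finite {k. vstrip r l k}" by (rule finite_subset) simp
  have "k \<in> (\<lambda>S j. l j - indic S j) ` UNIV" if "vstrip r k l" for k
  proof -
    obtain S where "l = (\<lambda>j. k j + indic S j)" using \<open>vstrip r k l\<close> by (auto simp: vstrip_def)
    then show ?thesis by (intro image_eqI[of _ _ S]) auto
  qed
  then have "{k. vstrip r k l} \<subseteq> (\<lambda>S j. l j - indic S j) ` UNIV" by blast
  then show "finite {k. vstrip r k l}" by (rule finite_subset) simp
qed

lemma finite_hstrip: "finite {k. hstrip r l k}" "finite {k. hstrip r k l}"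
proof -
  let ?C = "{\<gamma> :: 'a \<Rightarrow> int. (\<forall>i. \<gamma> i \<ge> 0) \<and> (\<Sum>i\<in>UNIV. \<gamma> i) = int r}"
  have "{k. hstrip r l k} \<subseteq> (\<lambda>\<gamma> j. l j + \<gamma> j) ` ?C"
    by (auto simp: hstrip_def sum_subtractf intro!: image_eqI[where x = "\<lambda>j. _ j - l j"])
  then show "finite {k. hstrip r l k}" by (rule finite_subset) (simp add: finite_compositions)
  have "{k. hstrip r k l} \<subseteq> (\<lambda>\<gamma> j. l j - \<gamma> j) ` ?C"
    by (auto simp: hstrip_def sum_subtractf intro!: image_eqI[where x = "\<lambda>j. l j - _ j"])
  then show "finite {k. hstrip r k l}" by (rule finite_subset) (simp add: finite_compositions)
qed

lemma prod_list_count: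
  fixes f :: "nat \<Rightarrow> 'a::comm_monoid_mult"
  assumes "finite S" "set xs \<subseteq> S"
  shows "(\<Prod>i<length xs. f (xs ! i)) = (\<Prod>j\<in>S. f j ^ count_list xs j)"
proof -
  have "prod_list (map f xs) = (\<Prod>j\<in>S. f j ^ count_list xs j)"
    using assms(2)
  proof (induction xs)
    case (Cons x xs)
    have "(\<Prod>j\<in>S. f j ^ count_list (x # xs) j) = (\<Prod>j\<in>S. (if j = x then f x else 1) * f j ^ count_list xs j)"
      by (intro prod.cong refl) simp
    also have "\<dots> = f x * (\<Prod>j\<in>S. f j ^ count_list xs j)"
      using Cons.prems assms(1) by (simp add: prod.distrib)
    finally show ?case using Cons by simp
  qed simp
  moreover have "prod_list (map f xs) = (\<Prod>i<length xs. f (xs ! i))"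
    by (simp add: prod.list_conv_set_nth atLeast0LessThan)
  ultimately show ?thesis by simp
qed

text \<open>Common part of both integrals: \<phi> gives the values of the class functions f on the
  torus, Q is the strip relation on integer weights and P the same relation on sequences of
  naturals.\<close>

lemma integral_eq_card_nat_walks:
  fixes M :: "(complex^'n^'n) measure" and f :: "nat \<Rightarrow> complex^'n^'n \<Rightarrow> complex"
    and Q :: "nat \<Rightarrow> ('n \<Rightarrow> int) \<Rightarrow> ('n \<Rightarrow> int) \<Rightarrow> bool"
  assumes haar: "haar_unitary M"
    and a: "partition_with_mults l a \<mu>" and b: "partition_with_mults l b \<nu>"
    and poly: "\<And>j. polyfun (\<lambda>A B. f j A)" and conj: "\<And>j g h A. is_inv g h \<Longrightarrow> f j (g ** A ** h) = f j A"
    and adj: "\<And>j A. f j (adjoint_mat A) = cnj (f j A)" and diag: "\<And>j t. f j (diag_mat t) = \<phi> j t"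
    and up: "\<And>t l r. regular t \<Longrightarrow> dominant l \<Longrightarrow> alt l t * \<phi> r t = (\<Sum>k | Q r l k. alt k t)"
    and down: "\<And>t l r. regular t \<Longrightarrow> dominant l \<Longrightarrow> alt l t * \<phi> r (\<lambda>i. inverse (t i)) = (\<Sum>k | Q r k l. alt k t)"
    and fin: "\<And>r l. finite {k. Q r l k}" "\<And>r l. finite {k. Q r k l}"
    and dom: "\<And>r l k. Q r l k \<Longrightarrow> dominant l" "\<And>r l k. Q r l k \<Longrightarrow> dominant k"
    and PQ: "\<And>r u v. (\<And>k. CARD('n) \<le> k \<Longrightarrow> u k = 0) \<Longrightarrow> (\<And>k. CARD('n) \<le> k \<Longrightarrow> v k = 0) \<Longrightarrow>
       Q r (extend u) (extend v) \<longleftrightarrow> P r u v"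
    and mono: "\<And>r l k i. Q r l k \<Longrightarrow> l i \<le> k i"
  shows "(\<integral>U. (\<Prod>j=1..l. f j U ^ a j * cnj (f j U ^ b j)) \<partial>M) = of_nat (card (nat_walks CARD('n) \<mu> \<nu> P))"
proof -
  let ?L = "length \<mu> + length \<nu>"
  \<comment> \<open>The second factor is evaluated at B, which is the adjoint on U(N), giving the
    conjugate, and the inverse on the torus, giving the inverted variables.\<close>
  have "polyfun (\<lambda>A B. \<Prod>j=1..l. f j A ^ a j * f j B ^ b j)"
    by (intro polyfun_prod polyfun_mult polyfun_power poly polyfun_swap[OF poly])
  then obtain e where e: "\<And>A B. eval_mp e A B = (\<Prod>j=1..l. f j A ^ a j * f j B ^ b j)"
    unfolding polyfun_def by auto
  have cl: "class_fn e" by (simp add: class_fn_def e conj)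
  have eval_unitary: "eval_unitary e U = (\<Prod>j=1..l. f j U ^ a j * cnj (f j U ^ b j))" for U
    by (simp add: eval_unitary_def e adj)
  define \<psi> where "\<psi> d t = (if d < length \<mu> then \<phi> (\<mu> ! d) t else \<phi> (\<nu> ! (?L - 1 - d)) (\<lambda>i. inverse (t i)))" for d t
  have eval_torus: "eval_torus e t = (\<Prod>d<?L. \<psi> d t)" for t
  proof -
    have cnt: "(\<Prod>i<length xs. F (xs ! i)) = (\<Prod>j=1..l. F j ^ c j)" if "partition_with_mults l c xs" for xs c and F :: "nat \<Rightarrow> complex"
    proof -
      have "(\<Prod>i<length xs. F (xs ! i)) = (\<Prod>j\<in>{1..l}. F j ^ count_list xs j)"
        using that by (intro prod_list_count) (auto simp: partition_with_mults_def)
      also have "\<dots> = (\<Prod>j=1..l. F j ^ c j)"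
        using that by (intro prod.cong) (auto simp: partition_with_mults_def)
      finally show ?thesis .
    qed
    have L: "{..<?L} = {..<length \<mu>} \<union> {length \<mu>..<?L}" by auto
    have "(\<Prod>d<?L. \<psi> d t) = (\<Prod>d<length \<mu>. \<psi> d t) * (\<Prod>d\<in>{length \<mu>..<?L}. \<psi> d t)"
      unfolding L by (rule prod.union_disjoint) auto
    also have "(\<Prod>d<length \<mu>. \<psi> d t) = (\<Prod>j=1..l. \<phi> j t ^ a j)"
      unfolding cnt[OF a, symmetric] by (intro prod.cong) (auto simp: \<psi>_def)
    also have "(\<Prod>d\<in>{length \<mu>..<?L}. \<psi> d t) = (\<Prod>i<length \<nu>. \<phi> (\<nu> ! i) (\<lambda>i. inverse (t i)))"
      by (rule prod.reindex_bij_witness[where i = "\<lambda>i. ?L - 1 - i" and j = "\<lambda>d. ?L - 1 - d"]) (auto simp: \<psi>_def)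
    also have "\<dots> = (\<Prod>j=1..l. \<phi> j (\<lambda>i. inverse (t i)) ^ b j)" by (rule cnt[OF b])
    finally show ?thesis by (simp add: eval_torus_def e diag prod.distrib)
  qed
  have "(\<integral>U. eval_unitary e U \<partial>M) = of_nat (card {w \<in> walks (strip_steps \<mu> \<nu> Q) ?L. w ?L = (\<lambda>_. 0)})"
  proof (rule integral_eq_card_walks[OF haar cl _ _ _ eval_torus])
    show "finite (strip_steps \<mu> \<nu> Q d l)" for d l by (simp add: strip_steps_def fin)
    show "k \<in> strip_steps \<mu> \<nu> Q d l \<Longrightarrow> dominant k" for d l k
      using dom by (auto simp: strip_steps_def split: if_splits)
    show "regular t \<Longrightarrow> dominant l \<Longrightarrow> alt l t * \<psi> d t = (\<Sum>k\<in>strip_steps \<mu> \<nu> Q d l. alt k t)" for d l t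
      by (simp add: \<psi>_def strip_steps_def up down)
  qed
  also have "card {w \<in> walks (strip_steps \<mu> \<nu> Q) ?L. w ?L = (\<lambda>_. 0)} = card (nat_walks CARD('n) \<mu> \<nu> P)"
  proof (rule card_closed_walks)
    show "Q r (extend u) (extend v) \<longleftrightarrow> P r u v"
      if "\<And>k. CARD('n) \<le> k \<Longrightarrow> u k = 0" "\<And>k. CARD('n) \<le> k \<Longrightarrow> v k = 0" for r u v
      using that by (rule PQ)
    show "Q r l k \<Longrightarrow> l i \<le> k i" for r l k i by (rule mono)
  qed
  finally show ?thesis unfolding eval_unitary .
qed

lemma integral_secular_walks:
  fixes M :: "(complex^'n^'n) measure"
  assumes haar: "haar_unitary M"
    and a: "partition_with_mults l a \<mu>" and b: "partition_with_mults l b \<nu>"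
  shows "(\<integral>U. (\<Prod>j=1..l. secular j U ^ a j * cnj (secular j U ^ b j)) \<partial>M) = of_nat (card (nat_walks CARD('n) \<mu> \<nu> (vertical CARD('n))))"
proof (rule integral_eq_card_nat_walks[OF haar a b polyfun_secular secular_conj secular_adjoint secular_diag,
    where Q = "\<lambda>r l k. dominant l \<and> dominant k \<and> vstrip r l k"])
  fix t :: "'n \<Rightarrow> complex" and l :: "'n \<Rightarrow> int" and r :: nat
  assume t: "regular t" and l: "dominant l"
  have t0: "t i \<noteq> 0" for i using t by (simp add: regular_def)
  show "alt l t * esym r t = (\<Sum>k | dominant l \<and> dominant k \<and> vstrip r l k. alt k t)"
    using alt_mult_esym(1)[OF t0 l] l by simp
  show "alt l t * esym r (\<lambda>i. inverse (t i)) = (\<Sum>k | dominant k \<and> dominant l \<and> vstrip r k l. alt k t)"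
    using alt_mult_esym(2)[OF t0 l] l by simp
next
  show "finite {k. dominant l \<and> dominant k \<and> vstrip r l k}" "finite {k. dominant k \<and> dominant l \<and> vstrip r k l}"
    for l :: "'n \<Rightarrow> int" and r
    by (rule finite_subset[OF _ finite_vstrip(1)[of r l]], blast) (rule finite_subset[OF _ finite_vstrip(2)[of r l]], blast)
next
  fix u v :: "nat \<Rightarrow> nat" and r
  assume "\<And>k. CARD('n) \<le> k \<Longrightarrow> u k = 0" "\<And>k. CARD('n) \<le> k \<Longrightarrow> v k = 0"
  then show "(dominant (extend u :: 'n \<Rightarrow> int) \<and> dominant (extend v :: 'n \<Rightarrow> int) \<and> vstrip r (extend u) (extend v :: 'n \<Rightarrow> int)) = vertical CARD('n) r u v"
    by (rule vstrip_extend)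
qed (auto simp: vstrip_iff)

lemma integral_tr_sym_walks:
  fixes M :: "(complex^'n^'n) measure"
  assumes haar: "haar_unitary M"
    and a: "partition_with_mults l a \<mu>" and b: "partition_with_mults l b \<nu>"
  shows "(\<integral>U. (\<Prod>j=1..l. tr_sym j U ^ a j * cnj (tr_sym j U ^ b j)) \<partial>M) = of_nat (card (nat_walks CARD('n) \<mu> \<nu> (interlacing CARD('n))))"
proof (rule integral_eq_card_nat_walks[OF haar a b polyfun_tr_sym tr_sym_conj tr_sym_adjoint tr_sym_diag, where Q = hstrip])
  fix t :: "'n \<Rightarrow> complex" and l :: "'n \<Rightarrow> int" and r :: nat
  assume t: "regular t" and l: "dominant l"
  have t0: "t i \<noteq> 0" for i using t by (simp add: regular_def)
  show "alt l t * hsym r t = (\<Sum>k | hstrip r l k. alt k t)"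
    by (rule alt_mult_hsym(1)[OF t0 l])
  show "alt l t * hsym r (\<lambda>i. inverse (t i)) = (\<Sum>k | hstrip r k l. alt k t)"
    by (rule alt_mult_hsym(2)[OF t0 l])
next
  fix u v :: "nat \<Rightarrow> nat" and r
  assume "\<And>k. CARD('n) \<le> k \<Longrightarrow> u k = 0" "\<And>k. CARD('n) \<le> k \<Longrightarrow> v k = 0"
  then show "hstrip r (extend u) (extend v :: 'n \<Rightarrow> int) = interlacing CARD('n) r u v"
    by (rule hstrip_extend)
next
  show "hstrip r l k \<Longrightarrow> l i \<le> k i" for r and l k :: "'n \<Rightarrow> int" and i by (simp add: hstrip_def)
  show "finite {k. hstrip r l k}" "finite {k. hstrip r k l}" for r and l :: "'n \<Rightarrow> int"
    by (rule finite_hstrip)+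
  show "hstrip r l k \<Longrightarrow> dominant l" "hstrip r l k \<Longrightarrow> dominant k" for r and l k :: "'n \<Rightarrow> int"
    using hstrip_dominant[of r l k] by simp_all
qed

section \<open>Conjugation of walks\<close>

lemma nat_walksD:
  assumes "y \<in> nat_walks N \<mu> \<nu> P"
  shows "N \<le> k \<Longrightarrow> y d k = 0" "y 0 k = 0" "length \<mu> + length \<nu> \<le> d \<Longrightarrow> y d k = 0"
    "d < length \<mu> \<Longrightarrow> P (\<mu> ! d) (y d) (y (Suc d))"
    "length \<mu> \<le> d \<Longrightarrow> d < length \<mu> + length \<nu> \<Longrightarrow> P (\<nu> ! (length \<mu> + length \<nu> - 1 - d)) (y (Suc d)) (y d)"
  using assms by (auto simp: nat_walks_def)

text \<open>A horizontal strip creates at most one new row; count the strips from the start of the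
  walk and, backwards, from its end.\<close>

lemma interlacing_walk_support:
  assumes y: "y \<in> nat_walks M \<mu> \<nu> (interlacing M')"
  shows "d \<le> length \<mu> \<Longrightarrow> d \<le> k \<Longrightarrow> y d k = 0"
    and "d \<le> length \<mu> + length \<nu> \<Longrightarrow> length \<mu> \<le> d \<Longrightarrow> length \<mu> + length \<nu> - d \<le> k \<Longrightarrow> y d k = 0"
proof -
  show "d \<le> length \<mu> \<Longrightarrow> d \<le> k \<Longrightarrow> y d k = 0"
  proof (induction d arbitrary: k)
    case 0 then show ?case using nat_walksD(2)[OF y] by simp
  next
    case (Suc d)
    then obtain k' where k: "k = Suc k'" "d \<le> k'" by (cases k) auto
    have "y (Suc d) (Suc k') \<le> y d k'" using nat_walksD(4)[OF y, of d] Suc.prems by (simp add: interlacing_def)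
    then show ?case using Suc k by simp
  qed
  show "d \<le> length \<mu> + length \<nu> \<Longrightarrow> length \<mu> \<le> d \<Longrightarrow> length \<mu> + length \<nu> - d \<le> k \<Longrightarrow> y d k = 0"
  proof (induction arbitrary: k rule: inc_induct)
    case base then show ?case using nat_walksD(3)[OF y] by simp
  next
    case (step m)
    then obtain k' where k: "k = Suc k'" "length \<mu> + length \<nu> - Suc m \<le> k'" by (cases k) auto
    have "y m (Suc k') \<le> y (Suc m) k'" using nat_walksD(5)[OF y, of m] step by (simp add: interlacing_def)
    then show ?case using step k by simp
  qed
qed

text \<open>The walk rises until step \<open>length \<mu>\<close> and falls afterwards.\<close>

lemma interlacing_walk_le_middle:
  assumes y: "y \<in> nat_walks M \<mu> \<nu> (interlacing M')"
  shows "y d k \<le> y (length \<mu>) k"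
proof -
  consider "d \<le> length \<mu>" | "length \<mu> \<le> d" "d \<le> length \<mu> + length \<nu>" | "length \<mu> + length \<nu> \<le> d" by linarith
  then show ?thesis
  proof cases
    case 1
    then show ?thesis
    proof (induction rule: inc_induct)
      case (step m)
      then show ?case using nat_walksD(4)[OF y, of m] by (auto simp: interlacing_def intro: order_trans)
    qed simp
  next
    case 2
    then show ?thesis
    proof (induction rule: dec_induct)
      case (step m)
      then show ?case using nat_walksD(5)[OF y, of m] by (auto simp: interlacing_def intro: order_trans)
    qed simp
  qed (simp add: nat_walksD(3)[OF y])
qed

lemma interlacing_walk_antimono:
  assumes y: "y \<in> nat_walks M \<mu> \<nu> (interlacing M')"
  shows "antimono (y d)"
proof -
  have step: "u (Suc k) \<le> u k \<and> v (Suc k) \<le> v k" if "interlacing M' r u v" for r u v and k :: nat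
    using that unfolding interlacing_def by (meson order_trans)
  consider "d < length \<mu>" | "length \<mu> \<le> d" "d < length \<mu> + length \<nu>" | "length \<mu> + length \<nu> \<le> d" by linarith
  then show ?thesis
  proof cases
    case 1 then show ?thesis using nat_walksD(4)[OF y, of d] step unfolding antimono_iff_le_Suc by blast
  next
    case 2 then show ?thesis using nat_walksD(5)[OF y, of d] step unfolding antimono_iff_le_Suc by blast
  qed (simp add: antimono_iff_le_Suc nat_walksD(3)[OF y])
qed

lemma sum_support_eq:
  fixes u :: "nat \<Rightarrow> nat"
  assumes "\<And>k. N \<le> k \<Longrightarrow> u k = 0" "\<And>k. L \<le> k \<Longrightarrow> u k = 0"
  shows "(\<Sum>k<N. u k) = (\<Sum>k<L. u k)"
proof -
  have zero: "\<forall>k\<in>{..<max N L} - {..<N}. u k = 0" "\<forall>k\<in>{..<max N L} - {..<L}. u k = 0"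
    using assms by auto
  have "(\<Sum>k<N. u k) = (\<Sum>k<max N L. u k)" by (rule sum.mono_neutral_left[OF _ _ zero(1)]) auto
  also have "\<dots> = (\<Sum>k<L. u k)" by (rule sum.mono_neutral_right[OF _ _ zero(2)]) auto
  finally show ?thesis .
qed

text \<open>No walk ever has more than L rows, so with L in place of N there is no restriction.
  Since the middle partition is the largest one, bounding its rows by N bounds them
  throughout.\<close>

lemma interlacing_walks_restrict:
  fixes \<mu> \<nu> :: "nat list"
  defines "L \<equiv> length \<mu> + length \<nu>"
  shows "{y \<in> nat_walks L \<mu> \<nu> (interlacing L). \<forall>k\<ge>N. y (length \<mu>) k = 0} = nat_walks N \<mu> \<nu> (interlacing N)"
proof (intro equalityI subsetI)
  have eq: "interlacing M r u v \<longleftrightarrow> interlacing M' r u v"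
    if "\<And>k. M \<le> k \<Longrightarrow> u k = 0" "\<And>k. M \<le> k \<Longrightarrow> v k = 0" "\<And>k. M' \<le> k \<Longrightarrow> u k = 0" "\<And>k. M' \<le> k \<Longrightarrow> v k = 0" for M M' r u v
    using sum_support_eq[of M u M', OF that(1,3)] sum_support_eq[of M v M', OF that(2,4)] by (simp add: interlacing_def)
  {
    fix y assume "y \<in> {y \<in> nat_walks L \<mu> \<nu> (interlacing L). \<forall>k\<ge>N. y (length \<mu>) k = 0}"
    then have y: "y \<in> nat_walks L \<mu> \<nu> (interlacing L)" and N: "\<And>k. N \<le> k \<Longrightarrow> y (length \<mu>) k = 0" by auto
    have yN: "N \<le> k \<Longrightarrow> y d k = 0" for d k using interlacing_walk_le_middle[OF y, of d k] N by simp
    have yL: "L \<le> k \<Longrightarrow> y d k = 0" for d k using nat_walksD(1)[OF y] .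
    show "y \<in> nat_walks N \<mu> \<nu> (interlacing N)"
      using y yN eq[of N "y d" "y d'" L for d d', OF yN yN yL yL] by (simp add: nat_walks_def)
  next
    fix y assume y: "y \<in> nat_walks N \<mu> \<nu> (interlacing N)"
    have yN: "N \<le> k \<Longrightarrow> y d k = 0" for d k using nat_walksD(1)[OF y] .
    have yL: "y d k = 0" if "L \<le> k" for d k
    proof -
      consider "d \<le> length \<mu>" | "length \<mu> \<le> d" "d \<le> L" | "L \<le> d" by linarith
      then show ?thesis
      proof cases
        case 1 then show ?thesis using interlacing_walk_support(1)[OF y, of d k] that by (simp add: L_def)
      next
        case 2 then show ?thesis using interlacing_walk_support(2)[OF y, of d k] that by (simp add: L_def)
      next
        case 3 then show ?thesis using nat_walksD(3)[OF y, of d k] by (simp add: L_def)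
      qed
    qed
    then show "y \<in> {y \<in> nat_walks L \<mu> \<nu> (interlacing L). \<forall>k\<ge>N. y (length \<mu>) k = 0}"
      using y yN eq[of N "y d" "y d'" L for d d', OF yN yN yL yL] by (simp add: nat_walks_def)
  }
qed

text \<open>Conjugate partition with parts indexed from 0; B has to be at least the number of rows
  and keeps the counted set finite.\<close>

definition conjugate :: "nat \<Rightarrow> (nat \<Rightarrow> nat) \<Rightarrow> nat \<Rightarrow> nat" where
  "conjugate B u k = card {m. m < B \<and> k < u m}"

text \<open>For weakly decreasing u the counted indices form an initial segment, so its size decides
  which cells belong to the diagram.\<close>

lemma conjugate_galois:
  assumes u: "antimono u" and B: "\<And>m. B \<le> m \<Longrightarrow> u m = 0"
  shows "m < conjugate B u k \<longleftrightarrow> k < u m"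
proof -
  let ?D = "{m. m < B \<and> k < u m}"
  have fin: "finite ?D" by simp
  show ?thesis
  proof
    assume "k < u m"
    have "{..m} \<subseteq> ?D"
    proof
      fix m' assume "m' \<in> {..m}"
      then have "u m \<le> u m'" using u by (auto simp: antimono_def)
      then show "m' \<in> ?D" using \<open>k < u m\<close> B[of m'] by (auto simp: not_le[symmetric])
    qed
    from card_mono[OF fin this] show "m < conjugate B u k" by (simp add: conjugate_def)
  next
    assume m: "m < conjugate B u k"
    show "k < u m"
    proof (rule ccontr)
      assume "\<not> k < u m"
      have "?D \<subseteq> {..<m}"
      proof
        fix m' assume "m' \<in> ?D"
        then have "\<not> m \<le> m'" using antimonoD[OF u, of m m'] \<open>\<not> k < u m\<close> by auto
        then show "m' \<in> {..<m}" by simp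
      qed
      from card_mono[OF _ this] m show False by (simp add: conjugate_def)
    qed
  qed
qed

lemma conjugate_antimono: "antimono (conjugate B u)"
  unfolding conjugate_def by (intro antimonoI card_mono) auto

lemma conjugate_conjugate:
  assumes u: "antimono u" and B: "\<And>m. B \<le> m \<Longrightarrow> u m = 0" and N: "\<And>m. u m \<le> N"
  shows "conjugate N (conjugate B u) = u"
proof
  fix m
  have "{k. k < N \<and> m < conjugate B u k} = {..<u m}"
    using N[of m] by (auto simp: conjugate_galois[OF u B])
  then show "conjugate N (conjugate B u) m = u m" by (simp add: conjugate_def)
qed

text \<open>Both sides count the cells of the diagram; N is large enough not to cut off any
  row.\<close>

lemma sum_conjugate:
  assumes N: "\<And>m. u m \<le> N"
  shows "(\<Sum>k<N. conjugate B u k) = (\<Sum>m<B. u m)"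
proof -
  have "(\<Sum>k<N. conjugate B u k) = (\<Sum>k<N. \<Sum>m<B. if k < u m then 1 else 0)"
    unfolding conjugate_def by (intro sum.cong refl) (simp add: sum.If_cases Int_def lessThan_def)
  also have "\<dots> = (\<Sum>m<B. \<Sum>k<N. if k < u m then 1 else 0)" by (rule sum.swap)
  also have "\<dots> = (\<Sum>m<B. u m)"
  proof (intro sum.cong refl)
    fix m
    have "{..<N} \<inter> {k. k < u m} = {..<u m}" using N[of m] by auto
    then show "(\<Sum>k<N. if k < u m then 1 else 0) = u m" by (simp add: sum.If_cases)
  qed
  finally show ?thesis .
qed

text \<open>Conjugation exchanges horizontal and vertical strips. The hypotheses are symmetric in u
  and u', so the lemma serves both for conjugating and for conjugating back.\<close>

lemma interlace_galois:
  fixes u v u' v' :: "nat \<Rightarrow> nat"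
  assumes u: "\<And>m k. m < u' k \<longleftrightarrow> k < u m" and v: "\<And>m k. m < v' k \<longleftrightarrow> k < v m"
  shows "(\<forall>m. u m \<le> v m \<and> v (Suc m) \<le> u m) \<longleftrightarrow> (\<forall>k. u' k \<le> v' k \<and> v' k \<le> Suc (u' k))"
proof
  assume a: "\<forall>m. u m \<le> v m \<and> v (Suc m) \<le> u m"
  show "\<forall>k. u' k \<le> v' k \<and> v' k \<le> Suc (u' k)"
  proof (intro allI conjI)
    fix k
    show "u' k \<le> v' k"
    proof (rule ccontr)
      assume "\<not> u' k \<le> v' k"
      then have "k < u (v' k)" using u[of "v' k" k] by simp
      then have "v' k < v' k" unfolding v using a by (meson less_le_trans)
      then show False by simp
    qed
    show "v' k \<le> Suc (u' k)"
    proof (rule ccontr)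
      assume "\<not> v' k \<le> Suc (u' k)"
      then have "k < v (Suc (u' k))" using v[of "Suc (u' k)" k] by simp
      then have "u' k < u' k" unfolding u using a by (meson less_le_trans)
      then show False by simp
    qed
  qed
next
  assume a: "\<forall>k. u' k \<le> v' k \<and> v' k \<le> Suc (u' k)"
  show "\<forall>m. u m \<le> v m \<and> v (Suc m) \<le> u m"
  proof (intro allI conjI)
    fix m
    show "u m \<le> v m"
    proof (rule ccontr)
      assume "\<not> u m \<le> v m"
      then have "m < u' (v m)" using u[of m "v m"] by simp
      then have "m < v' (v m)" using a by (meson less_le_trans)
      then show False using v[of m "v m"] by simp
    qed
    show "v (Suc m) \<le> u m"
    proof (rule ccontr)
      assume "\<not> v (Suc m) \<le> u m"
      then have "Suc m < v' (u m)" using v[of "Suc m" "u m"] by simp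
      also have "\<dots> \<le> Suc (u' (u m))" using a by blast
      finally show False using u[of m "u m"] by simp
    qed
  qed
qed

text \<open>A vertical strip raises each row by at most 1. Counting steps from the start or from the
  end bounds the parts, hence the rows of the conjugates.\<close>

lemma vertical_walk_bound:
  assumes y: "v \<in> nat_walks M \<mu> \<nu> (vertical M')"
  shows "v d k \<le> length \<mu> + length \<nu>"
proof -
  consider "d \<le> length \<mu>" | "length \<mu> \<le> d" "d \<le> length \<mu> + length \<nu>" | "length \<mu> + length \<nu> \<le> d" by linarith
  then show ?thesis
  proof cases
    case 1
    then have "v d k \<le> d"
    proof (induction d)
      case (Suc d)
      then show ?case using nat_walksD(4)[OF y, of d] by (auto simp: vertical_def intro: order_trans)
    qed (simp add: nat_walksD(2)[OF y])
    then show ?thesis using 1 by simp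
  next
    case 2
    from 2(2,1) have "v d k \<le> length \<mu> + length \<nu> - d"
    proof (induction rule: inc_induct)
      case (step m)
      have "v m k \<le> Suc (v (Suc m) k)" using nat_walksD(5)[OF y, of m] step by (simp add: vertical_def)
      then show ?case using step by simp
    qed (simp add: nat_walksD(3)[OF y])
    then show ?thesis by simp
  qed (simp add: nat_walksD(3)[OF y])
qed

lemma vertical_walk_antimono:
  assumes y: "y \<in> nat_walks M \<mu> \<nu> (vertical M')"
  shows "antimono (y d)"
proof -
  consider "d < length \<mu>" | "length \<mu> \<le> d" "d < length \<mu> + length \<nu>" | "length \<mu> + length \<nu> \<le> d" by linarith
  then show ?thesis
  proof cases
    case 1 then show ?thesis using nat_walksD(4)[OF y, of d] by (simp add: vertical_def)
  next
    case 2 then show ?thesis using nat_walksD(5)[OF y, of d] by (simp add: vertical_def)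
  qed (simp add: antimono_iff_le_Suc nat_walksD(3)[OF y])
qed

text \<open>Conjugation turns the bound N on the number of rows into a bound on the largest part,
  and the largest part of the whole walk is entry 0 of the middle partition.\<close>

lemma card_conjugate_walks:
  fixes \<mu> \<nu> :: "nat list"
  defines "L \<equiv> length \<mu> + length \<nu>"
  shows "card {y \<in> nat_walks L \<mu> \<nu> (interlacing L). y (length \<mu>) 0 \<le> N} = card (nat_walks N \<mu> \<nu> (vertical N))"
proof -
  let ?Y = "{y \<in> nat_walks L \<mu> \<nu> (interlacing L). y (length \<mu>) 0 \<le> N}"
  have "bij_betw (\<lambda>y d. conjugate L (y d)) ?Y (nat_walks N \<mu> \<nu> (vertical N))"
  proof (rule bij_betwI[where g = "\<lambda>v d. conjugate N (v d)"])
    have Y: "antimono (y d)" "\<And>k. L \<le> k \<Longrightarrow> y d k = 0" "\<And>k. y d k \<le> N" if "y \<in> ?Y" for y d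
    proof -
      have y: "y \<in> nat_walks L \<mu> \<nu> (interlacing L)" and N: "y (length \<mu>) 0 \<le> N" using that by auto
      show "antimono (y d)" by (rule interlacing_walk_antimono[OF y])
      show "L \<le> k \<Longrightarrow> y d k = 0" for k by (rule nat_walksD(1)[OF y])
      have "y d k \<le> y d 0" for k using \<open>antimono (y d)\<close> by (simp add: antimono_def)
      also have "y d 0 \<le> y (length \<mu>) 0" by (rule interlacing_walk_le_middle[OF y])
      finally show "y d k \<le> N" for k using N by (meson order_trans)
    qed
    have V: "antimono (v d)" "\<And>k. N \<le> k \<Longrightarrow> v d k = 0" "\<And>k. v d k \<le> L" if v: "v \<in> nat_walks N \<mu> \<nu> (vertical N)" for v d
      using vertical_walk_antimono[OF v] nat_walksD(1)[OF v] vertical_walk_bound[OF v] by (auto simp: L_def)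
    show "(\<lambda>y d. conjugate L (y d)) \<in> ?Y \<rightarrow> nat_walks N \<mu> \<nu> (vertical N)"
    proof
      fix y assume yY: "y \<in> ?Y"
      then have y: "y \<in> nat_walks L \<mu> \<nu> (interlacing L)" by simp
      have g: "m < conjugate L (y d) k \<longleftrightarrow> k < y d m" for d m k
        by (rule conjugate_galois[OF Y(1,2)[OF yY]])
      have rel: "vertical N r (conjugate L (y d)) (conjugate L (y d'))" if "interlacing L r (y d) (y d')" for r d d'
        using that conjugate_antimono sum_conjugate[of "y d" N L, OF Y(3)[OF yY]] sum_conjugate[of "y d'" N L, OF Y(3)[OF yY]]
          interlace_galois[of "conjugate L (y d)" "y d" "conjugate L (y d')" "y d'", OF g g]
        by (simp add: vertical_def interlacing_def)
      have z: "conjugate L (y d) k = 0" if "\<And>m. y d m \<le> k" for d k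
        using that by (simp add: conjugate_def not_less)
      show "(\<lambda>d. conjugate L (y d)) \<in> nat_walks N \<mu> \<nu> (vertical N)"
        unfolding nat_walks_def
        using nat_walksD(2-5)[OF y] rel z Y(3)[OF yY] by (auto intro!: z order_trans[OF Y(3)[OF yY]])
    qed
    show "(\<lambda>v d. conjugate N (v d)) \<in> nat_walks N \<mu> \<nu> (vertical N) \<rightarrow> ?Y"
    proof
      fix v assume v: "v \<in> nat_walks N \<mu> \<nu> (vertical N)"
      have rel: "interlacing L r (conjugate N (v d)) (conjugate N (v d'))" if "vertical N r (v d) (v d')" for r d d'
      proof -
        have g: "m < v d k \<longleftrightarrow> k < conjugate N (v d) m" for d m k
          by (rule conjugate_galois[OF V(1,2)[OF v], symmetric])
        show ?thesis
          using that sum_conjugate[of "v d" L N, OF V(3)[OF v]] sum_conjugate[of "v d'" L N, OF V(3)[OF v]]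
            interlace_galois[of "v d" "conjugate N (v d)" "v d'" "conjugate N (v d')", OF g g]
          by (simp add: vertical_def interlacing_def)
      qed
      have z: "conjugate N (v d) k = 0" if "\<And>m. v d m \<le> k" for d k
        using that by (simp add: conjugate_def not_less)
      have zs: "conjugate N (v d) k = 0" if "L \<le> k \<or> d = 0 \<or> length \<mu> + length \<nu> \<le> d" for d k
      proof (intro z)
        fix m show "v d m \<le> k" using that nat_walksD(2)[OF v, of m] nat_walksD(3)[OF v, of d m] V(3)[OF v, of d m] by auto
      qed
      have "conjugate N (v (length \<mu>)) 0 \<le> card {..<N}"
        unfolding conjugate_def by (rule card_mono) auto
      then have "conjugate N (v (length \<mu>)) 0 \<le> N" by simp
      moreover have "(\<lambda>d. conjugate N (v d)) \<in> nat_walks L \<mu> \<nu> (interlacing L)"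
        unfolding nat_walks_def
        using nat_walksD(4,5)[OF v] rel zs by auto
      ultimately show "(\<lambda>d. conjugate N (v d)) \<in> ?Y" by simp
    qed
    show "(\<lambda>d. conjugate N (conjugate L (y d))) = y" if "y \<in> ?Y" for y
      using conjugate_conjugate[OF Y[OF that]] by auto
    show "(\<lambda>d. conjugate L (conjugate N (v d))) = v" if "v \<in> nat_walks N \<mu> \<nu> (vertical N)" for v
      using conjugate_conjugate[OF V[OF that]] by auto
  qed
  then show ?thesis by (rule bij_betw_same_card)
qed

section \<open>Arrays\<close>

text \<open>Step \<open>d\<close> of the walk on the diagonals is the diagonal \<open>j - i = d - p\<close>; one of the two truncated
  differences is always \<open>0\<close>.\<close>

definition diagonals :: "nat \<Rightarrow> (nat \<Rightarrow> nat \<Rightarrow> nat) \<Rightarrow> nat \<Rightarrow> nat \<Rightarrow> nat" where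
  "diagonals p x d k = x (Suc k + (p - d)) (Suc k + (d - p))"

text \<open>Inverse of \<open>diagonals\<close>. Array indices start at 1 and positions on a
  diagonal at 0, so (i, j) is entry \<open>min i j - 1\<close> of diagonal \<open>p + j - i\<close>;
  as i \<le> p, that difference does not truncate.\<close>

definition undiagonals :: "nat \<Rightarrow> nat \<Rightarrow> (nat \<Rightarrow> nat \<Rightarrow> nat) \<Rightarrow> nat \<Rightarrow> nat \<Rightarrow> nat" where
  "undiagonals p q y i j = (if i \<in> {1..p} \<and> j \<in> {1..q} then y (p + j - i) (min i j - 1) else 0)"

lemma diagonal_sum_eq:
  assumes x: "is_array p q x" and L: "L \<ge> p + q"
  shows "diagonal_sum p q x (int d - int p) = (\<Sum>k<L. diagonals p x d k)"
proof -
  have "(\<Sum>k<L. diagonals p x d k) = (\<Sum>k | Suc k + (p - d) \<le> p \<and> Suc k + (d - p) \<le> q. diagonals p x d k)"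
  proof (rule sum.mono_neutral_right)
    show "\<forall>k\<in>{..<L} - {k. Suc k + (p - d) \<le> p \<and> Suc k + (d - p) \<le> q}. diagonals p x d k = 0"
      using x by (auto simp: diagonals_def is_array_def)
  qed (use L in auto)
  also have "\<dots> = diagonal_sum p q x (int d - int p)"
    unfolding diagonal_sum_def
    by (rule sum.reindex_bij_witness[where i = "\<lambda>(i, j). min i j - 1" and j = "\<lambda>k. (Suc k + (p - d), Suc k + (d - p))"])
       (auto simp: diagonals_def min_def split: if_splits)
  finally show ?thesis ..
qed

lemma partial_sums_iff:
  assumes "D 0 = (0 :: nat)"
  shows "(\<forall>r\<in>{1..length xs}. D r = sum_list (take r xs)) \<longleftrightarrow> (\<forall>r<length xs. D (Suc r) = D r + xs ! r)"
proof
  assume a: "\<forall>r\<in>{1..length xs}. D r = sum_list (take r xs)"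
  have "D r = sum_list (take r xs)" if "r \<le> length xs" for r
    using a assms that by (cases r) auto
  then show "\<forall>r<length xs. D (Suc r) = D r + xs ! r"
    by (simp add: take_Suc_conv_app_nth)
next
  assume a: "\<forall>r<length xs. D (Suc r) = D r + xs ! r"
  have "D r = sum_list (take r xs)" if "r \<le> length xs" for r
    using that
  proof (induction r)
    case (Suc r)
    then show ?case using a by (simp add: take_Suc_conv_app_nth)
  qed (use assms in simp)
  then show "\<forall>r\<in>{1..length xs}. D r = sum_list (take r xs)" by simp
qed

text \<open>Partial sums of parts become increments between neighbouring diagonals. The second
  family counts from the other end: s belongs to diagonal L - s, and diagonal L lies outside the
  array, so its sum is 0.\<close>

lemma diagonal_condition_iff:
  fixes \<mu> \<nu> :: "nat list"
  defines "L \<equiv> length \<mu> + length \<nu>"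
  assumes x: "is_array (length \<mu>) (length \<nu>) x"
  shows "diagonal_condition \<mu> \<nu> x \<longleftrightarrow>
    (\<forall>d<length \<mu>. (\<Sum>k<L. diagonals (length \<mu>) x (Suc d) k) = (\<Sum>k<L. diagonals (length \<mu>) x d k) + \<mu> ! d) \<and>
    (\<forall>d. length \<mu> \<le> d \<longrightarrow> d < L \<longrightarrow>
       (\<Sum>k<L. diagonals (length \<mu>) x d k) = (\<Sum>k<L. diagonals (length \<mu>) x (Suc d) k) + \<nu> ! (L - 1 - d))"
proof -
  let ?p = "length \<mu>" and ?q = "length \<nu>"
  define S where "S d = (\<Sum>k<L. diagonals ?p x d k)" for d
  have S: "diagonal_sum ?p ?q x (int d - int ?p) = S d" for d
    unfolding S_def by (rule diagonal_sum_eq[OF x]) (simp add: L_def)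
  have "S 0 = 0" "S L = 0"
    using x by (simp_all add: S_def diagonals_def is_array_def L_def)
  have 1: "(\<forall>r\<in>{1..?p}. diagonal_sum ?p ?q x (int r - int ?p) = sum_list (take r \<mu>)) \<longleftrightarrow> (\<forall>d<?p. S (Suc d) = S d + \<mu> ! d)"
    unfolding S by (rule partial_sums_iff) fact
  have "diagonal_sum ?p ?q x (int ?q - int s) = S (L - s)" if "s \<in> {1..?q}" for s
    using S[of "L - s"] that by (simp add: L_def of_nat_diff)
  then have "(\<forall>s\<in>{1..?q}. diagonal_sum ?p ?q x (int ?q - int s) = sum_list (take s \<nu>)) \<longleftrightarrow>
      (\<forall>s\<in>{1..?q}. S (L - s) = sum_list (take s \<nu>))" by simp
  also have "\<dots> \<longleftrightarrow> (\<forall>s<?q. S (L - Suc s) = S (L - s) + \<nu> ! s)"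
    by (rule partial_sums_iff) (simp add: \<open>S L = 0\<close>)
  also have "\<dots> \<longleftrightarrow> (\<forall>d. ?p \<le> d \<longrightarrow> d < L \<longrightarrow> S d = S (Suc d) + \<nu> ! (L - 1 - d))"
  proof (intro iffI allI impI)
    fix d assume a: "\<forall>s<?q. S (L - Suc s) = S (L - s) + \<nu> ! s" and d: "?p \<le> d" "d < L"
    have "L - 1 - d < ?q" "L - Suc (L - 1 - d) = d" "L - (L - 1 - d) = Suc d" using d by (auto simp: L_def)
    with a show "S d = S (Suc d) + \<nu> ! (L - 1 - d)" by metis
  next
    fix s assume a: "\<forall>d. ?p \<le> d \<longrightarrow> d < L \<longrightarrow> S d = S (Suc d) + \<nu> ! (L - 1 - d)" and s: "s < ?q"
    have "?p \<le> L - Suc s" "L - Suc s < L" "Suc (L - Suc s) = L - s" "L - 1 - (L - Suc s) = s" using s by (auto simp: L_def)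
    with a show "S (L - Suc s) = S (L - s) + \<nu> ! s" by metis
  qed
  finally show ?thesis unfolding diagonal_condition_def 1 S_def by simp
qed

definition diagonal_arrays :: "nat list \<Rightarrow> nat list \<Rightarrow> (nat \<Rightarrow> nat \<Rightarrow> nat) set" where
  "diagonal_arrays \<mu> \<nu> = {x. is_array (length \<mu>) (length \<nu>) x \<and>
     decreasing_array (length \<mu>) (length \<nu>) x \<and> diagonal_condition \<mu> \<nu> x}"

text \<open>The zeros outside the index range continue the decrease, so neighbours can be compared
  without an upper limit.\<close>

lemma decreasing_array_iff:
  assumes x: "is_array p q x"
  shows "decreasing_array p q x \<longleftrightarrow> (\<forall>i\<ge>1. \<forall>j\<ge>1. x (Suc i) j \<le> x i j \<and> x i (Suc j) \<le> x i j)"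
proof
  assume a: "decreasing_array p q x"
  show "\<forall>i\<ge>1. \<forall>j\<ge>1. x (Suc i) j \<le> x i j \<and> x i (Suc j) \<le> x i j"
  proof (intro allI impI conjI)
    fix i j :: nat assume ij: "1 \<le> i" "1 \<le> j"
    show "x (Suc i) j \<le> x i j"
    proof (cases "Suc i \<le> p \<and> j \<le> q")
      case True
      then show ?thesis using a ij unfolding decreasing_array_def by simp
    next
      case False
      then have "x (Suc i) j = 0" using x by (auto simp: is_array_def)
      then show ?thesis by simp
    qed
    show "x i (Suc j) \<le> x i j"
    proof (cases "i \<le> p \<and> Suc j \<le> q")
      case True
      then show ?thesis using a ij unfolding decreasing_array_def by simp
    next
      case False
      then have "x i (Suc j) = 0" using x by (auto simp: is_array_def)
      then show ?thesis by simp
    qed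
  qed
next
  assume a: "\<forall>i\<ge>1. \<forall>j\<ge>1. x (Suc i) j \<le> x i j \<and> x i (Suc j) \<le> x i j"
  have "x i j' \<le> x i j" if "1 \<le> i" "1 \<le> j" "j \<le> j'" for i j j'
    using that(3)
  proof (induction rule: dec_induct)
    case (step n) then show ?case using a that by (meson order_trans)
  qed simp
  moreover have "x i' j \<le> x i j" if "1 \<le> i" "1 \<le> j" "i \<le> i'" for i i' j
    using that(3)
  proof (induction rule: dec_induct)
    case (step n) then show ?case using a that by (meson order_trans)
  qed simp
  ultimately show "decreasing_array p q x" unfolding decreasing_array_def by simp
qed

lemma undiagonals_diagonals:
  assumes "is_array p q x"
  shows "undiagonals p q (diagonals p x) = x"
proof (intro ext)
  fix i j
  show "undiagonals p q (diagonals p x) i j = x i j"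
  proof (cases "i \<in> {1..p} \<and> j \<in> {1..q}")
    case True
    then have "Suc (min i j - 1) + (p - (p + j - i)) = i" "Suc (min i j - 1) + (p + j - i - p) = j" by auto
    then have "diagonals p x (p + j - i) (min i j - 1) = x i j" unfolding diagonals_def by (simp only:)
    then show ?thesis using True by (simp add: undiagonals_def)
  next
    case False
    then show ?thesis using assms by (auto simp: undiagonals_def is_array_def)
  qed
qed

text \<open>The array keeps only the entries of the walk that fall inside the rectangle. The others
  are 0: there are at most d rows on the way up and L - d on the way down, and the middle partition
  dominates all.\<close>

lemma diagonals_undiagonals:
  fixes \<mu> \<nu> :: "nat list"
  defines "L \<equiv> length \<mu> + length \<nu>"
  assumes y: "y \<in> nat_walks L \<mu> \<nu> (interlacing L)"
  shows "diagonals (length \<mu>) (undiagonals (length \<mu>) (length \<nu>) y) = y"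
proof (intro ext)
  fix d k
  let ?p = "length \<mu>" and ?q = "length \<nu>"
  show "diagonals ?p (undiagonals ?p ?q y) d k = y d k"
  proof (cases "Suc k + (?p - d) \<le> ?p \<and> Suc k + (d - ?p) \<le> ?q")
    case True
    then have "?p + (Suc k + (d - ?p)) - (Suc k + (?p - d)) = d" "min (Suc k + (?p - d)) (Suc k + (d - ?p)) - 1 = k"
      by auto
    then show ?thesis using True by (simp add: diagonals_def undiagonals_def)
  next
    case False
    have le: "y d k \<le> y ?p k" by (rule interlacing_walk_le_middle[OF y])
    have mid: "y ?p k = 0" if "?p \<le> k \<or> ?q \<le> k"
      using that interlacing_walk_support(1)[OF y, of ?p k] interlacing_walk_support(2)[OF y, of ?p k] by auto
    have "y d k = 0"
    proof (cases "d \<le> ?p")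
      case True
      then have "d \<le> k \<or> ?q \<le> k" using False by auto
      then show ?thesis using interlacing_walk_support(1)[OF y True] mid le by auto
    next
      case d: False
      then have "?p \<le> k \<or> L - d \<le> k" using False by (auto simp: L_def)
      then show ?thesis
        using interlacing_walk_support(2)[OF y, of d k] nat_walksD(3)[OF y, of d k] mid le d
        by (cases "d \<le> ?p + ?q") (auto simp: L_def)
    qed
    then show ?thesis using False by (auto simp: diagonals_def undiagonals_def)
  qed
qed

text \<open>Below the main diagonal, entry k of a diagonal has entry k of the next one above it and
  entry k + 1 to its right; from the main diagonal on, entry k is to its right and entry k - 1 above
  it. So decrease along rows and columns is interlacing, rising up to the main diagonal and falling
  after it.\<close>

lemma bij_diagonals:
  fixes \<mu> \<nu> :: "nat list"
  defines "L \<equiv> length \<mu> + length \<nu>"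
  shows "bij_betw (diagonals (length \<mu>)) (diagonal_arrays \<mu> \<nu>) (nat_walks L \<mu> \<nu> (interlacing L))"
proof (rule bij_betwI[where g = "undiagonals (length \<mu>) (length \<nu>)"])
  let ?p = "length \<mu>" and ?q = "length \<nu>"
  show "diagonals ?p \<in> diagonal_arrays \<mu> \<nu> \<rightarrow> nat_walks L \<mu> \<nu> (interlacing L)"
  proof
    fix x assume "x \<in> diagonal_arrays \<mu> \<nu>"
    then have x: "is_array ?p ?q x" and dec: "decreasing_array ?p ?q x" and cond: "diagonal_condition \<mu> \<nu> x"
      by (auto simp: diagonal_arrays_def)
    have m: "x (Suc i) j \<le> x i j \<and> x i (Suc j) \<le> x i j" if "1 \<le> i" "1 \<le> j" for i j
      using decreasing_array_iff[OF x] dec that by blast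
    have z: "diagonals ?p x d k = 0" if "L \<le> k \<or> d = 0 \<or> L \<le> d" for d k
    proof -
      have "?p < Suc k + (?p - d) \<or> ?q < Suc k + (d - ?p)" using that by (auto simp: L_def)
      then show ?thesis using x unfolding diagonals_def is_array_def by (meson atLeastAtMost_iff not_less)
    qed
    have up: "diagonals ?p x d k \<le> diagonals ?p x (Suc d) k \<and> diagonals ?p x (Suc d) (Suc k) \<le> diagonals ?p x d k"
      if "d < ?p" for d k
      using m[of "Suc k + (?p - Suc d)" "Suc k"] m[of "Suc k + (?p - d)" "Suc k"] that
      by (simp add: diagonals_def Suc_diff_Suc)
    have down: "diagonals ?p x (Suc d) k \<le> diagonals ?p x d k \<and> diagonals ?p x d (Suc k) \<le> diagonals ?p x (Suc d) k"
      if "?p \<le> d" for d k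
      using m[of "Suc k" "Suc k + (d - ?p)"] m[of "Suc k" "Suc (Suc k + (d - ?p))"] that
      by (simp add: diagonals_def Suc_diff_le)
    show "diagonals ?p x \<in> nat_walks L \<mu> \<nu> (interlacing L)"
      using cond[unfolded diagonal_condition_iff[OF x]] z up down
      unfolding nat_walks_def interlacing_def L_def by auto
  qed
  show "undiagonals ?p ?q \<in> nat_walks L \<mu> \<nu> (interlacing L) \<rightarrow> diagonal_arrays \<mu> \<nu>"
  proof
    fix y assume y: "y \<in> nat_walks L \<mu> \<nu> (interlacing L)"
    let ?x = "undiagonals ?p ?q y"
    have x: "is_array ?p ?q ?x" by (auto simp: is_array_def undiagonals_def)
    have up: "y d k \<le> y (Suc d) k \<and> y (Suc d) (Suc k) \<le> y d k" if "d < ?p" for d k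
      using nat_walksD(4)[OF y that] by (simp add: interlacing_def)
    have down: "y (Suc d) k \<le> y d k \<and> y d (Suc k) \<le> y (Suc d) k" if "?p \<le> d" "d < ?p + ?q" for d k
      using nat_walksD(5)[OF y that] by (simp add: interlacing_def)
    have "?x (Suc i) j \<le> ?x i j \<and> ?x i (Suc j) \<le> ?x i j" if ij: "1 \<le> i" "1 \<le> j" for i j
    proof
      show "?x (Suc i) j \<le> ?x i j"
      proof (cases "Suc i \<le> ?p \<and> j \<le> ?q")
        case True
        define d where "d = ?p + j - Suc i"
        have d: "?p + j - i = Suc d" using True unfolding d_def by linarith
        have xs: "?x (Suc i) j = y d (min (Suc i) j - 1)" "?x i j = y (Suc d) (min i j - 1)"
          using True ij d by (simp_all add: undiagonals_def d_def)
        \<comment> \<open>For j \<le> i both cells lie where the walk still adds strips, otherwise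
          where it removes them.\<close>
        show ?thesis
        proof (cases "j \<le> i")
          case ji: True
          then have "d < ?p" using True ij unfolding d_def by linarith+
          from up[OF this, of "j - 1"] ji show ?thesis unfolding xs by (simp add: min_def)
        next
          case False
          then have "?p \<le> d" "d < ?p + ?q" using True ij unfolding d_def by linarith+
          from down[OF this, of "i - 1"] False ij show ?thesis unfolding xs by (simp add: min_def)
        qed
      next
        case False
        then have "?x (Suc i) j = 0" by (auto simp: undiagonals_def)
        then show ?thesis by simp
      qed
      show "?x i (Suc j) \<le> ?x i j"
      proof (cases "i \<le> ?p \<and> Suc j \<le> ?q")
        case True
        define d where "d = ?p + j - i"
        have d: "?p + Suc j - i = Suc d" using True unfolding d_def by linarith
        have xs: "?x i (Suc j) = y (Suc d) (min i (Suc j) - 1)" "?x i j = y d (min i j - 1)"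
          using True ij d by (simp_all add: undiagonals_def d_def)
        show ?thesis
        proof (cases "i \<le> j")
          case le: True
          then have "?p \<le> d" "d < ?p + ?q" using True ij unfolding d_def by linarith+
          from down[OF this, of "i - 1"] le show ?thesis unfolding xs by (simp add: min_def)
        next
          case False
          then have "d < ?p" using True ij unfolding d_def by linarith+
          moreover have "min i (Suc j) = Suc j" "min i j = j" using False by auto
          ultimately show ?thesis using up[of d "j - 1"] ij unfolding xs by simp
        qed
      next
        case False
        then have "?x i (Suc j) = 0" by (auto simp: undiagonals_def)
        then show ?thesis by simp
      qed
    qed
    then have "decreasing_array ?p ?q ?x" using decreasing_array_iff[OF x] by blast
    moreover have "diagonal_condition \<mu> \<nu> ?x"
      unfolding diagonal_condition_iff[OF x] diagonals_undiagonals[OF y[unfolded L_def]]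
      using nat_walksD(4,5)[OF y] by (simp add: interlacing_def L_def)
    ultimately show "?x \<in> diagonal_arrays \<mu> \<nu>" using x by (simp add: diagonal_arrays_def)
  qed
  show "undiagonals ?p ?q (diagonals ?p x) = x" if "x \<in> diagonal_arrays \<mu> \<nu>" for x
    using that by (simp add: diagonal_arrays_def undiagonals_diagonals)
  show "diagonals ?p (undiagonals ?p ?q y) = y" if "y \<in> nat_walks L \<mu> \<nu> (interlacing L)" for y
    using diagonals_undiagonals that unfolding L_def by blast
qed

lemma bij_betw_restrict_pred:
  assumes "bij_betw f A B" "\<And>x. x \<in> A \<Longrightarrow> P x \<longleftrightarrow> Q (f x)"
  shows "bij_betw f {x \<in> A. P x} {y \<in> B. Q y}"
  using assms by (auto simp: bij_betw_def inj_on_def)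

text \<open>\<open>x 1 1\<close> is entry 0 of the main diagonal, hence the largest part of the
  middle partition; conjugation makes it a number of rows.\<close>

lemma card_secular_arrays:
  "card (secular_arrays N \<mu> \<nu>) = card (nat_walks N \<mu> \<nu> (vertical N))"
proof -
  let ?L = "length \<mu> + length \<nu>"
  have arrays: "secular_arrays N \<mu> \<nu> = {x \<in> diagonal_arrays \<mu> \<nu>. x 1 1 \<le> N}"
    by (auto simp: secular_arrays_def diagonal_arrays_def)
  have "card (secular_arrays N \<mu> \<nu>) = card {y \<in> nat_walks ?L \<mu> \<nu> (interlacing ?L). y (length \<mu>) 0 \<le> N}"
    unfolding arrays
    by (rule bij_betw_same_card, rule bij_betw_restrict_pred[OF bij_diagonals]) (simp add: diagonals_def)
  also have "\<dots> = card (nat_walks N \<mu> \<nu> (vertical N))" by (rule card_conjugate_walks)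
  finally show ?thesis .
qed

text \<open>The main diagonal is the middle partition of the walk, so its vanishing beyond N means
  at most N rows.\<close>

lemma card_sym_arrays:
  "card (sym_arrays N \<mu> \<nu>) = card (nat_walks N \<mu> \<nu> (interlacing N))"
proof -
  let ?L = "length \<mu> + length \<nu>"
  have arrays: "sym_arrays N \<mu> \<nu> = {x \<in> diagonal_arrays \<mu> \<nu>. \<forall>i\<in>{N + 1..min (length \<mu>) (length \<nu>)}. x i i = 0}"
    by (auto simp: sym_arrays_def diagonal_arrays_def)
  have "card (sym_arrays N \<mu> \<nu>) = card {y \<in> nat_walks ?L \<mu> \<nu> (interlacing ?L). \<forall>k\<ge>N. y (length \<mu>) k = 0}"
    unfolding arrays
  proof (rule bij_betw_same_card, rule bij_betw_restrict_pred[OF bij_diagonals])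
    fix x assume "x \<in> diagonal_arrays \<mu> \<nu>"
    then have x: "is_array (length \<mu>) (length \<nu>) x" by (simp add: diagonal_arrays_def)
    have zero: "x (Suc k) (Suc k) = 0" if "\<not> Suc k \<le> min (length \<mu>) (length \<nu>)" for k
      using x that by (auto simp: is_array_def)
    show "(\<forall>i\<in>{N + 1..min (length \<mu>) (length \<nu>)}. x i i = 0) \<longleftrightarrow> (\<forall>k\<ge>N. diagonals (length \<mu>) x (length \<mu>) k = 0)"
    proof (intro iffI allI ballI impI)
      fix k assume a: "\<forall>i\<in>{N + 1..min (length \<mu>) (length \<nu>)}. x i i = 0" and k: "N \<le> k"
      show "diagonals (length \<mu>) x (length \<mu>) k = 0"
        using a[rule_format, of "Suc k"] zero[of k] k by (cases "Suc k \<le> min (length \<mu>) (length \<nu>)") (auto simp: diagonals_def)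
    next
      fix i assume a: "\<forall>k\<ge>N. diagonals (length \<mu>) x (length \<mu>) k = 0" and i: "i \<in> {N + 1..min (length \<mu>) (length \<nu>)}"
      have "N \<le> i - 1" "Suc (i - 1) = i" using i by auto
      then show "x i i = 0" using a[rule_format, of "i - 1"] by (simp add: diagonals_def)
    qed
  qed
  also have "\<dots> = card (nat_walks N \<mu> \<nu> (interlacing N))"
    by (rule arg_cong[of _ _ card]) (rule interlacing_walks_restrict)
  finally show ?thesis .
qed

theorem proposition4p3:
  fixes M :: "(complex^'n^'n) measure"
    and l :: nat and a b :: "nat \<Rightarrow> nat" and \<mu> \<nu> :: "nat list"
  assumes "haar_unitary M"
    and "partition_with_mults l a \<mu>"
    and "partition_with_mults l b \<nu>"
  shows "(\<integral>U. (\<Prod>j=1..l. secular j U ^ a j * cnj (secular j U ^ b j)) \<partial>M)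
           = of_nat (card (secular_arrays CARD('n) \<mu> \<nu>)) \<and>
         (\<integral>U. (\<Prod>j=1..l. tr_sym j U ^ a j * cnj (tr_sym j U ^ b j)) \<partial>M)
           = of_nat (card (sym_arrays CARD('n) \<mu> \<nu>))"
  unfolding card_secular_arrays card_sym_arrays
  using integral_secular_walks[OF assms] integral_tr_sym_walks[OF assms] by blast

end
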